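(* Let $T>0$ and let $G\subset[0,T]\times[0,2\pi]$ be a measurable set. Then the following are equivalent: (1) (Unique continuation on $G$) for every $(u_0,u_1)\in H^1(\mathbb{T})\times L^2(\mathbb{T})$, if the solution $u$ of $(\partial_t^2-\partial_x^2)u=0$, $(u,\partial_t u)|_{t=0}=(u_0,u_1)$, satisfies $\partial_t u=0$ a.e. in $G$, then $u$ is constant; (2) $G$ satisfies both (OSC) and (weak GCC).
   Context: $\mathbb{T}=\mathbb{R}/2\pi\mathbb{Z}$, and functions on $\mathbb{T}$ are identified with $2\pi$-periodic functions on $\mathbb{R}$. Functions are real-valued. The solution $u$ is the unique one with $(u,\partial_t u)\in C([0,T];H^1(\mathbb{T})\times L^2(\mathbb{T}))$. Points $(t,x)$ have time coordinate $t$ first. $|A|$ is Lebesgue measure of $A\subset\mathbb{R}$; $\mathrm{meas}_{\mathbb{R}}$ of a subset of lines in the plane is one-dimensional Lebesgue (arclength) measure; $\mathrm{meas}_{\mathbb{R}^2}$ is planar Lebesgue measure. For $x_0\in\mathbb{R}$ set $L_{\xi=x_0}=\bigcup_{k\in\mathbb{Z}}\{(t,x):x+t=x_0+2k\pi\}$ and $L_{\eta=x_0}=\bigcup_{k\in\mathbb{Z}}\{(t,x):x-t=x_0+2k\pi\}$. (weak GCC): a measurable $G\subset[0,T]\times[0,2\pi]$ satisfies (weak GCC) if for almost every $x\in[0,2\pi]$, $\mathrm{meas}_{\mathbb{R}}(G\cap L_{\xi=x})>0$ and $\mathrm{meas}_{\mathbb{R}}(G\cap L_{\eta=x})>0$.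 For measurable $A,B\subset[0,2\pi]$ and $T\geq 0$ set $$L_{\xi\in A}^T=\{(t,x)\in[0,T]\times\mathbb{R}:\ x+t\in A+2\pi\mathbb{Z}\},\qquad L_{\eta\in B}^T=\{(t,x)\in[0,T]\times\mathbb{R}:\ x-t\in B+2\pi\mathbb{Z}\}.$$ $G$ is $(A,B;T)$-observable symmetric if $\mathrm{meas}_{\mathbb{R}^2}\big([G\cap L_{\xi\in A}^T]\,\Delta\,[G\cap L_{\eta\in B}^T]\big)=0$, where $\Delta$ is the symmetric difference. A pair $(A,B)$ is trivial if $|A|=|B|=0$ or $|A|=|B|=2\pi$, and non-trivial otherwise. (OSC): $G$ satisfies (OSC) if for every non-trivial pair $(A,B)$ of measurable subsets of $[0,2\pi]$, $G$ is not $(A,B;T)$-observable symmetric. *)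

theory Defs
  imports "HOL-Analysis.Analysis"
begin

section \<open>Smooth functions\<close>

definition dir_deriv :: "'a::euclidean_space \<Rightarrow> ('a \<Rightarrow> real) \<Rightarrow> 'a \<Rightarrow> real" where
  "dir_deriv b f = (\<lambda>p. frechet_derivative f (at p) b)"

primrec Ck :: "nat \<Rightarrow> ('a::euclidean_space \<Rightarrow> real) \<Rightarrow> bool" where
  "Ck 0 f \<longleftrightarrow> continuous_on UNIV f"
| "Ck (Suc k) f \<longleftrightarrow> (\<forall>p. f differentiable (at p)) \<and> (\<forall>b\<in>Basis. Ck k (dir_deriv b f))"

definition smooth :: "('a::euclidean_space \<Rightarrow> real) \<Rightarrow> bool" where
  "smooth f \<longleftrightarrow> (\<forall>k. Ck k f)"

text \<open>A point of space-time is a pair \<open>(t, x)\<close>, time first.\<close>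

abbreviation d_t :: "(real \<times> real \<Rightarrow> real) \<Rightarrow> real \<times> real \<Rightarrow> real" where
  "d_t \<equiv> dir_deriv (1, 0)"

abbreviation d_x :: "(real \<times> real \<Rightarrow> real) \<Rightarrow> real \<times> real \<Rightarrow> real" where
  "d_x \<equiv> dir_deriv (0, 1)"


section \<open>The spaces \<open>L\<^sup>2\<close> and \<open>H\<^sup>1\<close> of the circle\<close>

text \<open>
  Functions on the circle are \<open>2 * pi\<close>-periodic functions on the line. Elements of the function
  spaces are represented by arbitrary members of their almost-everywhere classes, so that equality
  of elements is equality almost everywhere.
\<close>

definition periodic :: "(real \<Rightarrow> 'b) \<Rightarrow> bool" where
  "periodic f \<longleftrightarrow> (\<forall>x. f (x + 2 * pi) = f x)"

definition L2 :: "(real \<Rightarrow> real) set" where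
  "L2 = {f. periodic f \<and> f \<in> borel_measurable lebesgue \<and>
            integrable (lebesgue_on {0..2 * pi}) (\<lambda>x. (f x)\<^sup>2)}"

definition L2_norm :: "(real \<Rightarrow> real) \<Rightarrow> real" where
  "L2_norm f = sqrt (integral\<^sup>L (lebesgue_on {0..2 * pi}) (\<lambda>x. (f x)\<^sup>2))"

definition has_weak_deriv :: "(real \<Rightarrow> real) \<Rightarrow> (real \<Rightarrow> real) \<Rightarrow> bool" where
  "has_weak_deriv f g \<longleftrightarrow>
     (\<forall>\<phi>. smooth \<phi> \<and> periodic \<phi> \<longrightarrow>
        integral\<^sup>L (lebesgue_on {0..2 * pi}) (\<lambda>x. f x * deriv \<phi> x) =
        - integral\<^sup>L (lebesgue_on {0..2 * pi}) (\<lambda>x. g x * \<phi> x))"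

definition H1 :: "(real \<Rightarrow> real) set" where
  "H1 = {f \<in> L2. \<exists>g\<in>L2. has_weak_deriv f g}"

text \<open>The choice is immaterial for the norm: a weak derivative is unique almost everywhere.\<close>

definition weak_deriv :: "(real \<Rightarrow> real) \<Rightarrow> real \<Rightarrow> real" where
  "weak_deriv f = (SOME g. g \<in> L2 \<and> has_weak_deriv f g)"

definition H1_norm :: "(real \<Rightarrow> real) \<Rightarrow> real" where
  "H1_norm f = sqrt ((L2_norm f)\<^sup>2 + (L2_norm (weak_deriv f))\<^sup>2)"

text \<open>Continuous curves on \<open>[0,T]\<close> in a space \<open>X\<close> of functions with (semi)norm \<open>N\<close>.\<close>

definition continuous_curve ::
    "real \<Rightarrow> (real \<Rightarrow> real) set \<Rightarrow> ((real \<Rightarrow> real) \<Rightarrow> real) \<Rightarrow> (real \<Rightarrow> real \<Rightarrow> real) \<Rightarrow> bool" where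
  "continuous_curve T X N u \<longleftrightarrow>
     (\<forall>t\<in>{0..T}. u t \<in> X) \<and>
     (\<forall>t\<in>{0..T}. ((\<lambda>s. N (\<lambda>x. u s x - u t x)) \<longlongrightarrow> 0) (at t within {0..T}))"


section \<open>Solutions of the wave equation\<close>

text \<open>Test functions on \<open>(0,T)\<close> times the circle.\<close>

definition test_fun :: "real \<Rightarrow> (real \<times> real \<Rightarrow> real) \<Rightarrow> bool" where
  "test_fun T \<phi> \<longleftrightarrow>
     smooth \<phi> \<and> (\<forall>t. periodic (\<lambda>x. \<phi> (t, x))) \<and>
     (\<exists>a b. 0 < a \<and> b < T \<and> (\<forall>t x. t \<notin> {a..b} \<longrightarrow> \<phi> (t, x) = 0))"

definition cyl_pairing :: "real \<Rightarrow> (real \<Rightarrow> real \<Rightarrow> real) \<Rightarrow> (real \<times> real \<Rightarrow> real) \<Rightarrow> real" where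
  "cyl_pairing T w \<phi> =
     integral\<^sup>L (lebesgue_on ({0..T} \<times> {0..2 * pi})) (\<lambda>p. w (fst p) (snd p) * \<phi> p)"

text \<open>
  Curves in \<open>L\<^sup>2\<close> determine an almost-everywhere class of functions on space-time only through a
  jointly measurable representative; this is why joint measurability is required below.
\<close>

definition jointly_measurable :: "real \<Rightarrow> (real \<Rightarrow> real \<Rightarrow> real) \<Rightarrow> bool" where
  "jointly_measurable T w \<longleftrightarrow>
     (\<lambda>p. w (fst p) (snd p)) \<in> borel_measurable (lebesgue_on ({0..T} \<times> UNIV))"

text \<open>
  \<open>v\<close> is the time derivative of \<open>u\<close>; it and the wave equation are understood in the sense of
  distributions, and the initial condition through the continuity in time of \<open>(u, v)\<close>.
\<close>

definition wave_solution ::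
    "real \<Rightarrow> (real \<Rightarrow> real) \<Rightarrow> (real \<Rightarrow> real) \<Rightarrow> (real \<Rightarrow> real \<Rightarrow> real) \<Rightarrow> (real \<Rightarrow> real \<Rightarrow> real) \<Rightarrow> bool"
  where
  "wave_solution T u0 u1 u v \<longleftrightarrow>
     jointly_measurable T u \<and> jointly_measurable T v \<and>
     continuous_curve T H1 H1_norm u \<and> continuous_curve T L2 L2_norm v \<and>
     (\<forall>\<phi>. test_fun T \<phi> \<longrightarrow> cyl_pairing T u (d_t \<phi>) = - cyl_pairing T v \<phi>) \<and>
     (\<forall>\<phi>. test_fun T \<phi> \<longrightarrow> cyl_pairing T u (\<lambda>p. d_t (d_t \<phi>) p - d_x (d_x \<phi>) p) = 0) \<and>
     (AE x in lebesgue. u 0 x = u0 x) \<and> (AE x in lebesgue. v 0 x = u1 x)"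

definition unique_continuation :: "real \<Rightarrow> (real \<times> real) set \<Rightarrow> bool" where
  "unique_continuation T G \<longleftrightarrow>
     (\<forall>u0\<in>H1. \<forall>u1\<in>L2. \<forall>u v.
        wave_solution T u0 u1 u v \<longrightarrow>
        (AE p in lebesgue. p \<in> G \<longrightarrow> v (fst p) (snd p) = 0) \<longrightarrow>
        (\<exists>c. \<forall>t\<in>{0..T}. AE x in lebesgue. u t x = c))"


section \<open>The weak geometric control condition\<close>

definition L_xi :: "real \<Rightarrow> (real \<times> real) set" where
  "L_xi x0 = (\<Union>k::int. {(t, x). x + t = x0 + 2 * of_int k * pi})"

definition L_eta :: "real \<Rightarrow> (real \<times> real) set" where
  "L_eta x0 = (\<Union>k::int. {(t, x). x - t = x0 + 2 * of_int k * pi})"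

text \<open>Arclength measure of the part of \<open>S\<close> on the line through \<open>p\<close> with unit direction \<open>d\<close>.\<close>

definition line_measure :: "real \<times> real \<Rightarrow> real \<times> real \<Rightarrow> (real \<times> real) set \<Rightarrow> ennreal" where
  "line_measure p d S = emeasure lebesgue {s. p + s *\<^sub>R d \<in> S}"

text \<open>
  The disjoint lines making up \<open>L_xi x0\<close> and \<open>L_eta x0\<close> meet the axis \<open>t = 0\<close> at the points
  \<open>x0 + 2 * k * pi\<close>.
\<close>

definition meas_L_xi :: "real \<Rightarrow> (real \<times> real) set \<Rightarrow> ennreal" where
  "meas_L_xi x0 S =
     (\<Sum>\<^sub>\<infinity>k::int. line_measure (0, x0 + 2 * of_int k * pi) (1 / sqrt 2, - 1 / sqrt 2) S)"

definition meas_L_eta :: "real \<Rightarrow> (real \<times> real) set \<Rightarrow> ennreal" where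
  "meas_L_eta x0 S =
     (\<Sum>\<^sub>\<infinity>k::int. line_measure (0, x0 + 2 * of_int k * pi) (1 / sqrt 2, 1 / sqrt 2) S)"

definition weak_GCC :: "(real \<times> real) set \<Rightarrow> bool" where
  "weak_GCC G \<longleftrightarrow>
     (AE x in lebesgue. x \<in> {0..2 * pi} \<longrightarrow>
        meas_L_xi x (G \<inter> L_xi x) > 0 \<and> meas_L_eta x (G \<inter> L_eta x) > 0)"


section \<open>Observable symmetry\<close>

definition L_xi_set :: "real \<Rightarrow> real set \<Rightarrow> (real \<times> real) set" where
  "L_xi_set T A = {(t, x). t \<in> {0..T} \<and> (\<exists>a\<in>A. \<exists>k::int. x + t = a + 2 * pi * of_int k)}"

definition L_eta_set :: "real \<Rightarrow> real set \<Rightarrow> (real \<times> real) set" where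
  "L_eta_set T B = {(t, x). t \<in> {0..T} \<and> (\<exists>b\<in>B. \<exists>k::int. x - t = b + 2 * pi * of_int k)}"

definition observable_symmetric ::
    "real set \<Rightarrow> real set \<Rightarrow> real \<Rightarrow> (real \<times> real) set \<Rightarrow> bool" where
  "observable_symmetric A B T G \<longleftrightarrow>
     sym_diff (G \<inter> L_xi_set T A) (G \<inter> L_eta_set T B) \<in> null_sets lebesgue"

definition trivial_pair :: "real set \<Rightarrow> real set \<Rightarrow> bool" where
  "trivial_pair A B \<longleftrightarrow>
     (measure lebesgue A = 0 \<and> measure lebesgue B = 0) \<or>
     (measure lebesgue A = 2 * pi \<and> measure lebesgue B = 2 * pi)"

definition OSC :: "real \<Rightarrow> (real \<times> real) set \<Rightarrow> bool" where
  "OSC T G \<longleftrightarrow>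
     (\<forall>A B. A \<in> sets lebesgue \<and> A \<subseteq> {0..2 * pi} \<and> B \<in> sets lebesgue \<and> B \<subseteq> {0..2 * pi} \<and>
            \<not> trivial_pair A B \<longrightarrow> \<not> observable_symmetric A B T G)"

end

theory Submission
  imports Defs "HOL-Computational_Algebra.Polynomial"
begin

text \<open>
  Testing a solution against \<open>\<theta> t * \<psi> (x + s * t)\<close> with \<open>s = 1\<close> or \<open>s = -1\<close> shows that
  \<open>\<partial>\<^sub>t u + s * \<partial>\<^sub>x u\<close> is transported along characteristics, so \<open>\<partial>\<^sub>t u = f (x + t) - g (x - t)\<close> and
  \<open>\<partial>\<^sub>x u = f (x + t) + g (x - t)\<close>, where \<open>f + g\<close> has mean zero. If \<open>\<partial>\<^sub>t u = 0\<close> on \<open>G\<close>, then each pair of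
  superlevel sets \<open>{f > c}\<close>, \<open>{g > c}\<close> is observable symmetric; under (OSC) these pairs are trivial, so
  \<open>f\<close> and \<open>g\<close> equal the same constant, which vanishes because of the mean.

  Conversely, an observable symmetric pair \<open>(A, B)\<close> yields a solution with \<open>f = 1\<^sub>A - m\<close> and
  \<open>g = 1\<^sub>B - m\<close>, where \<open>m\<close> makes the mean of \<open>f + g\<close> vanish; it satisfies \<open>\<partial>\<^sub>t u = 0\<close> on \<open>G\<close>, so
  by unique continuation \<open>1\<^sub>A = m = 1\<^sub>B\<close> almost everywhere.

  The weak geometric control condition follows from (OSC): if the characteristics starting in \<open>A\<close>
  miss \<open>G\<close>, then the pair \<open>(A, {})\<close> or \<open>({}, A)\<close> is observable symmetric.
\<close>

section \<open>Smooth functions\<close>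

text \<open>A solution is given only as a pair of curves satisfying the equation against test
  functions. Nothing can be differentiated pointwise, so each identity is an integral identity that
  a fundamental lemma turns into an almost everywhere one. For the travelling test functions the
  terms containing the second derivative of \<psi> cancel because \<open>s * s = 1\<close>; what
  survives says that a continuous function of time is orthogonal to every \<theta>', hence constant.
  Two technical obstacles shape the proof. A statement for each t and almost every x becomes a
  statement on the plane only through joint measurability; and \<open>lebesgue\<close> on the plane
  is a completion, so Fubini's theorem and the changes of variables pass through Borel
  representatives. The set G only sees the equality f (x + t) = g (x - t). Therefore f and g are cut
  at the same level c, and a constant common to both is invisible to the time derivative; only the
  mean of the space derivative can fix it. In the converse direction the profiles are bounded but
  discontinuous. The solution is then merely Lipschitz, and it is handled through integration by
  parts for primitives and the continuity of translations in the mean.\<close>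

lemma dir_deriv_eq:
  assumes "(f has_derivative f') (at p)"
  shows "dir_deriv b f p = f' b"
  using frechet_derivative_at[OF assms] by (simp add: dir_deriv_def)

lemma dir_deriv_real: "f differentiable (at x) \<Longrightarrow> dir_deriv 1 f x = deriv f (x::real)"
  by (metis DERIV_imp_deriv dir_deriv_def frechet_derivative_works has_field_derivative_iff
      has_field_derivative_def differentiable_def dir_deriv_eq mult.right_neutral
      real_differentiable_def)

lemma Ck_differentiable: "Ck (Suc k) f \<Longrightarrow> f differentiable (at p)"
  by simp

lemma Ck_continuous_on: "Ck k f \<Longrightarrow> continuous_on UNIV f"
  by (cases k) (auto intro!: differentiable_imp_continuous_on differentiable_at_imp_differentiable_on)

lemma Ck_Suc_imp_Ck: "Ck (Suc k) f \<Longrightarrow> Ck k f"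
proof (induction k arbitrary: f)
  case 0
  then show ?case by (metis Ck_continuous_on Ck.simps(1))
next
  case (Suc k)
  then show ?case by auto
qed

lemma Ck_const [simp]: "Ck k (\<lambda>_. c)"
proof (induction k arbitrary: c)
  case 0
  then show ?case by simp
next
  case (Suc k)
  have "dir_deriv b (\<lambda>_::'a. c) = (\<lambda>_. 0)" for b :: 'a
    by (rule ext) (rule dir_deriv_eq, rule has_derivative_const)
  then show ?case using Suc by simp
qed

lemma Ck_bounded_linear: "bounded_linear l \<Longrightarrow> Ck k l"
proof (cases k)
  case 0
  then show "bounded_linear l \<Longrightarrow> Ck k l" by (simp add: linear_continuous_on)
next
  case (Suc j)
  assume l: "bounded_linear l"
  have "dir_deriv b l = (\<lambda>_. l b)" for b
    by (rule ext) (rule dir_deriv_eq, rule bounded_linear_imp_has_derivative[OF l])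
  then show "Ck k l" using Suc bounded_linear_imp_differentiable[OF l] by simp
qed

lemma Ck_add: "Ck k f \<Longrightarrow> Ck k g \<Longrightarrow> Ck k (\<lambda>x. f x + g x)"
proof (induction k arbitrary: f g)
  case 0
  then show ?case by (simp add: continuous_on_add)
next
  case (Suc k)
  have "dir_deriv b (\<lambda>x. f x + g x) = (\<lambda>x. dir_deriv b f x + dir_deriv b g x)" for b
  proof
    fix p
    have "(f has_derivative frechet_derivative f (at p)) (at p)"
      "(g has_derivative frechet_derivative g (at p)) (at p)"
      by (rule frechet_derivative_works[THEN iffD1], use Suc.prems in simp)+
    from dir_deriv_eq[OF has_derivative_add[OF this]]
    show "dir_deriv b (\<lambda>x. f x + g x) p = dir_deriv b f p + dir_deriv b g p"
      by (simp add: dir_deriv_def)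
  qed
  then show ?case using Suc by (auto intro!: differentiable_add)
qed

lemma dir_deriv_mult:
  assumes "f differentiable (at p)" "g differentiable (at p)"
  shows "dir_deriv b (\<lambda>x. f x * g x) p = f p * dir_deriv b g p + dir_deriv b f p * (g p::real)"
proof -
  have "(f has_derivative frechet_derivative f (at p)) (at p)"
    "(g has_derivative frechet_derivative g (at p)) (at p)"
    by (rule frechet_derivative_works[THEN iffD1], rule assms)+
  from dir_deriv_eq[OF has_derivative_mult[OF this]] show ?thesis
    by (simp add: dir_deriv_def)
qed

lemma Ck_mult: "Ck k f \<Longrightarrow> Ck k g \<Longrightarrow> Ck k (\<lambda>x. f x * g x)"
proof (induction k arbitrary: f g)
  case 0
  then show ?case by (simp add: continuous_on_mult)
next
  case (Suc k)
  have "dir_deriv b (\<lambda>x. f x * g x) = (\<lambda>x. f x * dir_deriv b g x + dir_deriv b f x * g x)" for b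
    using Suc.prems by (intro ext dir_deriv_mult) auto
  moreover have "Ck k f" "Ck k g"
    using Suc.prems Ck_Suc_imp_Ck by auto
  ultimately show ?case using Suc by (auto intro!: differentiable_mult Ck_add)
qed

lemma smoothD: "smooth f \<Longrightarrow> f differentiable (at p)"
  using Ck_differentiable unfolding smooth_def by blast

lemma smooth_continuous_on: "smooth f \<Longrightarrow> continuous_on S f"
  using Ck_continuous_on unfolding smooth_def by (metis continuous_on_subset subset_UNIV)

lemma smooth_real_iff:
  "smooth (f :: real \<Rightarrow> real) \<longleftrightarrow> (\<forall>x. f differentiable (at x)) \<and> smooth (deriv f)"
proof -
  have "dir_deriv 1 f = deriv f" if "\<forall>x. f differentiable (at x)"
    using that dir_deriv_real by blast
  moreover have "smooth f \<longleftrightarrow> (\<forall>k. Ck (Suc k) f)"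
    unfolding smooth_def using Ck_Suc_imp_Ck by blast
  ultimately show ?thesis
    unfolding smooth_def by (metis Basis_real_def Ck.simps(2) singletonD singletonI)
qed

lemma smooth_DERIV: "smooth (f :: real \<Rightarrow> real) \<Longrightarrow> (f has_real_derivative deriv f x) (at x)"
  using DERIV_deriv_iff_real_differentiable smoothD by blast

lemma smooth_deriv: "smooth (f :: real \<Rightarrow> real) \<Longrightarrow> smooth (deriv f)"
  using smooth_real_iff by blast

lemma smooth_dir_deriv: "smooth f \<Longrightarrow> b \<in> Basis \<Longrightarrow> smooth (dir_deriv b f)"
  unfolding smooth_def by (metis Ck.simps(2))

text \<open>No formula for higher derivatives is needed: in a class closed under differentiation,
  induction on the order with the function left arbitrary gives \<open>Ck k\<close> for each member.
  This serves for combinations of sine and cosine and for \<open>range flat_poly\<close>.\<close>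

lemma smooth_real_coinduct:
  fixes f :: "real \<Rightarrow> real"
  assumes "f \<in> F" and "\<And>g. g \<in> F \<Longrightarrow> \<exists>h\<in>F. \<forall>x. (g has_real_derivative h x) (at x)"
  shows "smooth f"
proof -
  have "Ck k f" for k
    using assms(1)
  proof (induction k arbitrary: f)
    case 0
    then show ?case using assms(2) DERIV_continuous_on
      by (metis Ck.simps(1) has_field_derivative_at_within)
  next
    case (Suc k)
    then obtain h where h: "h \<in> F" "\<And>x. (f has_real_derivative h x) (at x)"
      using assms(2) by blast
    have "dir_deriv 1 f = h"
    proof
      fix x show "dir_deriv 1 f x = h x"
        using dir_deriv_eq[OF h(2)[of x, unfolded has_field_derivative_def], of 1] by simp
    qed
    with h Suc.IH[OF h(1)] show ?case
      using differentiableI real_differentiable_def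
      by (auto simp: has_field_derivative_def intro!: differentiableI)
  qed
  then show ?thesis by (simp add: smooth_def)
qed

lemma smooth_antiderivative:
  fixes f :: "real \<Rightarrow> real"
  assumes "\<And>x. (f has_real_derivative g x) (at x)" "smooth g"
  shows "smooth f" "deriv f = g"
proof -
  show d: "deriv f = g" using DERIV_imp_deriv[OF assms(1)] by blast
  show "smooth f"
    using assms d smooth_real_iff real_differentiable_def by blast
qed

lemma dir_deriv_compose:
  assumes "f differentiable (at (g p))" "g differentiable (at p)"
  shows "dir_deriv b (\<lambda>x. f (g x)) p = deriv f (g p) * dir_deriv b g p"
proof -
  have f: "(f has_derivative (*) (deriv f (g p))) (at (g p))"
    using assms(1) DERIV_deriv_iff_real_differentiable
    unfolding has_field_derivative_def[symmetric] by blast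
  have "(g has_derivative frechet_derivative g (at p)) (at p)"
    using assms(2) frechet_derivative_works by auto
  from dir_deriv_eq[OF has_derivative_compose[OF this f]] show ?thesis
    by (simp add: dir_deriv_def)
qed

text \<open>The outer function is smooth and arbitrary in the induction, so the hypothesis applies
  to \<open>deriv f\<close> without any count of its order of differentiability.\<close>

lemma Ck_compose: "smooth f \<Longrightarrow> Ck k g \<Longrightarrow> Ck k (\<lambda>x. f (g x))"
proof (induction k arbitrary: f g)
  case 0
  then show ?case
    using continuous_on_compose2[OF smooth_continuous_on[of f UNIV], of UNIV g] by simp
next
  case (Suc k)
  have d: "\<And>p. f differentiable (at p)" "\<And>p. g differentiable (at p)"
    using Suc.prems smoothD by auto
  have "dir_deriv b (\<lambda>x. f (g x)) = (\<lambda>x. deriv f (g x) * dir_deriv b g x)" for b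
    using d by (intro ext dir_deriv_compose)
  moreover have "(\<lambda>x. f (g x)) differentiable (at p)" for p
    using d differentiable_chain_at[of g p f] by (simp add: o_def)
  moreover have "Ck k (\<lambda>x. deriv f (g x))"
    using Suc.IH[OF smooth_deriv[OF Suc.prems(1)] Ck_Suc_imp_Ck[OF Suc.prems(2)]] .
  ultimately show ?case using Suc.prems by (auto intro!: Ck_mult)
qed

lemma smooth_const [simp]: "smooth (\<lambda>_. c)"
  and smooth_bounded_linear: "bounded_linear l \<Longrightarrow> smooth l"
  and smooth_add: "smooth f \<Longrightarrow> smooth g \<Longrightarrow> smooth (\<lambda>x. f x + g x)"
  and smooth_mult: "smooth f \<Longrightarrow> smooth g \<Longrightarrow> smooth (\<lambda>x. f x * g x)"
  and smooth_compose: "smooth h \<Longrightarrow> smooth g \<Longrightarrow> smooth (\<lambda>x. h (g x))"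
  by (auto simp: smooth_def Ck_bounded_linear intro: Ck_add Ck_mult)
     (simp add: Ck_compose smooth_def)

lemma smooth_ident: "smooth (\<lambda>x::real. x)"
  by (simp add: smooth_bounded_linear bounded_linear_ident)

lemma smooth_cmult: "smooth f \<Longrightarrow> smooth (\<lambda>x. c * f x)"
  by (rule smooth_mult) auto

lemma smooth_diff: "smooth f \<Longrightarrow> smooth g \<Longrightarrow> smooth (\<lambda>x. f x - g x)"
  using smooth_add[of f "\<lambda>x. (-1) * g x"] smooth_cmult[of g "-1"] by simp

lemma smooth_affine: "smooth (\<lambda>x::real. c * x + d)"
  by (intro smooth_add smooth_mult smooth_ident) auto

lemma smooth_sin: "smooth (sin :: real \<Rightarrow> real)"
proof (rule smooth_real_coinduct[where F = "{\<lambda>x. a * sin x + b * cos x |a b. True}"])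
  show "sin \<in> {\<lambda>x::real. a * sin x + b * cos x |a b. True}"
    by (rule CollectI, rule exI[of _ 1], rule exI[of _ 0]) auto
  fix g :: "real \<Rightarrow> real" assume "g \<in> {\<lambda>x. a * sin x + b * cos x |a b. True}"
  then obtain a b where g: "g = (\<lambda>x. a * sin x + b * cos x)" by blast
  show "\<exists>h\<in>{\<lambda>x. a * sin x + b * cos x |a b. True}. \<forall>x. (g has_real_derivative h x) (at x)"
  proof (rule bexI[of _ "\<lambda>x. (-b) * sin x + a * cos x"])
    show "\<forall>x. (g has_real_derivative (-b) * sin x + a * cos x) (at x)"
      unfolding g by (auto intro!: derivative_eq_intros)
  qed blast
qed

text \<open>Chain rule along curves of velocity (1, 0), (0, 1) and (1, - s). The third curve is a
  characteristic, along which any function of \<open>x + s * t\<close> is constant.\<close>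

lemma smooth_test_slice:
  assumes "smooth \<phi>"
  shows "((\<lambda>t. \<phi> (t, x)) has_real_derivative d_t \<phi> (t, x)) (at t)"
    and "((\<lambda>x. \<phi> (t, x)) has_real_derivative d_x \<phi> (t, x)) (at x)"
    and "((\<lambda>t. \<phi> (t, y - s * t)) has_real_derivative
          d_t \<phi> (t, y - s * t) - s * d_x \<phi> (t, y - s * t)) (at t)"
proof -
  have D: "(\<phi> has_derivative frechet_derivative \<phi> (at p)) (at p)" for p
    using smoothD[OF assms] frechet_derivative_works by blast
  have lin: "linear (frechet_derivative \<phi> (at p))" for p
    using D has_derivative_linear by blast
  have *: "((\<lambda>s. \<phi> (g s)) has_real_derivative frechet_derivative \<phi> (at (g s)) (a, b)) (at s)"
    if "(g has_vector_derivative (a, b)) (at s)" for g s a b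
  proof -
    from has_derivative_compose[OF that[unfolded has_vector_derivative_def] D]
    have "((\<lambda>s. \<phi> (g s)) has_derivative (\<lambda>h. frechet_derivative \<phi> (at (g s)) (h *\<^sub>R (a, b)))) (at s)" .
    also have "(\<lambda>h. frechet_derivative \<phi> (at (g s)) (h *\<^sub>R (a, b))) =
        (*) (frechet_derivative \<phi> (at (g s)) (a, b))"
      using linear_cmul[OF lin] by (auto simp: fun_eq_iff simp del: scaleR_Pair)
    finally show ?thesis by (simp add: has_field_derivative_def)
  qed
  show "((\<lambda>t. \<phi> (t, x)) has_real_derivative d_t \<phi> (t, x)) (at t)"
    unfolding dir_deriv_def by (rule *) (auto intro!: derivative_eq_intros)
  show "((\<lambda>x. \<phi> (t, x)) has_real_derivative d_x \<phi> (t, x)) (at x)"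
    unfolding dir_deriv_def by (rule *) (auto intro!: derivative_eq_intros)
  have "((\<lambda>t. \<phi> (t, y - s * t)) has_real_derivative frechet_derivative \<phi> (at (t, y - s * t)) (1, - s)) (at t)"
    by (rule *) (auto intro!: derivative_eq_intros)
  moreover have "frechet_derivative \<phi> (at p) (1, - s) = d_t \<phi> p - s * d_x \<phi> p" for p
    using linear_diff[OF lin, of p "(1, 0)" "s *\<^sub>R (0, 1)"] linear_cmul[OF lin, of p s "(0, 1)"]
    by (simp add: dir_deriv_def)
  ultimately show "((\<lambda>t. \<phi> (t, y - s * t)) has_real_derivative
      d_t \<phi> (t, y - s * t) - s * d_x \<phi> (t, y - s * t)) (at t)"
    by simp
qed

section \<open>Fundamental lemmas on the circle and on an interval\<close>

definition flat_poly :: "real poly \<Rightarrow> real \<Rightarrow> real" where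
  "flat_poly P x = (if x > 0 then poly P (1 / x) * exp (- (1 / x)) else 0)"

text \<open>The factor \<open>y ^ n\<close> makes the induction close: splitting off the constant
  coefficient of the polynomial turns its variable into one more power of y.\<close>

lemma tendsto_power_mult_poly_mult_exp:
  "((\<lambda>y::real. y ^ n * poly P y * exp (- y)) \<longlongrightarrow> 0) at_top"
proof (induction P arbitrary: n)
  case 0
  then show ?case by simp
next
  case (pCons a P)
  have "((\<lambda>y::real. a * (y ^ n / exp y) + y ^ Suc n * poly P y * exp (- y)) \<longlongrightarrow> a * 0 + 0) at_top"
    by (intro tendsto_intros tendsto_power_div_exp_0 pCons.IH)
  then show ?case
    by (simp add: algebra_simps exp_minus divide_inverse)
qed

lemma flat_poly_tendsto_0: "(flat_poly P \<longlongrightarrow> 0) (at 0)"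
proof -
  have "((\<lambda>x. poly P (inverse x) * exp (- inverse x)) \<longlongrightarrow> 0) (at_right 0)"
    using filterlim_compose[OF tendsto_power_mult_poly_mult_exp[of 0 P]
        filterlim_inverse_at_top_right] by simp
  then have "(flat_poly P \<longlongrightarrow> 0) (at_right 0)"
    by (rule Lim_transform_eventually)
      (auto simp: flat_poly_def eventually_at_filter inverse_eq_divide)
  moreover have "(flat_poly P \<longlongrightarrow> 0) (at_left 0)"
    by (rule Lim_transform_eventually[OF tendsto_const])
      (auto simp: flat_poly_def eventually_at_filter)
  ultimately show ?thesis by (simp add: filterlim_split_at)
qed

text \<open>With y = 1 / x, the derivative of P(y) exp (- y) in x is y^2 (P - P')(y) exp (- y). The
  family is thus closed under differentiation, which is why polynomials in 1 / x are carried
  along.\<close>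

lemma DERIV_flat_poly:
  "(flat_poly P has_real_derivative flat_poly (monom 1 2 * (P - pderiv P)) x) (at x)"
proof -
  consider "x > 0" | "x < 0" | "x = 0" by linarith
  then show ?thesis
  proof cases
    case 1
    have "((\<lambda>x. poly P (1 / x) * exp (- (1 / x))) has_real_derivative
            flat_poly (monom 1 2 * (P - pderiv P)) x) (at x)"
      using 1 by (auto simp: flat_poly_def poly_monom field_simps power2_eq_square
          intro!: derivative_eq_intros DERIV_chain'[OF _ poly_DERIV])
    then show ?thesis
      by (rule has_field_derivative_transform_within_open[of _ _ _ "{0<..}"])
        (use 1 in \<open>auto simp: flat_poly_def\<close>)
  next
    case 2
    have "((\<lambda>x. 0) has_real_derivative flat_poly (monom 1 2 * (P - pderiv P)) x) (at x)"
      using 2 by (simp add: flat_poly_def)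
    then show ?thesis
      by (rule has_field_derivative_transform_within_open[of _ _ _ "{..<0}"])
        (use 2 in \<open>auto simp: flat_poly_def\<close>)
  next
    case 3
    \<comment> \<open>Dividing by h multiplies the polynomial by its variable, so the difference
      quotient at 0 is itself the function \<open>flat_poly (pCons 0 P)\<close>.\<close>
    have "((\<lambda>h. (flat_poly P (0 + h) - flat_poly P 0) / h) \<longlongrightarrow> 0) (at 0)"
      by (rule Lim_transform_eventually[OF flat_poly_tendsto_0[of "pCons 0 P"]])
        (auto simp: flat_poly_def eventually_at_filter)
    then show ?thesis
      unfolding 3 by (simp add: DERIV_def flat_poly_def)
  qed
qed

definition flat :: "real \<Rightarrow> real" where
  "flat = flat_poly 1"

lemma flat_eq: "flat x = (if x > 0 then exp (- (1 / x)) else 0)"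
  by (simp add: flat_def flat_poly_def)

lemma flat_pos_iff: "flat x > 0 \<longleftrightarrow> x > 0"
  and flat_nonneg: "flat x \<ge> 0"
  and flat_le_1: "flat x \<le> 1"
  by (auto simp: flat_eq)

lemma smooth_flat: "smooth flat"
  by (rule smooth_real_coinduct[where F = "range flat_poly"])
    (auto simp: flat_def intro!: DERIV_flat_poly)

text \<open>For positive x the exponent - 1 / (n x) tends to 0. Composed with a smooth function s,
  this approximates the indicator of the set where s is positive by smooth functions with values
  between 0 and 1, ready for dominated convergence.\<close>

lemma flat_tendsto_indicator:
  "(\<lambda>n. flat (real n * x)) \<longlonglongrightarrow> (if x > 0 then 1 else 0)"
proof (cases "x > 0")
  case True
  have "(\<lambda>n. exp (- (inverse (real n) * inverse x))) \<longlonglongrightarrow> exp (- (0 * inverse x))"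
    by (intro tendsto_intros lim_inverse_n)
  then have "(\<lambda>n. flat (real n * x)) \<longlonglongrightarrow> exp (- (0 * inverse x))"
    by (rule Lim_transform_eventually)
      (use True in \<open>auto simp: flat_eq divide_inverse eventually_sequentially intro!: exI[of _ 1]\<close>)
  then show ?thesis using True by simp
next
  case False
  then have "\<not> real n * x > 0" for n
    by (simp add: zero_less_mult_iff)
  then show ?thesis using False by (simp add: flat_eq)
qed

lemma primitive_exists:
  fixes f :: "real \<Rightarrow> real"
  assumes "continuous_on UNIV f"
  obtains F where "\<And>x. (F has_real_derivative f x) (at x)"
proof -
  have "\<exists>F. \<forall>x::real. -\<infinity> < ereal x \<longrightarrow> ereal x < \<infinity> \<longrightarrow> (F has_vector_derivative f x) (at x)"
    using assms by (intro einterval_antiderivative) (auto simp: continuous_on_eq_continuous_at)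
  then show ?thesis
    using that by (auto simp: has_real_derivative_iff_has_vector_derivative)
qed

lemma integrable_lebesgue_on_continuous:
  fixes f :: "real \<Rightarrow> real"
  assumes "continuous_on {a..b} f"
  shows "integrable (lebesgue_on {a..b}) f"
  using continuous_imp_integrable_real[OF assms] .

lemma FTC_lebesgue_on:
  fixes F :: "real \<Rightarrow> real"
  assumes "a \<le> b" "\<And>x. x \<in> {a..b} \<Longrightarrow> (F has_real_derivative f x) (at x)" "continuous_on {a..b} f"
  shows "integral\<^sup>L (lebesgue_on {a..b}) f = F b - F a"
proof -
  have "(f has_integral F b - F a) {a..b}"
    using assms by (intro fundamental_theorem_of_calculus)
      (auto simp: has_real_derivative_iff_has_vector_derivative[symmetric]
        intro: has_field_derivative_at_within)
  then show ?thesis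
    using lebesgue_integral_eq_integral[OF integrable_lebesgue_on_continuous[OF assms(3)]]
    by (simp add: integral_unique)
qed

lemma bump_exists:
  fixes c r :: real
  assumes "r > 0"
  obtains \<beta> where "smooth \<beta>" "\<And>x. \<beta> x \<ge> 0" "\<And>x. \<beta> x > 0 \<longleftrightarrow> \<bar>x - c\<bar> < r"
proof
  let ?s = "\<lambda>x. r\<^sup>2 - (x - c)\<^sup>2"
  have "smooth ?s"
    unfolding power2_eq_square
    by (intro smooth_diff smooth_mult smooth_ident smooth_const)
  then show "smooth (\<lambda>x. flat (?s x))"
    by (rule smooth_compose[OF smooth_flat])
  show "flat (?s x) > 0 \<longleftrightarrow> \<bar>x - c\<bar> < r" for x
    using assms abs_le_square_iff[of r "x - c"] by (auto simp: flat_pos_iff)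
qed (simp add: flat_nonneg)

text \<open>Since \<open>ennreal\<close> truncates negative numbers to 0, the functions g and - g
  used as densities give the measures of the positive and the negative part. These agree on
  half-lines, hence everywhere, and uniqueness of densities forces both parts to coincide, so both
  vanish.\<close>

lemma AE_eq_0_if_tail_integrals_0:
  fixes g :: "real \<Rightarrow> real"
  assumes g: "integrable lborel g"
    and zero: "\<And>a. (LINT x|lborel. g x * indicator {a<..} x) = 0"
  shows "AE x in lborel. g x = 0"
proof -
  have [measurable]: "g \<in> borel_measurable borel" using g by auto
  have em: "emeasure (density lborel (\<lambda>x. ennreal (h x))) {a<..} = ennreal (LINT x|lborel. max 0 (h x) * indicator {a<..} x)"
    if h: "integrable lborel h" for h :: "real \<Rightarrow> real" and a
  proof -
    have [measurable]: "h \<in> borel_measurable borel" using h by auto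
    have "emeasure (density lborel (\<lambda>x. ennreal (h x))) {a<..} =
        (\<integral>\<^sup>+x. ennreal (h x) * indicator {a<..} x \<partial>lborel)"
      by (intro emeasure_density) auto
    also have "\<dots> = (\<integral>\<^sup>+x. ennreal (max 0 (h x) * indicator {a<..} x) \<partial>lborel)"
      by (auto intro!: nn_integral_cong simp: indicator_def max_def ennreal_neg)
    also have "\<dots> = ennreal (LINT x|lborel. max 0 (h x) * indicator {a<..} x)"
      using h by (intro nn_integral_eq_integral integrable_real_mult_indicator integrable_max) auto
    finally show ?thesis .
  qed
  have "density lborel (\<lambda>x. ennreal (g x)) = density lborel (\<lambda>x. ennreal (- g x))"
  proof (rule measure_eqI_lessThan)
    fix a
    have "0 = (LINT x|lborel. max 0 (g x) * indicator {a<..} x - max 0 (- g x) * indicator {a<..} x)"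
      by (subst zero[of a, symmetric], intro Bochner_Integration.integral_cong) (auto simp: indicator_def)
    also have "\<dots> = (LINT x|lborel. max 0 (g x) * indicator {a<..} x) - (LINT x|lborel. max 0 (- g x) * indicator {a<..} x)"
      using g by (intro Bochner_Integration.integral_diff integrable_real_mult_indicator integrable_max) auto
    finally show "emeasure (density lborel (\<lambda>x. ennreal (g x))) {a<..} =
        emeasure (density lborel (\<lambda>x. ennreal (- g x))) {a<..}"
      using g by (simp add: em)
    show "emeasure (density lborel (\<lambda>x. ennreal (g x))) {a<..} < \<infinity>"
      using g by (simp add: em)
  qed auto
  then have "AE x in lborel. ennreal (g x) = ennreal (- g x)"
    by (intro sigma_finite_measure.density_unique[OF sigma_finite_lborel]) auto
  then show ?thesis
  proof eventually_elim
    case (elim x)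
    then show ?case by (cases "g x \<ge> 0") (auto simp: ennreal_neg)
  qed
qed

section \<open>The fundamental lemma and du Bois-Reymond's lemma on the circle\<close>

abbreviation circ :: "real measure" where
  "circ \<equiv> lebesgue_on {0..2 * pi}"

lemma measure_circ [simp]: "measure circ {0..2 * pi} = 2 * pi"
  by (simp add: measure_restrict_space)

text \<open>The indicator of the arc from a to 2 pi is the pointwise limit, on one period, of the
  smooth periodic functions \<open>flat (real n * s x)\<close>, all orthogonal to w.\<close>

lemma circ_tail_integral_0:
  assumes w: "integrable circ w"
    and zero: "\<And>\<psi>. smooth \<psi> \<Longrightarrow> periodic \<psi> \<Longrightarrow> (LINT x|circ. w x * \<psi> x) = 0"
    and a: "0 \<le> a" "a < 2 * pi"
  shows "(LINT x|circ. w x * indicator {a<..<2 * pi} x) = 0"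
proof -
  \<comment> \<open>Each factor changes sign under translation by 2 pi, so the product is periodic.
    On [0, 2 pi] the first factor is nonnegative and the second has the sign of x - a, so s is
    positive exactly on the open arc.\<close>
  define s where "s x = sin (x / 2) * sin ((x - a) / 2)" for x
  have sm: "smooth s"
  proof -
    have "smooth (\<lambda>x. sin (1 / 2 * x + 0) * sin (1 / 2 * x + (- a / 2)))"
      by (intro smooth_mult smooth_compose[OF smooth_sin] smooth_affine)
    moreover have "(\<lambda>x. sin (1 / 2 * x + 0) * sin (1 / 2 * x + (- a / 2))) = s"
      by (auto simp: s_def fun_eq_iff diff_divide_distrib)
    ultimately show ?thesis by simp
  qed
  have per: "s (x + 2 * pi) = s x" for x
  proof -
    have "sin (x / 2 + pi) * sin ((x - a) / 2 + pi) = sin (x / 2) * sin ((x - a) / 2)"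
      by (simp only: sin_periodic_pi minus_mult_minus)
    then show ?thesis by (simp add: s_def add_divide_distrib diff_divide_distrib algebra_simps)
  qed
  have pos: "s x > 0 \<longleftrightarrow> x \<in> {a<..<2 * pi}" if "x \<in> {0..2 * pi}" for x
  proof (cases "x = 2 * pi \<or> x = 0")
    case True
    then show ?thesis using a by (auto simp: s_def)
  next
    case False
    then have "sin (x / 2) > 0" using that by (intro sin_gt_zero) auto
    moreover have "sin ((x - a) / 2) > 0" if "x > a"
      using that False \<open>x \<in> {0..2 * pi}\<close> a by (intro sin_gt_zero) auto
    moreover have "sin ((x - a) / 2) \<le> 0" if "x \<le> a"
    proof -
      have "sin ((x - a) / 2) = - sin ((a - x) / 2)"
        by (metis minus_diff_eq minus_divide_left sin_minus)
      moreover have "sin ((a - x) / 2) \<ge> 0"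
        using that \<open>x \<in> {0..2 * pi}\<close> a by (intro sin_ge_zero) auto
      ultimately show ?thesis by simp
    qed
    ultimately show ?thesis
      using that False by (fastforce simp: s_def zero_less_mult_iff)
  qed
  have z: "(LINT x|circ. w x * flat (real n * s x)) = 0" for n
    by (rule zero)
      (auto simp: periodic_def per intro!: smooth_compose[OF smooth_flat] smooth_cmult sm)
  have mw: "w \<in> borel_measurable circ" using w by auto
  have ms: "(\<lambda>x. flat (real n * s x)) \<in> borel_measurable circ" for n
    by (intro borel_measurable_continuous_onI measurable_restrict_space1 measurable_completion
        smooth_continuous_on[OF smooth_compose[OF smooth_flat]] smooth_cmult sm)
       (auto intro!: borel_measurable_continuous_onI smooth_continuous_on[OF smooth_compose[OF smooth_flat]] smooth_cmult sm)
  have "(\<lambda>n. LINT x|circ. w x * flat (real n * s x)) \<longlonglongrightarrow> (LINT x|circ. w x * indicator {a<..<2 * pi} x)"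
  proof (rule integral_dominated_convergence[where w = "\<lambda>x. \<bar>w x\<bar>"])
    show "(\<lambda>x. w x * indicator {a<..<2 * pi} x) \<in> borel_measurable circ"
      using mw by (intro borel_measurable_times[OF mw] measurable_restrict_space1 borel_measurable_indicator) auto
    show "(\<lambda>x. w x * flat (real n * s x)) \<in> borel_measurable circ" for n
      using mw ms by (rule borel_measurable_times)
    show "integrable circ (\<lambda>x. \<bar>w x\<bar>)" using w by simp
    show "AE x in circ. (\<lambda>n. w x * flat (real n * s x)) \<longlonglongrightarrow> w x * indicator {a<..<2 * pi} x"
    proof (rule AE_I2)
      fix x assume "x \<in> space circ"
      then have "indicator {a<..<2 * pi} x = (if s x > 0 then 1 else 0 :: real)"
        using pos by (auto simp: indicator_def)
      then show "(\<lambda>n. w x * flat (real n * s x)) \<longlonglongrightarrow> w x * indicator {a<..<2 * pi} x"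
        using tendsto_mult_left[OF flat_tendsto_indicator[of "s x"], of "w x"] by presburger
    qed
    show "AE x in circ. norm (w x * flat (real n * s x)) \<le> \<bar>w x\<bar>" for n
      using flat_le_1 flat_nonneg by (auto simp: abs_mult mult_left_le)
  qed
  then show ?thesis by (simp add: z LIMSEQ_const_iff)
qed

lemma AE_circ_iff: "(AE x in circ. P x) \<longleftrightarrow> (AE x in lebesgue. x \<in> {0..2 * pi} \<longrightarrow> P x)"
  by (rule AE_restrict_space_iff) simp

text \<open>The extension of w by zero has vanishing integral over every half-line; a Borel
  representative makes the uniqueness of densities applicable.\<close>

lemma circ_fundamental_lemma:
  assumes w: "integrable circ w"
    and zero: "\<And>\<psi>. smooth \<psi> \<Longrightarrow> periodic \<psi> \<Longrightarrow> (LINT x|circ. w x * \<psi> x) = 0"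
  shows "AE x in circ. w x = 0"
proof -
  define W where "W x = (if x \<in> {0..2 * pi} then w x else 0)" for x
  have W: "integrable lebesgue W"
    using w unfolding W_def by (subst Lebesgue_Measure.integrable_restrict_UNIV) auto
  then obtain g where g: "g \<in> borel_measurable lborel" and ae: "AE x in lborel. W x = g x"
    using completion_ex_borel_measurable_real[of W lborel] by auto
  have ae': "AE x in lebesgue. W x = g x"
    using AE_completion[OF ae] .
  have int_g: "integrable lborel g"
  proof -
    have "integrable lebesgue g"
      using W ae' g by (subst integrable_cong_AE[of g _ W]) (auto intro: measurable_completion)
    then show ?thesis using g integrable_completion by blast
  qed
  have tail: "(LINT x|lborel. g x * indicator {a<..} x) = 0" for a
  proof -
    have "(LINT x|lborel. g x * indicator {a<..} x) = (LINT x|lebesgue. g x * indicator {a<..} x)"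
      using g by (intro integral_completion[symmetric]) auto
    \<comment> \<open>The extension vanishes to the left of 0, so a negative a may be replaced by 0;
      the endpoints 0 and 2 pi, which the open arc omits, are negligible.\<close>
    also have "\<dots> = (LINT x|lebesgue. (if x \<in> {0..2 * pi} then w x * indicator {max 0 a<..<2 * pi} x else 0))"
    proof (rule integral_cong_AE)
      show "(\<lambda>x. g x * indicator {a<..} x) \<in> borel_measurable lebesgue"
        using g by (intro measurable_completion) auto
      have "(\<lambda>x. W x * indicator {max 0 a<..<2 * pi} x) \<in> borel_measurable lebesgue"
        using W by (intro borel_measurable_times borel_measurable_indicator) auto
      also have "(\<lambda>x. W x * indicator {max 0 a<..<2 * pi} x) =
          (\<lambda>x. if x \<in> {0..2 * pi} then w x * indicator {max 0 a<..<2 * pi} x else 0)"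
        by (auto simp: W_def fun_eq_iff)
      finally show "(\<lambda>x. if x \<in> {0..2 * pi} then w x * indicator {max 0 a<..<2 * pi} x else 0) \<in> borel_measurable lebesgue" .
      have "AE x in lebesgue. x \<noteq> 0" "AE x in lebesgue. x \<noteq> 2 * pi"
        by (auto intro!: AE_completion AE_lborel_singleton)
      with ae' show "AE x in lebesgue. g x * indicator {a<..} x =
          (if x \<in> {0..2 * pi} then w x * indicator {max 0 a<..<2 * pi} x else 0)"
      proof eventually_elim
        case (elim x)
        then show ?case by (auto simp: W_def indicator_def split: if_splits)
      qed
    qed
    also have "\<dots> = (LINT x|circ. w x * indicator {max 0 a<..<2 * pi} x)"
      by (rule Lebesgue_Measure.integral_restrict_UNIV) simp
    also have "\<dots> = 0"
    proof (cases "a < 2 * pi")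
      case True
      then show ?thesis by (intro circ_tail_integral_0[OF w zero]) auto
    qed auto
    finally show ?thesis .
  qed
  have "AE x in lebesgue. g x = 0"
    using AE_eq_0_if_tail_integrals_0[OF int_g tail] by (rule AE_completion)
  with ae' have "AE x in lebesgue. x \<in> {0..2 * pi} \<longrightarrow> w x = 0"
    by eventually_elim (auto simp: W_def)
  then show ?thesis by (simp add: AE_circ_iff)
qed

text \<open>The increment of a primitive over one period does not depend on the starting point,
  because \<psi> is periodic, and from 0 it is the integral of \<psi>.\<close>

lemma primitive_periodic:
  assumes "smooth \<psi>" "periodic \<psi>" "(LINT x|circ. \<psi> x) = 0"
  obtains \<Psi> where "smooth \<Psi>" "periodic \<Psi>" "deriv \<Psi> = \<psi>"
proof -
  obtain \<Psi> where \<Psi>: "\<And>x. (\<Psi> has_real_derivative \<psi> x) (at x)"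
    using primitive_exists[OF smooth_continuous_on[OF assms(1)]] by blast
  have *: "\<Psi> (x + 2 * pi) - \<Psi> x = \<Psi> (0 + 2 * pi) - \<Psi> 0" for x
  proof -
    have "((\<lambda>x. \<Psi> (x + 2 * pi)) has_real_derivative \<psi> (x + 2 * pi)) (at x)" for x
      using \<Psi> DERIV_shift by blast
    then have "((\<lambda>x. \<Psi> (x + 2 * pi) - \<Psi> x) has_real_derivative 0) (at x)" for x
      using DERIV_diff[OF _ \<Psi>, of "\<lambda>x. \<Psi> (x + 2 * pi)" "\<psi> (x + 2 * pi)" x] assms(2)
      by (simp add: periodic_def)
    then show ?thesis
      by (intro DERIV_isconst_all) auto
  qed
  have "\<Psi> (0 + 2 * pi) - \<Psi> 0 = 0"
    using FTC_lebesgue_on[of 0 "2 * pi" \<Psi> \<psi>] \<Psi> assms(3) smooth_continuous_on[OF assms(1)] by simp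
  then have "periodic \<Psi>" using * unfolding periodic_def by (metis eq_iff_diff_eq_0)
  moreover have "smooth \<Psi>" "deriv \<Psi> = \<psi>"
    using smooth_antiderivative[OF \<Psi> assms(1)] .
  ultimately show ?thesis using that by blast
qed

lemma integrable_mult_bounded:
  fixes f g :: "'a \<Rightarrow> real"
  assumes "integrable M f" "g \<in> borel_measurable M" "\<And>x. x \<in> space M \<Longrightarrow> \<bar>g x\<bar> \<le> C"
  shows "integrable M (\<lambda>x. f x * g x)"
proof (rule Bochner_Integration.integrable_bound)
  show "integrable M (\<lambda>x. C * \<bar>f x\<bar>)" using assms(1) by simp
  show "(\<lambda>x. f x * g x) \<in> borel_measurable M" using assms by auto
  have "\<bar>f x\<bar> * \<bar>g x\<bar> \<le> \<bar>f x\<bar> * C" if "x \<in> space M" for x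
    using assms(3)[OF that] by (intro mult_left_mono) auto
  then show "AE x in M. norm (f x * g x) \<le> norm (C * \<bar>f x\<bar>)"
    by (intro AE_I2) (simp add: abs_mult, smt (verit) mult.commute mult_right_mono)
qed

lemma integrable_mult_continuous:
  fixes f g :: "real \<Rightarrow> real"
  assumes "integrable (lebesgue_on {a..b}) f" "continuous_on {a..b} g"
  shows "integrable (lebesgue_on {a..b}) (\<lambda>x. f x * g x)"
proof -
  have "compact (g ` {a..b})" using assms(2) by (intro compact_continuous_image) auto
  then obtain C where "\<And>x. x \<in> {a..b} \<Longrightarrow> \<bar>g x\<bar> \<le> C"
    using compact_imp_bounded bounded_iff by (metis imageI real_norm_def)
  moreover have "g \<in> borel_measurable (lebesgue_on {a..b})"
    using assms(2) by (intro continuous_imp_measurable_on_sets_lebesgue) auto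
  ultimately show ?thesis using assms(1) by (intro integrable_mult_bounded) auto
qed

text \<open>Subtracting its mean k makes any test function the derivative of a periodic one. Pairing
  w with \<psi> - k equals pairing w minus its mean with \<psi>, so the fundamental lemma
  applies.\<close>

lemma circ_du_Bois_Reymond:
  assumes w: "integrable circ w"
    and zero: "\<And>\<psi>. smooth \<psi> \<Longrightarrow> periodic \<psi> \<Longrightarrow> (LINT x|circ. w x * deriv \<psi> x) = 0"
  shows "AE x in circ. w x = (LINT x|circ. w x) / (2 * pi)"
proof -
  define m where "m = (LINT x|circ. w x) / (2 * pi)"
  have c: "integrable circ (\<lambda>_. k)" for k :: real
    by (rule integrable_lebesgue_on_continuous) simp
  have "AE x in circ. w x - m = 0"
  proof (rule circ_fundamental_lemma)
    show "integrable circ (\<lambda>x. w x - m)" using w c by simp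
    fix \<psi> :: "real \<Rightarrow> real" assume \<psi>: "smooth \<psi>" "periodic \<psi>"
    define k where "k = (LINT x|circ. \<psi> x) / (2 * pi)"
    have i\<psi>: "integrable circ \<psi>"
      by (rule integrable_lebesgue_on_continuous[OF smooth_continuous_on[OF \<psi>(1)]])
    have iw: "integrable circ (\<lambda>x. w x * \<psi> x)"
      by (rule integrable_mult_continuous[OF w smooth_continuous_on[OF \<psi>(1)]])
    have "(LINT x|circ. \<psi> x - k) = 0"
      using i\<psi> c by (simp add: k_def)
    moreover have "smooth (\<lambda>x. \<psi> x - k)" "periodic (\<lambda>x. \<psi> x - k)"
      using \<psi> by (auto simp: periodic_def intro!: smooth_diff)
    ultimately obtain \<Psi> where \<Psi>: "smooth \<Psi>" "periodic \<Psi>" "deriv \<Psi> = (\<lambda>x. \<psi> x - k)"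
      using primitive_periodic by blast
    have "0 = (LINT x|circ. w x * (\<psi> x - k))"
      using zero[OF \<Psi>(1,2)] by (simp add: \<Psi>(3))
    also have "\<dots> = (LINT x|circ. w x * \<psi> x) - (LINT x|circ. w x) * k"
      using w iw by (simp add: right_diff_distrib)
    also have "\<dots> = (LINT x|circ. (w x - m) * \<psi> x)"
      using iw i\<psi> by (simp add: left_diff_distrib m_def k_def)
    finally show "(LINT x|circ. (w x - m) * \<psi> x) = 0" by simp
  qed
  then show ?thesis by (simp add: m_def)
qed

section \<open>Du Bois-Reymond's lemma on a time interval\<close>

lemma integral_continuous_pos:
  fixes f :: "real \<Rightarrow> real"
  assumes f: "continuous_on {a..b} f" and nonneg: "\<And>x. x \<in> {a..b} \<Longrightarrow> 0 \<le> f x"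
    and x: "x \<in> {a<..<b}" "f x > 0"
  shows "(LINT x|lebesgue_on {a..b}. f x) > 0"
proof -
  have i: "integrable (lebesgue_on {a..b}) f"
    by (rule integrable_lebesgue_on_continuous[OF f])
  have "(LINT x|lebesgue_on {a..b}. f x) \<noteq> 0"
  proof
    assume "(LINT x|lebesgue_on {a..b}. f x) = 0"
    then have "(f has_integral 0) (cbox a b)"
      using lebesgue_integral_eq_integral[OF i] integrable_on_lebesgue_on[OF i]
      by (simp add: has_integral_iff)
    from has_integral_0_cbox_imp_0[OF _ _ this, of x] f nonneg x show False by auto
  qed
  moreover have "(LINT x|lebesgue_on {a..b}. f x) \<ge> 0"
    using nonneg by (intro integral_nonneg_AE AE_I2) auto
  ultimately show ?thesis by simp
qed

text \<open>The primitive that vanishes at 0 is constant on each side of the support; the zero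
  integral makes the constant on the right vanish too.\<close>

lemma compactly_supported_primitive:
  fixes \<theta> :: "real \<Rightarrow> real"
  assumes \<theta>: "smooth \<theta>" and ab: "0 < a" "b < T" and supp: "\<And>t. t \<notin> {a..b} \<Longrightarrow> \<theta> t = 0"
    and T: "T > 0" and zero: "(LINT t|lebesgue_on {0..T}. \<theta> t) = 0"
  obtains \<Theta> where "smooth \<Theta>" "deriv \<Theta> = \<theta>" "\<And>t. t \<notin> {a..b} \<Longrightarrow> \<Theta> t = 0"
proof -
  obtain F where F: "\<And>t. (F has_real_derivative \<theta> t) (at t)"
    using primitive_exists[OF smooth_continuous_on[OF \<theta>]] by blast
  define \<Theta> where "\<Theta> t = F t - F 0" for t
  have D: "(\<Theta> has_real_derivative \<theta> t) (at t)" for t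
    unfolding \<Theta>_def using DERIV_diff[OF F[of t] DERIV_const[where k = "F 0"]] by simp
  have "\<Theta> T = 0"
    using FTC_lebesgue_on[of 0 T \<Theta> \<theta>] D T zero smooth_continuous_on[OF \<theta>] by (simp add: \<Theta>_def)
  have const: "\<Theta> s = \<Theta> t" if "convex S" "s \<in> S" "t \<in> S" "\<And>x. x \<in> S \<Longrightarrow> \<theta> x = 0" for S s t
  proof -
    have "\<exists>c. \<forall>x\<in>S. \<Theta> x = c"
      using that D by (intro has_field_derivative_zero_constant)
        (metis has_field_derivative_at_within)+
    then show ?thesis using that by metis
  qed
  show ?thesis
  proof (rule that[of \<Theta>])
    show "smooth \<Theta>" "deriv \<Theta> = \<theta>" using smooth_antiderivative[OF D \<theta>] .
    fix t assume "t \<notin> {a..b}"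
    then consider "t < a" | "t > b" by fastforce
    then show "\<Theta> t = 0"
    proof cases
      case 1
      then have "\<Theta> t = \<Theta> 0" using const[of "{..<a}" t 0] ab supp by auto
      then show ?thesis by (simp add: \<Theta>_def)
    next
      case 2
      then show ?thesis using const[of "{b<..}" t T] ab supp \<open>\<Theta> T = 0\<close> by auto
    qed
  qed
qed

text \<open>If h took different values at two interior points, a bump at one minus a bump of equal
  mass at the other would be the derivative of an admissible \<theta>, yet pair strictly positively
  with h. Continuity of h makes the conclusion hold at every time, endpoints included.\<close>

lemma interval_du_Bois_Reymond:
  fixes h :: "real \<Rightarrow> real"
  assumes T: "T > 0" and h: "continuous_on {0..T} h"
    and zero: "\<And>\<theta> a b. smooth \<theta> \<Longrightarrow> 0 < a \<Longrightarrow> b < T \<Longrightarrow> (\<And>t. t \<notin> {a..b} \<Longrightarrow> \<theta> t = 0) \<Longrightarrow>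
       (LINT t|lebesgue_on {0..T}. h t * deriv \<theta> t) = 0"
    and t: "t \<in> {0..T}"
  shows "h t = h 0"
proof -
  let ?M = "lebesgue_on {0..T}"
  have ic: "integrable ?M f" if "continuous_on {0..T} f" for f :: "real \<Rightarrow> real"
    using that by (rule integrable_lebesgue_on_continuous)
  have le: "\<not> h s1 > h s2" if s: "s1 \<in> {0<..<T}" "s2 \<in> {0<..<T}" for s1 s2
  proof
    assume gt: "h s1 > h s2"
    define c where "c = (h s1 + h s2) / 2"
    have c: "h s1 > c" "h s2 < c" using gt by (auto simp: c_def)
    have cont: "(h \<longlongrightarrow> h s) (at s)" if "s \<in> {0<..<T}" for s
      using continuous_on_interior[OF h, of s] that by (simp add: isCont_def)
    have "\<forall>\<^sub>F x in at s1. h x > c" "\<forall>\<^sub>F x in at s2. h x < c"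
      using order_tendstoD[OF cont[OF s(1)]] order_tendstoD[OF cont[OF s(2)]] c by auto
    then obtain d1 d2 where d: "d1 > 0" "d2 > 0"
      "\<And>x. \<bar>x - s1\<bar> < d1 \<Longrightarrow> h x > c" "\<And>x. \<bar>x - s2\<bar> < d2 \<Longrightarrow> h x < c"
      unfolding eventually_at dist_real_def using c by (metis (full_types) UNIV_I)
    \<comment> \<open>The radius keeps h above or below c on the bumps; the halved distances to 0
      and T keep their supports inside a compact part of the open interval.\<close>
    define r where "r = Min {d1, d2, s1 / 2, s2 / 2, (T - s1) / 2, (T - s2) / 2}"
    have "r > 0" using d s by (auto simp: r_def)
    have r: "r \<le> d1" "r \<le> d2" "r \<le> s1 / 2" "r \<le> s2 / 2" "r \<le> (T - s1) / 2" "r \<le> (T - s2) / 2"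
      unfolding r_def by (intro Min_le; simp)+
    obtain \<beta>1 where \<beta>1: "smooth \<beta>1" "\<And>x. \<beta>1 x \<ge> 0" "\<And>x. \<beta>1 x > 0 \<longleftrightarrow> \<bar>x - s1\<bar> < r"
      using bump_exists[OF \<open>r > 0\<close>, of s1] by blast
    obtain \<beta>2 where \<beta>2: "smooth \<beta>2" "\<And>x. \<beta>2 x \<ge> 0" "\<And>x. \<beta>2 x > 0 \<longleftrightarrow> \<bar>x - s2\<bar> < r"
      using bump_exists[OF \<open>r > 0\<close>, of s2] by blast
    note cb = smooth_continuous_on[OF \<beta>1(1)] smooth_continuous_on[OF \<beta>2(1)]
    define Z1 where "Z1 = (LINT t|?M. \<beta>1 t)"
    define Z2 where "Z2 = (LINT t|?M. \<beta>2 t)"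
    have Z: "Z1 > 0" "Z2 > 0"
      unfolding Z1_def Z2_def using cb \<beta>1 \<beta>2 s \<open>r > 0\<close>
      by (intro integral_continuous_pos[of 0 T \<beta>1 s1] integral_continuous_pos[of 0 T \<beta>2 s2]; simp)+
    \<comment> \<open>Both bumps are normalised to mass 1, so the difference has integral 0 and
      possesses a compactly supported primitive.\<close>
    define \<theta> where "\<theta> t = (1 / Z1) * \<beta>1 t - (1 / Z2) * \<beta>2 t" for t
    have \<theta>: "smooth \<theta>"
      unfolding \<theta>_def by (intro smooth_diff smooth_cmult \<beta>1 \<beta>2)
    have "(LINT t|?M. \<theta> t) = 0"
      unfolding \<theta>_def using Z ic cb by (simp flip: Z1_def Z2_def)
    moreover have supp: "\<theta> t = 0" if "t \<notin> {min s1 s2 - r..max s1 s2 + r}" for t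
    proof -
      have "\<not> \<beta>1 t > 0" "\<not> \<beta>2 t > 0" using that \<beta>1(3) \<beta>2(3) by auto
      then have "\<beta>1 t = 0" "\<beta>2 t = 0" using \<beta>1(2)[of t] \<beta>2(2)[of t] by auto
      then show ?thesis by (simp add: \<theta>_def)
    qed
    moreover have ab: "0 < min s1 s2 - r" "max s1 s2 + r < T"
      using r s by (auto simp: min_def max_def)
    ultimately obtain \<Theta> where \<Theta>: "smooth \<Theta>" "deriv \<Theta> = \<theta>"
        "\<And>t. t \<notin> {min s1 s2 - r..max s1 s2 + r} \<Longrightarrow> \<Theta> t = 0"
      using compactly_supported_primitive[OF \<theta> ab _ T] by blast
    have "(LINT t|?M. h t * \<theta> t) = 0"
      using zero[OF \<Theta>(1) ab \<Theta>(3)] by (simp add: \<Theta>(2))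
    moreover have "(LINT t|?M. h t * \<theta> t) =
        (1 / Z1) * (LINT t|?M. (h t - c) * \<beta>1 t) + (1 / Z2) * (LINT t|?M. (c - h t) * \<beta>2 t)"
    proof -
      have i: "integrable ?M (\<lambda>t. (h t - c) * \<beta>1 t)" "integrable ?M (\<lambda>t. (c - h t) * \<beta>2 t)"
        "integrable ?M \<theta>"
        using cb h smooth_continuous_on[OF \<theta>] by (auto intro!: ic continuous_intros)
      \<comment> \<open>Adding and subtracting c costs nothing, as \<theta> has integral 0, and
        leaves two integrands that are nonnegative.\<close>
      have "(\<lambda>t. h t * \<theta> t) =
          (\<lambda>t. (1 / Z1) * ((h t - c) * \<beta>1 t) + (1 / Z2) * ((c - h t) * \<beta>2 t) + c * \<theta> t)"
        by (auto simp: \<theta>_def algebra_simps)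
      then show ?thesis using i \<open>(LINT t|?M. \<theta> t) = 0\<close> by simp
    qed
    moreover have "(LINT t|?M. (h t - c) * \<beta>1 t) > 0"
    proof (rule integral_continuous_pos[of _ _ _ s1])
      show "0 \<le> (h x - c) * \<beta>1 x" for x
        using \<beta>1(2,3)[of x] d(3)[of x] r(1) by (cases "\<bar>x - s1\<bar> < r") auto
      show "0 < (h s1 - c) * \<beta>1 s1" using \<beta>1(3)[of s1] c \<open>r > 0\<close> by simp
    qed (use cb h s in \<open>auto intro!: continuous_intros\<close>)
    moreover have "(LINT t|?M. (c - h t) * \<beta>2 t) > 0"
    proof (rule integral_continuous_pos[of _ _ _ s2])
      show "0 \<le> (c - h x) * \<beta>2 x" for x
        using \<beta>2(2,3)[of x] d(4)[of x] r(2) by (cases "\<bar>x - s2\<bar> < r") auto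
      show "0 < (c - h s2) * \<beta>2 s2" using \<beta>2(3)[of s2] c \<open>r > 0\<close> by simp
    qed (use cb h s in \<open>auto intro!: continuous_intros\<close>)
    ultimately show False
      using Z by (smt (verit) mult_pos_pos zero_less_divide_1_iff)
  qed
  then have eq: "h s = h (T / 2)" if "s \<in> {0<..<T}" for s
    using that T by (metis field_sum_of_halves greaterThanLessThan_iff half_gt_zero less_add_same_cancel2 linorder_neqE)
  have "h s = h (T / 2)" if "s \<in> {0..T}" for s
  proof -
    have cl: "closure {0<..<T} = {0..T}" using T by simp
    show ?thesis
      by (rule continuous_constant_on_closure[of "{0<..<T}" h "h (T / 2)"])
        (simp_all only: cl h eq that)
  qed
  then show ?thesis using t T by (metis atLeastAtMost_iff order_refl less_imp_le)
qed

section \<open>Lebesgue measure on the plane and periodic functions\<close>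

text \<open>Preimages of Borel null sets are null, so a Borel measure-preserving map stays
  measurable and measure-preserving between the completions.\<close>

lemma measure_preserving_lebesgue:
  fixes h :: "'a::euclidean_space \<Rightarrow> 'b::euclidean_space"
  assumes h: "h \<in> borel_measurable borel" and pres: "distr lborel borel h = lborel"
  shows "h \<in> lebesgue \<rightarrow>\<^sub>M lebesgue" "distr lebesgue lebesgue h = lebesgue"
proof -
  have h': "h \<in> lborel \<rightarrow>\<^sub>M lborel" using h by simp
  then have hl: "h \<in> lebesgue \<rightarrow>\<^sub>M lborel" by (rule measurable_completion)
  have "distr lebesgue lborel h = distr lborel lborel h"
    by (rule distr_completion[OF h'])
  also have "\<dots> = lborel" using pres by (metis distr_cong sets_lborel)
  finally have *: "distr lebesgue lborel h = lborel" .
  show "h \<in> lebesgue \<rightarrow>\<^sub>M lebesgue"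
    by (rule completion.measurable_completion2[OF hl]) (simp add: *)
  have "completion (distr lebesgue lborel h) = distr lebesgue lebesgue h"
    by (rule completion.completion_distr_eq[OF hl]) (simp add: *)
  then show "distr lebesgue lebesgue h = lebesgue" by (simp add: *)
qed

lemma
  fixes h :: "'a::euclidean_space \<Rightarrow> 'b::euclidean_space"
  assumes h: "h \<in> borel_measurable borel" "distr lborel borel h = lborel"
  shows AE_lebesgue_preserved: "(AE x in lebesgue. P x) \<Longrightarrow> (AE x in lebesgue. P (h x))"
    and integrable_lebesgue_preserved:
      "integrable lebesgue (f :: 'b \<Rightarrow> real) \<Longrightarrow> integrable lebesgue (\<lambda>x. f (h x))"
    and integral_lebesgue_preserved:
      "f \<in> borel_measurable lebesgue \<Longrightarrow> (LINT x|lebesgue. f (h x)) = (LINT x|lebesgue. f x)"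
proof -
  note l = measure_preserving_lebesgue[OF h]
  show "(AE x in lebesgue. P x) \<Longrightarrow> (AE x in lebesgue. P (h x))"
    using AE_distrD[OF l(1), of P] unfolding l(2) .
  show "integrable lebesgue f \<Longrightarrow> integrable lebesgue (\<lambda>x. f (h x))"
    using integrable_distr[OF l(1), of f] unfolding l(2) .
  show "f \<in> borel_measurable lebesgue \<Longrightarrow> (LINT x|lebesgue. f (h x)) = (LINT x|lebesgue. f x)"
    using integral_distr[OF l(1), of f] unfolding l(2) by (rule sym)
qed

lemma distr_shift: "distr lborel borel (\<lambda>x. x + c) = (lborel :: real measure)"
  using lborel_distr_plus[of c] by (simp add: add.commute[of _ c])

text \<open>For fixed t the shear is the translation by \<open>s * t\<close> in the second
  coordinate; integrating the measures of the slices gives the claim.\<close>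

lemma distr_shear: "distr lborel borel (\<lambda>p. (fst p, snd p + s * fst p)) = (lborel :: (real \<times> real) measure)"
proof (rule measure_eqI)
  let ?h = "\<lambda>p::real \<times> real. (fst p, snd p + s * fst p)"
  have [measurable]: "?h \<in> borel \<rightarrow>\<^sub>M borel"
    by (intro borel_measurable_continuous_onI continuous_intros)
  fix X :: "(real \<times> real) set" assume "X \<in> sets (distr lborel borel ?h)"
  then have X [measurable]: "X \<in> sets borel" by simp
  have em: "emeasure lborel Y = (\<integral>\<^sup>+t. emeasure lborel (Pair t -` Y) \<partial>lborel)"
    if "Y \<in> sets borel" for Y :: "(real \<times> real) set"
    using lborel.emeasure_pair_measure_alt[of Y lborel] that unfolding lborel_prod by simp
  have slice: "Pair t -` Y \<in> sets borel" if "Y \<in> sets borel" for Y :: "(real \<times> real) set" and t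
    using sets_Pair1[of Y lborel lborel t] that unfolding lborel_prod by simp
  have "emeasure (distr lborel borel ?h) X = emeasure lborel (?h -` X)"
    by (subst emeasure_distr) auto
  also have "\<dots> = (\<integral>\<^sup>+t. emeasure lborel (Pair t -` (?h -` X)) \<partial>lborel)"
    using measurable_sets_borel[of ?h borel X] by (intro em) auto
  also have "\<dots> = (\<integral>\<^sup>+t. emeasure lborel (Pair t -` X) \<partial>lborel)"
  proof (intro nn_integral_cong)
    fix t :: real
    have "emeasure lborel (Pair t -` X) = emeasure (distr lborel borel (\<lambda>x. x + s * t)) (Pair t -` X)"
      by (simp add: distr_shift)
    also have "\<dots> = emeasure lborel ((\<lambda>x. x + s * t) -` (Pair t -` X))"
      using slice[OF X, of t] by (subst emeasure_distr) auto
    also have "(\<lambda>x. x + s * t) -` (Pair t -` X) = Pair t -` (?h -` X)" by auto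
    finally show "emeasure lborel (Pair t -` (?h -` X)) = emeasure lborel (Pair t -` X)" by simp
  qed
  also have "\<dots> = emeasure lborel X" using em[OF X] by simp
  finally show "emeasure (distr lborel borel ?h) X = emeasure lborel X" .
qed auto

lemma distr_swap: "distr lborel borel (\<lambda>p. (snd p, fst p)) = (lborel :: (real \<times> real) measure)"
proof -
  have "distr lborel borel (\<lambda>p::real \<times> real. (snd p, fst p)) =
      distr (lborel \<Otimes>\<^sub>M lborel) (lborel \<Otimes>\<^sub>M lborel) (\<lambda>(x, y). (y, x))"
    by (rule distr_cong) (simp_all only: lborel_prod sets_lborel case_prod_beta)
  also have "\<dots> = lborel \<Otimes>\<^sub>M lborel"
    by (rule lborel_pair.distr_pair_swap[symmetric])
  finally show ?thesis by (simp only: lborel_prod)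
qed

lemma shear_measurable: "(\<lambda>p::real \<times> real. (fst p, snd p + s * fst p)) \<in> borel_measurable borel"
  and swap_measurable: "(\<lambda>p::real \<times> real. (snd p, fst p)) \<in> borel_measurable borel"
  and shift_measurable: "(\<lambda>x::real. x + c) \<in> borel_measurable borel"
  by (intro borel_measurable_continuous_onI continuous_intros)+

lemmas AE_shear = AE_lebesgue_preserved[OF shear_measurable distr_shear]
lemmas AE_shift = AE_lebesgue_preserved[OF shift_measurable distr_shift]
lemmas AE_swap = AE_lebesgue_preserved[OF swap_measurable distr_swap]
lemmas measurable_shear = measure_preserving_lebesgue(1)[OF shear_measurable distr_shear]
lemmas measurable_shift = measure_preserving_lebesgue(1)[OF shift_measurable distr_shift]
lemmas measurable_swap = measure_preserving_lebesgue(1)[OF swap_measurable distr_swap]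

section \<open>Null sets and Fubini's theorem for the completed measure on the plane\<close>

lemma AE_lebesgue_pair:
  fixes P :: "real \<times> real \<Rightarrow> bool"
  assumes "AE p in lebesgue. P p"
  shows "AE t in lebesgue. AE x in lebesgue. P (t, x)"
proof -
  have "AE p in lborel \<Otimes>\<^sub>M lborel. P p"
    using assms unfolding AE_completion_iff lborel_prod .
  then show ?thesis
    using lborel_pair.AE_pair by (simp add: AE_completion_iff)
qed

text \<open>Split S into a Borel set and a subset of a Borel null set: the Borel part has null
  slices, hence is null by the product theorem. This is the passage from statements at almost every
  time to statements on space-time.\<close>

lemma AE_lebesgue_pairI:
  fixes S :: "(real \<times> real) set"
  assumes S: "S \<in> sets lebesgue" and ae: "AE t in lebesgue. AE x in lebesgue. (t, x) \<notin> S"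
  shows "AE p in lebesgue. p \<notin> S"
proof -
  obtain B N N' where B: "S = B \<union> N" "N \<subseteq> N'" "N' \<in> null_sets lborel" "B \<in> sets lborel"
    using sets_completionE[OF S] by blast
  have "AE t in lborel. AE x in lborel. (t, x) \<notin> B"
    using ae unfolding AE_completion_iff by (simp add: B(1))
  moreover have "{p \<in> space (lborel \<Otimes>\<^sub>M lborel). p \<notin> B} \<in> sets (lborel \<Otimes>\<^sub>M lborel)"
    using B(4) unfolding lborel_prod by (intro sets.sets_Collect_neg) auto
  ultimately have "AE p in lborel \<Otimes>\<^sub>M lborel. p \<notin> B"
    by (intro lborel_pair.AE_pair_measure)
  then have "AE p in lborel. p \<notin> B" unfolding lborel_prod .
  moreover have "AE p in lborel. p \<notin> N'" by (rule AE_not_in[OF B(3)])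
  ultimately have "AE p in lborel. p \<notin> S" using B by (auto elim: eventually_elim2)
  then show ?thesis by (rule AE_completion)
qed

lemma integrable_lebesgue_shift:
  "integrable lebesgue (f :: real \<Rightarrow> real) \<Longrightarrow> integrable lebesgue (\<lambda>x. f (x + c))"
  by (rule integrable_lebesgue_preserved[OF shift_measurable distr_shift])

lemma integral_lebesgue_shift:
  "integrable lebesgue (f :: real \<Rightarrow> real) \<Longrightarrow> (LINT x|lebesgue. f (x + c)) = (LINT x|lebesgue. f x)"
  by (rule integral_lebesgue_preserved[OF shift_measurable distr_shift]) auto

text \<open>A Borel function g equal to f almost everywhere satisfies Fubini's theorem for the
  product of Borel measures. For almost every t the slices of f and g agree almost everywhere, which
  transfers integrability and integrals back to f.\<close>

lemma Fubini_lebesgue: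
  fixes f :: "real \<times> real \<Rightarrow> real"
  assumes f: "integrable lebesgue f"
  shows "AE t in lebesgue. integrable lebesgue (\<lambda>x. f (t, x))"
    and "integrable lebesgue (\<lambda>t. LINT x|lebesgue. f (t, x))"
    and "(LINT p|lebesgue. f p) = (LINT t|lebesgue. LINT x|lebesgue. f (t, x))"
proof -
  obtain g where g: "g \<in> borel_measurable lborel" and ae: "AE p in lborel. f p = g p"
    using completion_ex_borel_measurable_real[of f lborel] f by auto
  have ae': "AE p in lebesgue. f p = g p" by (rule AE_completion[OF ae])
  have gl: "g \<in> borel_measurable lebesgue" using g by (rule measurable_completion)
  have ig: "integrable lborel g"
    using integrable_cong_AE_imp[OF f gl ae'] integrable_completion[of g lborel] g by simp
  then have igp: "integrable (lborel \<Otimes>\<^sub>M lborel) g" by (simp add: lborel_prod)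
  have g2: "g \<in> borel_measurable (lborel \<Otimes>\<^sub>M lborel)" using igp by auto
  have slice: "(\<lambda>x. g (t, x)) \<in> borel_measurable lborel" for t
    using measurable_Pair2[OF g2, of t] by simp
  have gint: "AE t in lebesgue. integrable lebesgue (\<lambda>x. g (t, x))"
    using lborel_pair.AE_integrable_fst'[OF igp] slice by (intro AE_completion) (simp add: integrable_completion)
  have eq: "AE t in lebesgue. AE x in lebesgue. f (t, x) = g (t, x)"
    by (rule AE_lebesgue_pair[OF ae'])
  have slf: "(\<lambda>x. f (t, x)) \<in> borel_measurable lebesgue" if "AE x in lebesgue. f (t, x) = g (t, x)" for t
  proof (rule borel_measurable_AE[OF measurable_completion[OF slice]])
    show "AE x in lebesgue. g (t, x) = f (t, x)" using that by eventually_elim simp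
  qed
  show "AE t in lebesgue. integrable lebesgue (\<lambda>x. f (t, x))"
    using eq gint
  proof eventually_elim
    case (elim t)
    have "AE x in lebesgue. g (t, x) = f (t, x)" using elim(1) by eventually_elim simp
    then show ?case by (rule integrable_cong_AE_imp[OF elim(2) slf[OF elim(1)]])
  qed
  have ints: "AE t in lebesgue. (LINT x|lborel. g (t, x)) = (LINT x|lebesgue. f (t, x))"
    using eq
  proof eventually_elim
    case (elim t)
    have eq': "AE x in lebesgue. g (t, x) = f (t, x)" using elim by eventually_elim simp
    have "(LINT x|lborel. g (t, x)) = (LINT x|lebesgue. g (t, x))"
      using slice by (intro integral_completion[symmetric]) auto
    also have "\<dots> = (LINT x|lebesgue. f (t, x))"
      using eq' slf[OF elim] measurable_completion[OF slice]
      by (intro Bochner_Integration.integral_cong_AE)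
    finally show ?case .
  qed
  have ig1: "integrable lborel (\<lambda>t. LINT x|lborel. g (t, x))"
    by (rule lborel_pair.integrable_fst'[OF igp])
  then have ig1': "integrable lebesgue (\<lambda>t. LINT x|lborel. g (t, x))"
    using integrable_completion[of "\<lambda>t. LINT x|lborel. g (t, x)" lborel] by auto
  have m: "(\<lambda>t. LINT x|lebesgue. f (t, x)) \<in> borel_measurable lebesgue"
    using borel_measurable_AE[OF _ ints] ig1' by auto
  show "integrable lebesgue (\<lambda>t. LINT x|lebesgue. f (t, x))"
    by (rule integrable_cong_AE_imp[OF ig1' m ints])
  have "(LINT p|lebesgue. f p) = (LINT p|lebesgue. g p)"
    using f gl ae' by (intro Bochner_Integration.integral_cong_AE) auto
  also have "\<dots> = integral\<^sup>L (lborel \<Otimes>\<^sub>M lborel) g"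
    using integral_completion[of g lborel] g by (simp add: lborel_prod)
  also have "\<dots> = (LINT t|lborel. LINT x|lborel. g (t, x))"
    by (rule lborel_pair.integral_fst'[OF igp, symmetric])
  also have "\<dots> = (LINT t|lebesgue. LINT x|lborel. g (t, x))"
    using ig1 by (intro integral_completion[symmetric]) auto
  also have "\<dots> = (LINT t|lebesgue. LINT x|lebesgue. f (t, x))"
    using m ig1' ints by (intro Bochner_Integration.integral_cong_AE) auto
  finally show "(LINT p|lebesgue. f p) = (LINT t|lebesgue. LINT x|lebesgue. f (t, x))" .
qed

text \<open>Tonelli's criterion in the form suited to curves: measurability is joint, while
  integrability is controlled slice by slice through an integrable majorant of the slice
  norms.\<close>

lemma integrable_lebesgue_pairI:
  fixes f :: "real \<times> real \<Rightarrow> real"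
  assumes f: "f \<in> borel_measurable lebesgue"
    and ae: "AE t in lebesgue. integrable lebesgue (\<lambda>x. f (t, x)) \<and> (LINT x|lebesgue. \<bar>f (t, x)\<bar>) \<le> h t"
    and h: "integrable lebesgue h"
  shows "integrable lebesgue f"
proof -
  obtain g where g: "g \<in> borel_measurable lborel" and aeg: "AE p in lborel. f p = g p"
    using completion_ex_borel_measurable_real[of f lborel] f by auto
  have ae': "AE p in lebesgue. g p = f p" using AE_completion[OF aeg] by eventually_elim simp
  have gl: "g \<in> borel_measurable lebesgue" using g by (rule measurable_completion)
  have g2 [measurable]: "g \<in> borel_measurable (lborel \<Otimes>\<^sub>M lborel)" using g by (simp add: lborel_prod)
  have slice: "(\<lambda>x. g (t, x)) \<in> borel_measurable lborel" for t
    using measurable_Pair2[OF g2, of t] by simp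
  have "AE t in lebesgue. integrable lborel (\<lambda>x. g (t, x)) \<and> (LINT x|lborel. norm (g (t, x))) \<le> h t"
    using ae AE_lebesgue_pair[OF ae'] AE_lebesgue_pair[OF AE_completion[OF aeg]]
  proof eventually_elim
    case (elim t)
    note sl = measurable_completion[OF slice, of t]
    have il: "integrable lebesgue (\<lambda>x. g (t, x))"
      by (rule integrable_cong_AE_imp[OF conjunct1[OF elim(1)] sl elim(3)])
    have "(LINT x|lebesgue. \<bar>g (t, x)\<bar>) = (LINT x|lebesgue. \<bar>f (t, x)\<bar>)"
    proof (rule Bochner_Integration.integral_cong_AE)
      show "AE x in lebesgue. \<bar>g (t, x)\<bar> = \<bar>f (t, x)\<bar>" using elim(2) by eventually_elim simp
    qed (use il elim(1) in auto)
    moreover have "(LINT x|lebesgue. \<bar>g (t, x)\<bar>) = (LINT x|lborel. \<bar>g (t, x)\<bar>)"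
      using slice by (intro integral_completion) auto
    ultimately show ?case using il elim slice by (simp add: integrable_completion)
  qed
  then have ae2: "AE t in lborel. integrable lborel (\<lambda>x. g (t, x)) \<and> (LINT x|lborel. norm (g (t, x))) \<le> h t"
    by (simp add: AE_completion_iff)
  have "integrable (lborel \<Otimes>\<^sub>M lborel) g"
  proof (rule lborel_pair.Fubini_integrable)
    show "AE t in lborel. integrable lborel (\<lambda>x. g (t, x))" using ae2 by eventually_elim auto
    have m: "(\<lambda>t. LINT x|lborel. norm (g (t, x))) \<in> borel_measurable lborel"
      by measurable
    have "integrable lebesgue (\<lambda>t. LINT x|lborel. norm (g (t, x)))"
    proof (rule Bochner_Integration.integrable_bound[OF h measurable_completion[OF m]])
      show "AE t in lebesgue. norm (LINT x|lborel. norm (g (t, x))) \<le> norm (h t)"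
        using AE_completion[OF ae2]
      proof eventually_elim
        case (elim t)
        have "0 \<le> (LINT x|lborel. norm (g (t, x)))" by simp
        moreover have "h t \<le> \<bar>h t\<bar>" by simp
        ultimately show ?case using conjunct2[OF elim] by simp
      qed
    qed
    then show "integrable lborel (\<lambda>t. LINT x|lborel. norm (g (t, x)))"
      using m by (simp add: integrable_completion)
  qed auto
  then have "integrable lebesgue g"
    using g by (simp add: lborel_prod integrable_completion)
  then show ?thesis by (rule integrable_cong_AE_imp[OF _ f ae'])
qed

text \<open>Extension by zero reduces to the whole plane. The second order of integration comes from
  exchanging the coordinates, which preserves the measure.\<close>

lemma Fubini_lebesgue_on:
  fixes f :: "real \<times> real \<Rightarrow> real"
  assumes A: "A \<in> sets borel" and B: "B \<in> sets borel" and f: "integrable (lebesgue_on (A \<times> B)) f"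
  shows "(LINT p|lebesgue_on (A \<times> B). f p) = (LINT t|lebesgue_on A. LINT x|lebesgue_on B. f (t, x))"
    and "(LINT p|lebesgue_on (A \<times> B). f p) = (LINT x|lebesgue_on B. LINT t|lebesgue_on A. f (t, x))"
proof -
  define F where "F p = (if p \<in> A \<times> B then f p else 0)" for p
  have AB: "A \<times> B \<in> sets lebesgue"
    using pair_measureI[OF A B] unfolding borel_prod by simp
  have ABl: "A \<in> sets lebesgue" "B \<in> sets lebesgue" using A B by auto
  have F: "integrable lebesgue F"
    unfolding F_def using f AB by (simp add: Lebesgue_Measure.integrable_restrict_UNIV)
  have FI: "(LINT p|lebesgue_on (A \<times> B). f p) = (LINT p|lebesgue. F p)"
    unfolding F_def using AB by (simp add: Lebesgue_Measure.integral_restrict_UNIV)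
  have "(LINT x|lebesgue. F (t, x)) = (if t \<in> A then LINT x|lebesgue_on B. f (t, x) else 0)" for t
    using Lebesgue_Measure.integral_restrict_UNIV[OF ABl(2), of "\<lambda>x. f (t, x)"] by (simp add: F_def)
  then show "(LINT p|lebesgue_on (A \<times> B). f p) = (LINT t|lebesgue_on A. LINT x|lebesgue_on B. f (t, x))"
    using Fubini_lebesgue(3)[OF F] FI ABl by (simp add: Lebesgue_Measure.integral_restrict_UNIV)
  have "(LINT p|lebesgue. F p) = (LINT p|lebesgue. F (snd p, fst p))"
    using F by (intro integral_lebesgue_preserved[OF swap_measurable distr_swap, symmetric]) auto
  also have "\<dots> = (LINT x|lebesgue. LINT t|lebesgue. F (t, x))"
    using Fubini_lebesgue(3)[OF integrable_lebesgue_preserved[OF swap_measurable distr_swap F]] by simp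
  finally have S: "(LINT p|lebesgue. F p) = (LINT x|lebesgue. LINT t|lebesgue. F (t, x))" .
  have "(LINT t|lebesgue. F (t, x)) = (if x \<in> B then LINT t|lebesgue_on A. f (t, x) else 0)" for x
    using Lebesgue_Measure.integral_restrict_UNIV[OF ABl(1), of "\<lambda>t. f (t, x)"] by (simp add: F_def)
  then show "(LINT p|lebesgue_on (A \<times> B). f p) = (LINT x|lebesgue_on B. LINT t|lebesgue_on A. f (t, x))"
    using S FI ABl by (simp add: Lebesgue_Measure.integral_restrict_UNIV)
qed

section \<open>Periodic functions and integration over one period\<close>

lemma periodic_int: "periodic f \<Longrightarrow> f (x + 2 * pi * of_int k) = f x"
proof (induction k rule: int_induct[where k = 0])
  case base
  then show ?case by simp
next
  case (step1 i)
  then show ?case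
    unfolding periodic_def using spec[OF step1(3)[unfolded periodic_def], of "x + 2 * pi * of_int i"]
    by (simp add: algebra_simps)
next
  case (step2 i)
  then show ?case
    unfolding periodic_def using spec[OF step2(3)[unfolded periodic_def], of "x + 2 * pi * of_int (i - 1)"]
    by (simp add: algebra_simps)
qed

lemma circle_representative:
  obtains k :: int where "x + 2 * pi * of_int k \<in> {0..2 * pi}"
proof
  define k where "k = \<lfloor>x / (2 * pi)\<rfloor>"
  have "of_int k \<le> x / (2 * pi)" "x / (2 * pi) < of_int k + 1"
    by (auto simp: k_def)
  then show "x + 2 * pi * of_int (- k) \<in> {0..2 * pi}"
    by (auto simp: field_simps)
qed

text \<open>The exceptional set is contained in countably many translates of a null set by multiples
  of 2 pi. Here \<open>periodic\<close> is applied to a predicate.\<close>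

lemma periodic_AE:
  assumes P: "periodic P" and ae: "AE x in circ. P x"
  shows "AE x in lebesgue. P x"
proof -
  have "AE x in lebesgue. x \<in> {0..2 * pi} \<longrightarrow> P x"
    using ae by (simp add: AE_circ_iff)
  then have "AE x in lebesgue. \<forall>k::int. x + 2 * pi * of_int k \<in> {0..2 * pi} \<longrightarrow> P (x + 2 * pi * of_int k)"
    unfolding AE_all_countable by (intro allI AE_shift)
  then show ?thesis
  proof eventually_elim
    case (elim x)
    then show ?case using circle_representative[of x] periodic_int[OF P] by metis
  qed
qed

text \<open>Modulo 2 pi the shift is some r in [0, 2 pi]. Cut the period at r: the part right of r
  moves by - r, the part left of r by 2 pi - r, and together they fill one period again.\<close>

lemma
  assumes f: "integrable circ (f :: real \<Rightarrow> real)" and per: "periodic f"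
  shows integrable_circ_shift: "integrable circ (\<lambda>x. f (x + c))"
    and integral_circ_shift: "(LINT x|circ. f (x + c)) = (LINT x|circ. f x)"
proof -
  let ?I = "{0..2 * pi}"
  obtain k :: int where k: "c + 2 * pi * of_int k \<in> ?I" using circle_representative .
  define r where "r = c + 2 * pi * of_int k"
  have rI: "0 \<le> r" "r \<le> 2 * pi" using k by (auto simp: r_def)
  have fc: "f (x + c) = f (x + r)" for x
    using periodic_int[OF per, of "x + c" k] by (simp add: r_def algebra_simps)
  define F where "F x = (if x \<in> ?I then f x else 0)" for x
  have F: "integrable lebesgue F"
    unfolding F_def using f by (subst Lebesgue_Measure.integrable_restrict_UNIV) auto
  have FI: "(LINT x|circ. f x) = (LINT x|lebesgue. F x)"
    unfolding F_def by (subst Lebesgue_Measure.integral_restrict_UNIV) auto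
  have ind: "(\<lambda>y. indicator ?I (y + d) :: real) \<in> borel_measurable lebesgue" for d
    by (intro measurable_completion) simp
  \<comment> \<open>\<open>A\<close> is the part of F on [r, 2 pi] and \<open>B\<close> the part on
    [0, r]; each indicator is written as the condition that the translated point lies in the
    period.\<close>
  define A where "A y = F y * indicator ?I (y + (- r))" for y
  define B where "B y = F y * indicator ?I (y + (2 * pi - r))" for y
  have AB: "integrable lebesgue A" "integrable lebesgue B"
    unfolding A_def B_def by (rule integrable_mult_bounded[OF F ind, where C = 1]; simp add: indicator_def)+
  have "AE x in lebesgue. x \<noteq> 0 \<and> x \<noteq> 2 * pi \<and> x \<noteq> r"
    by (intro AE_completion) (auto intro!: AE_conjI AE_lborel_singleton)
  then have sum: "AE y in lebesgue. A y + B y = F y"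
  proof eventually_elim
    case (elim y)
    then show ?case using rI by (auto simp: A_def B_def F_def indicator_def)
  qed
  have ABs: "integrable lebesgue (\<lambda>x. A (x + r))" "integrable lebesgue (\<lambda>x. B (x + (r - 2 * pi)))"
    by (rule integrable_lebesgue_shift[OF AB(1)], rule integrable_lebesgue_shift[OF AB(2)])
  have "AE x in lebesgue. x \<noteq> 0 \<and> x \<noteq> 2 * pi \<and> x \<noteq> - r \<and> x \<noteq> 2 * pi - r"
    by (intro AE_completion) (auto intro!: AE_conjI AE_lborel_singleton)
  then have eq: "AE x in lebesgue. A (x + r) + B (x + (r - 2 * pi)) = (if x \<in> ?I then f (x + r) else 0)"
  proof eventually_elim
    case (elim x)
    have "f (x + r) = f (x + r - 2 * pi)"
      using periodic_int[OF per, of "x + r" "-1"] by simp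
    then show ?case using elim rI by (auto simp: A_def B_def F_def indicator_def algebra_simps)
  qed
  have m: "(\<lambda>x. if x \<in> ?I then f (x + r) else 0) \<in> borel_measurable lebesgue"
    using borel_measurable_AE[OF _ eq] ABs by auto
  have int: "integrable lebesgue (\<lambda>x. if x \<in> ?I then f (x + r) else 0)"
    using ABs by (intro integrable_cong_AE_imp[OF _ m eq]) auto
  then show "integrable circ (\<lambda>x. f (x + c))"
    unfolding fc by (subst (asm) Lebesgue_Measure.integrable_restrict_UNIV) auto
  have "(LINT x|circ. f (x + c)) = (LINT x|lebesgue. (if x \<in> ?I then f (x + r) else 0))"
    unfolding fc by (subst Lebesgue_Measure.integral_restrict_UNIV) auto
  also have "\<dots> = (LINT x|lebesgue. A (x + r) + B (x + (r - 2 * pi)))"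
  proof (rule Bochner_Integration.integral_cong_AE)
    show "AE x in lebesgue. (if x \<in> ?I then f (x + r) else 0) = A (x + r) + B (x + (r - 2 * pi))"
      using eq by eventually_elim simp
  qed (use m ABs in auto)
  also have "\<dots> = (LINT x|lebesgue. A x) + (LINT x|lebesgue. B x)"
    using ABs AB by (simp add: integral_lebesgue_shift)
  also have "\<dots> = (LINT x|lebesgue. F x)"
    using AB F sum by (simp flip: Bochner_Integration.integral_add, intro Bochner_Integration.integral_cong_AE) auto
  finally show "(LINT x|circ. f (x + c)) = (LINT x|circ. f x)" by (simp add: FI)
qed

section \<open>Transport along characteristics\<close>

lemma
  assumes "f \<in> L2"
  shows L2_periodic: "periodic f"
    and L2_measurable: "f \<in> borel_measurable lebesgue"
    and L2_measurable_circ: "f \<in> borel_measurable circ"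
    and L2_integrable_square: "integrable circ (\<lambda>x. (f x)\<^sup>2)"
  using assms by (auto simp: L2_def intro: measurable_restrict_space1)

lemma L2_integrable:
  assumes "f \<in> L2"
  shows "integrable circ f"
proof (rule Bochner_Integration.integrable_bound)
  show "integrable circ (\<lambda>x. 1 + (f x)\<^sup>2)"
    by (intro Bochner_Integration.integrable_add[OF _ L2_integrable_square[OF assms]]
        integrable_lebesgue_on_continuous) auto
  have "\<bar>f x\<bar> \<le> 1 + (f x)\<^sup>2" for x
    using sum_squares_bound[of 1 "\<bar>f x\<bar>"] by simp
  then show "AE x in circ. norm (f x) \<le> norm (1 + (f x)\<^sup>2)" by auto
qed (rule L2_measurable_circ[OF assms])

lemma L2_cmult: "f \<in> L2 \<Longrightarrow> (\<lambda>x. c * f x) \<in> L2"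
  by (auto simp: L2_def periodic_def power_mult_distrib)

lemma L2_add:
  assumes "f \<in> L2" "g \<in> L2"
  shows "(\<lambda>x. f x + g x) \<in> L2"
proof -
  have "integrable circ (\<lambda>x. (f x + g x)\<^sup>2)"
  proof (rule Bochner_Integration.integrable_bound)
    show "integrable circ (\<lambda>x. 2 * (f x)\<^sup>2 + 2 * (g x)\<^sup>2)"
      using assms by (intro Bochner_Integration.integrable_add integrable_mult_right L2_integrable_square)
    have "(f x + g x)\<^sup>2 \<le> 2 * (f x)\<^sup>2 + 2 * (g x)\<^sup>2" for x
      using sum_squares_bound[of "f x" "g x"] by (simp add: power2_sum)
    then show "AE x in circ. norm ((f x + g x)\<^sup>2) \<le> norm (2 * (f x)\<^sup>2 + 2 * (g x)\<^sup>2)"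
      by auto
    show "(\<lambda>x. (f x + g x)\<^sup>2) \<in> borel_measurable circ"
      using L2_measurable_circ[OF assms(1)] L2_measurable_circ[OF assms(2)] by simp
  qed
  then show ?thesis using assms by (auto simp: L2_def periodic_def)
qed

lemma L2_diff: "f \<in> L2 \<Longrightarrow> g \<in> L2 \<Longrightarrow> (\<lambda>x. f x - g x) \<in> L2"
  using L2_add[OF _ L2_cmult[of g "-1"], of f] by simp

lemma L2_norm_power2: "(L2_norm f)\<^sup>2 = (LINT x|circ. (f x)\<^sup>2)"
  by (simp add: L2_norm_def)

lemma L2_norm_nonneg: "L2_norm f \<ge> 0"
  by (simp add: L2_norm_def)

text \<open>The weighted inequality \<bar>f\<bar> \<le> N / 2 + f^2 / (2 N), with N the norm itself,
  replaces Cauchy-Schwarz. Integration yields the factor pi + 1 / 2, and 4 is a round bound for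
  it.\<close>

lemma L1_le_L2_norm:
  assumes f: "f \<in> L2"
  shows "(LINT x|circ. \<bar>f x\<bar>) \<le> 4 * L2_norm f"
proof (cases "L2_norm f = 0")
  case True
  then have "(LINT x|circ. (f x)\<^sup>2) = 0" using L2_norm_power2[of f] by simp
  then have "AE x in circ. (f x)\<^sup>2 = 0"
    using integral_nonneg_eq_0_iff_AE[OF L2_integrable_square[OF f]] by simp
  then have "(LINT x|circ. \<bar>f x\<bar>) = 0" by (intro integral_eq_zero_AE) auto
  then show ?thesis using True by simp
next
  case False
  define N where "N = L2_norm f"
  have N: "N > 0" using False L2_norm_nonneg[of f] by (simp add: N_def)
  have c: "integrable circ (\<lambda>_. N / 2)" by (rule integrable_lebesgue_on_continuous) simp
  have "(LINT x|circ. \<bar>f x\<bar>) \<le> (LINT x|circ. N / 2 + (f x)\<^sup>2 / (2 * N))"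
  proof (rule integral_mono)
    show "integrable circ (\<lambda>x. \<bar>f x\<bar>)" using L2_integrable[OF f] by simp
    show "integrable circ (\<lambda>x. N / 2 + (f x)\<^sup>2 / (2 * N))"
      using L2_integrable_square[OF f] c by auto
    fix x
    show "\<bar>f x\<bar> \<le> N / 2 + (f x)\<^sup>2 / (2 * N)"
      using N sum_squares_bound[of N "\<bar>f x\<bar>"] by (simp add: field_simps power2_eq_square)
  qed
  also have "\<dots> = 2 * pi * (N / 2) + N\<^sup>2 / (2 * N)"
    using L2_integrable_square[OF f] c L2_norm_power2[of f]
    by (subst Bochner_Integration.integral_add) (auto simp: N_def)
  also have "\<dots> = (pi + 1 / 2) * N"
    using N by (simp add: field_simps power2_eq_square)
  also have "\<dots> \<le> 4 * N"
  proof -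
    have "pi + 1 / 2 \<le> 4" using pi_less_4 pi_approx by simp
    then show ?thesis using N by (intro mult_right_mono) auto
  qed
  finally show ?thesis by (simp add: N_def)
qed

lemma periodic_continuous_bounded:
  assumes "periodic (\<psi> :: real \<Rightarrow> real)" "continuous_on UNIV \<psi>"
  obtains C where "C > 0" "\<And>x. \<bar>\<psi> x\<bar> \<le> C"
proof -
  have "compact (\<psi> ` {0..2 * pi})"
    using assms(2) by (intro compact_continuous_image continuous_on_subset[OF assms(2)]) auto
  then obtain C where C: "C > 0" "\<And>x. x \<in> {0..2 * pi} \<Longrightarrow> \<bar>\<psi> x\<bar> \<le> C"
    using compact_imp_bounded bounded_pos by (metis imageI real_norm_def)
  have "\<bar>\<psi> x\<bar> \<le> C" for x
  proof -
    obtain k :: int where k: "x + 2 * pi * of_int k \<in> {0..2 * pi}" using circle_representative .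
    then show ?thesis using C(2)[OF k] periodic_int[OF assms(1), of x k] by simp
  qed
  with C(1) show ?thesis by (rule that)
qed

lemma periodic_deriv:
  assumes "periodic \<psi>" "smooth (\<psi> :: real \<Rightarrow> real)"
  shows "periodic (deriv \<psi>)"
proof -
  have "deriv \<psi> (x + 2 * pi) = deriv \<psi> x" for x
  proof -
    have "((\<lambda>y. \<psi> (y + 2 * pi)) has_real_derivative deriv \<psi> (x + 2 * pi)) (at x)"
      using smooth_DERIV[OF assms(2)] DERIV_shift by blast
    then show ?thesis
      using assms(1) DERIV_imp_deriv by (fastforce simp: periodic_def)
  qed
  then show ?thesis by (simp add: periodic_def)
qed

lemma periodic_smooth_Lipschitz:
  assumes "periodic \<psi>" "smooth (\<psi> :: real \<Rightarrow> real)"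
  obtains C where "C > 0" "\<And>x y. \<bar>\<psi> x - \<psi> y\<bar> \<le> C * \<bar>x - y\<bar>"
proof -
  obtain C where C: "C > 0" "\<And>x. \<bar>deriv \<psi> x\<bar> \<le> C"
    using periodic_continuous_bounded[OF periodic_deriv[OF assms]
        smooth_continuous_on[OF smooth_deriv[OF assms(2)]]] by blast
  have "\<bar>\<psi> x - \<psi> y\<bar> \<le> C * \<bar>x - y\<bar>" for x y
    using field_differentiable_bound[of UNIV \<psi> "deriv \<psi>" C x y] C smooth_DERIV[OF assms(2)]
    by simp
  with C(1) show ?thesis by (rule that)
qed

lemma periodic_compose_affine:
  assumes "periodic \<psi>"
  shows "periodic (\<lambda>x. \<psi> (x + c))"
proof -
  have "\<psi> (x + c + 2 * pi) = \<psi> (x + c)" for x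
    using assms unfolding periodic_def by blast
  then show ?thesis by (simp add: periodic_def algebra_simps)
qed

lemma smooth_shift: "smooth (\<psi> :: real \<Rightarrow> real) \<Longrightarrow> smooth (\<lambda>x. \<psi> (x + c))"
  using smooth_compose[OF _ smooth_affine[of 1 c], of \<psi>] by simp

lemma deriv_shift:
  assumes "smooth (\<psi> :: real \<Rightarrow> real)"
  shows "deriv (\<lambda>x. \<psi> (x + c)) = (\<lambda>x. deriv \<psi> (x + c))"
  using smooth_DERIV[OF assms] DERIV_shift DERIV_imp_deriv by (intro ext) blast

text \<open>The curve moves in \<open>L2\<close> and the test function moves along characteristics.
  The first change is controlled by the norm and a bound for \<psi>, the second by the Lipschitz
  constant of \<psi>.\<close>

lemma curve_continuous_pairing:
  assumes w: "continuous_curve T L2 L2_norm w"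
    and \<psi>: "periodic \<psi>" "smooth \<psi>"
  shows "continuous_on {0..T} (\<lambda>t. LINT x|circ. w t x * \<psi> (x + s * t))"
  unfolding continuous_on_def
proof
  fix t assume t: "t \<in> {0..T}"
  let ?I = "\<lambda>t. LINT x|circ. w t x * \<psi> (x + s * t)"
  obtain C where C: "C > 0" "\<And>x. \<bar>\<psi> x\<bar> \<le> C"
    using periodic_continuous_bounded[OF \<psi>(1) smooth_continuous_on[OF \<psi>(2)]] by blast
  obtain C' where C': "C' > 0" "\<And>x y. \<bar>\<psi> x - \<psi> y\<bar> \<le> C' * \<bar>x - y\<bar>"
    using periodic_smooth_Lipschitz[OF \<psi>] by blast
  have L: "w r \<in> L2" if "r \<in> {0..T}" for r using w that by (simp add: continuous_curve_def)
  have i\<psi>: "integrable circ (\<lambda>x. f x * \<psi> (x + d))" if "integrable circ f" for f d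
    by (rule integrable_mult_continuous[OF that smooth_continuous_on[OF smooth_shift[OF \<psi>(2)]]])
  have "((\<lambda>r. ?I r - ?I t) \<longlongrightarrow> 0) (at t within {0..T})"
  proof (rule Lim_null_comparison)
    show "\<forall>\<^sub>F r in at t within {0..T}. norm (?I r - ?I t) \<le>
        4 * C * L2_norm (\<lambda>x. w r x - w t x) + C' * \<bar>s\<bar> * \<bar>r - t\<bar> * (LINT x|circ. \<bar>w t x\<bar>)"
      unfolding eventually_at_filter
    proof (rule eventuallyI, intro impI)
      fix r assume r: "r \<in> {0..T}"
      note iw = L2_integrable[OF L[OF r]] L2_integrable[OF L[OF t]]
      have "norm (?I r - ?I t) = \<bar>LINT x|circ. w r x * \<psi> (x + s * r) - w t x * \<psi> (x + s * t)\<bar>"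
        using i\<psi> iw by simp
      also have "\<dots> \<le> (LINT x|circ. \<bar>w r x * \<psi> (x + s * r) - w t x * \<psi> (x + s * t)\<bar>)"
        by (rule integral_abs_bound)
      also have "\<dots> \<le> (LINT x|circ. C * \<bar>w r x - w t x\<bar> + C' * \<bar>s\<bar> * \<bar>r - t\<bar> * \<bar>w t x\<bar>)"
      proof (rule integral_mono)
        show "integrable circ (\<lambda>x. \<bar>w r x * \<psi> (x + s * r) - w t x * \<psi> (x + s * t)\<bar>)"
          using i\<psi> iw by simp
        show "integrable circ (\<lambda>x. C * \<bar>w r x - w t x\<bar> + C' * \<bar>s\<bar> * \<bar>r - t\<bar> * \<bar>w t x\<bar>)"
          using iw by simp
        fix x
        \<comment> \<open>Product rule for differences: one factor changes at a time, the test
          function being kept at time r in the first term.\<close>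
        have "w r x * \<psi> (x + s * r) - w t x * \<psi> (x + s * t) =
            (w r x - w t x) * \<psi> (x + s * r) + w t x * (\<psi> (x + s * r) - \<psi> (x + s * t))"
          by (simp add: algebra_simps)
        also have "\<bar>\<dots>\<bar> \<le> \<bar>w r x - w t x\<bar> * \<bar>\<psi> (x + s * r)\<bar> + \<bar>w t x\<bar> * \<bar>\<psi> (x + s * r) - \<psi> (x + s * t)\<bar>"
          by (metis abs_mult abs_triangle_ineq)
        also have "\<dots> \<le> \<bar>w r x - w t x\<bar> * C + \<bar>w t x\<bar> * (C' * \<bar>x + s * r - (x + s * t)\<bar>)"
          by (intro add_mono mult_left_mono C C') auto
        also have "\<bar>x + s * r - (x + s * t)\<bar> = \<bar>s\<bar> * \<bar>r - t\<bar>"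
          by (simp add: abs_mult flip: right_diff_distrib)
        finally show "\<bar>w r x * \<psi> (x + s * r) - w t x * \<psi> (x + s * t)\<bar> \<le>
            C * \<bar>w r x - w t x\<bar> + C' * \<bar>s\<bar> * \<bar>r - t\<bar> * \<bar>w t x\<bar>"
          by (simp add: mult_ac)
      qed
      also have "\<dots> = C * (LINT x|circ. \<bar>w r x - w t x\<bar>) + C' * \<bar>s\<bar> * \<bar>r - t\<bar> * (LINT x|circ. \<bar>w t x\<bar>)"
        using iw by simp
      also have "\<dots> \<le> C * (4 * L2_norm (\<lambda>x. w r x - w t x)) + C' * \<bar>s\<bar> * \<bar>r - t\<bar> * (LINT x|circ. \<bar>w t x\<bar>)"
        using C(1) L1_le_L2_norm[OF L2_diff[OF L[OF r] L[OF t]]] by (intro add_right_mono mult_left_mono) auto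
      finally show "norm (?I r - ?I t) \<le>
          4 * C * L2_norm (\<lambda>x. w r x - w t x) + C' * \<bar>s\<bar> * \<bar>r - t\<bar> * (LINT x|circ. \<bar>w t x\<bar>)"
        by (simp add: mult_ac)
    qed
    have "((\<lambda>r. L2_norm (\<lambda>x. w r x - w t x)) \<longlongrightarrow> 0) (at t within {0..T})"
      using w t by (simp add: continuous_curve_def)
    then have "((\<lambda>r. 4 * C * L2_norm (\<lambda>x. w r x - w t x) + C' * \<bar>s\<bar> * \<bar>r - t\<bar> * (LINT x|circ. \<bar>w t x\<bar>))
        \<longlongrightarrow> 4 * C * 0 + C' * \<bar>s\<bar> * \<bar>t - t\<bar> * (LINT x|circ. \<bar>w t x\<bar>)) (at t within {0..T})"
      by (intro tendsto_intros)
    then show "((\<lambda>r. 4 * C * L2_norm (\<lambda>x. w r x - w t x) + C' * \<bar>s\<bar> * \<bar>r - t\<bar> * (LINT x|circ. \<bar>w t x\<bar>))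
        \<longlongrightarrow> 0) (at t within {0..T})"
      by simp
  qed
  then show "(?I \<longlongrightarrow> ?I t) (at t within {0..T})"
    by (simp add: LIM_zero_iff)
qed

text \<open>The slice norm is continuous on a compact interval. The uniform bound supplies the
  majorant for integrability over space-time.\<close>

lemma curve_L1_bounded:
  assumes w: "continuous_curve T L2 L2_norm w"
  obtains M where "M \<ge> 0" "\<And>t. t \<in> {0..T} \<Longrightarrow> (LINT x|circ. \<bar>w t x\<bar>) \<le> M"
proof -
  let ?J = "\<lambda>t. LINT x|circ. \<bar>w t x\<bar>"
  have L: "w r \<in> L2" if "r \<in> {0..T}" for r using w that by (simp add: continuous_curve_def)
  have "continuous_on {0..T} ?J"
    unfolding continuous_on_def
  proof
    fix t assume t: "t \<in> {0..T}"
    have "((\<lambda>r. ?J r - ?J t) \<longlongrightarrow> 0) (at t within {0..T})"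
    proof (rule Lim_null_comparison)
      show "\<forall>\<^sub>F r in at t within {0..T}. norm (?J r - ?J t) \<le> 4 * L2_norm (\<lambda>x. w r x - w t x)"
        unfolding eventually_at_filter
      proof (rule eventuallyI, intro impI)
        fix r assume r: "r \<in> {0..T}"
        note iw = L2_integrable[OF L[OF r]] L2_integrable[OF L[OF t]]
        have "norm (?J r - ?J t) = \<bar>LINT x|circ. \<bar>w r x\<bar> - \<bar>w t x\<bar>\<bar>" using iw by simp
        also have "\<dots> \<le> (LINT x|circ. \<bar>\<bar>w r x\<bar> - \<bar>w t x\<bar>\<bar>)" by (rule integral_abs_bound)
        also have "\<dots> \<le> (LINT x|circ. \<bar>w r x - w t x\<bar>)"
          using iw by (intro integral_mono) auto
        also have "\<dots> \<le> 4 * L2_norm (\<lambda>x. w r x - w t x)"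
          by (rule L1_le_L2_norm[OF L2_diff[OF L[OF r] L[OF t]]])
        finally show "norm (?J r - ?J t) \<le> 4 * L2_norm (\<lambda>x. w r x - w t x)" .
      qed
      have "((\<lambda>r. L2_norm (\<lambda>x. w r x - w t x)) \<longlongrightarrow> 0) (at t within {0..T})"
        using w t by (simp add: continuous_curve_def)
      from tendsto_mult_left[OF this, of 4]
      show "((\<lambda>r. 4 * L2_norm (\<lambda>x. w r x - w t x)) \<longlongrightarrow> 0) (at t within {0..T})" by simp
    qed
    then show "(?J \<longlongrightarrow> ?J t) (at t within {0..T})" by (simp add: LIM_zero_iff)
  qed
  then have "bounded (?J ` {0..T})"
    by (intro compact_imp_bounded compact_continuous_image) auto
  then obtain M where M: "M > 0" "\<And>t. t \<in> {0..T} \<Longrightarrow> \<bar>?J t\<bar> \<le> M"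
    unfolding bounded_pos by (metis imageI real_norm_def)
  show ?thesis
    using M by (intro that[of M]) (auto intro: order_trans[OF abs_ge_self])
qed

section \<open>Integrals over the space-time cylinder and travelling test functions\<close>

abbreviation cyl :: "real \<Rightarrow> (real \<times> real) measure" where
  "cyl T \<equiv> lebesgue_on ({0..T} \<times> {0..2 * pi})"

lemma cyl_sets: "{0..T} \<times> {0..2 * pi} \<in> sets (lebesgue :: (real \<times> real) measure)"
  by (intro lborelD borel_closed sets_completionI_sets closed_Times) auto

text \<open>The majorant of the slice norms is the constant M on the time interval and 0 outside
  it.\<close>

lemma integrable_cyl:
  assumes j: "jointly_measurable T w" and w: "\<And>t. t \<in> {0..T} \<Longrightarrow> integrable circ (w t)"
    and M: "\<And>t. t \<in> {0..T} \<Longrightarrow> (LINT x|circ. \<bar>w t x\<bar>) \<le> M"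
  shows "integrable (cyl T) (\<lambda>p. w (fst p) (snd p))"
proof -
  let ?D = "{0..T} \<times> {0..2 * pi}"
  define F where "F p = (if p \<in> ?D then w (fst p) (snd p) else 0)" for p
  have "integrable lebesgue F"
  proof (rule integrable_lebesgue_pairI[where h = "\<lambda>t. if t \<in> {0..T} then M else 0"])
    have "(\<lambda>p. w (fst p) (snd p)) \<in> borel_measurable (lebesgue_on ?D)"
      using j unfolding jointly_measurable_def
      by (rule measurable_restrict_mono) auto
    then show "F \<in> borel_measurable lebesgue"
      unfolding F_def using cyl_sets by (subst borel_measurable_if) auto
    show "integrable lebesgue (\<lambda>t. if t \<in> {0..T} then M else 0)"
      by (subst Lebesgue_Measure.integrable_restrict_UNIV) (auto intro: integrable_lebesgue_on_continuous)
    have "integrable lebesgue (\<lambda>x. F (t, x)) \<and> (LINT x|lebesgue. \<bar>F (t, x)\<bar>) \<le> (if t \<in> {0..T} then M else 0)" for t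
    proof (cases "t \<in> {0..T}")
      case True
      have F1: "(\<lambda>x. F (t, x)) = (\<lambda>x. if x \<in> {0..2 * pi} then w t x else 0)"
        using True by (auto simp: F_def)
      have F2: "(\<lambda>x. \<bar>F (t, x)\<bar>) = (\<lambda>x. if x \<in> {0..2 * pi} then \<bar>w t x\<bar> else 0)"
        using True by (auto simp: F_def)
      show ?thesis
        unfolding F1 F2 using True w[OF True] M[OF True]
        by (subst Lebesgue_Measure.integrable_restrict_UNIV, simp,
            subst Lebesgue_Measure.integral_restrict_UNIV) auto
    next
      case False
      then have "F (t, x) = 0" for x by (auto simp: F_def)
      then show ?thesis using False by auto
    qed
    then show "AE t in lebesgue. integrable lebesgue (\<lambda>x. F (t, x)) \<and>
        (LINT x|lebesgue. \<bar>F (t, x)\<bar>) \<le> (if t \<in> {0..T} then M else 0)"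
      by (intro AE_I2)
  qed
  then show ?thesis
    unfolding F_def using cyl_sets by (subst (asm) Lebesgue_Measure.integrable_restrict_UNIV) auto
qed

lemma integrable_cyl_mult:
  assumes w: "integrable (cyl T) w"
    and \<phi>: "continuous_on UNIV (\<phi> :: real \<times> real \<Rightarrow> real)"
  shows "integrable (cyl T) (\<lambda>p. w p * \<phi> p)"
proof -
  have "compact (\<phi> ` ({0..T} \<times> {0..2 * pi}))"
    by (intro compact_continuous_image continuous_on_subset[OF \<phi>] compact_Times) auto
  then obtain C where C: "\<And>p. p \<in> {0..T} \<times> {0..2 * pi} \<Longrightarrow> \<bar>\<phi> p\<bar> \<le> C"
    using compact_imp_bounded bounded_iff by (metis imageI real_norm_def)
  have "\<phi> \<in> borel_measurable (cyl T)"
    using \<phi> by (intro measurable_restrict_space1 measurable_completion) (simp add: borel_measurable_continuous_onI)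
  then show ?thesis using w C by (intro integrable_mult_bounded) auto
qed

lemma cyl_pairing_iterated:
  assumes "integrable (cyl T) (\<lambda>p. w (fst p) (snd p))"
    and "continuous_on UNIV \<phi>"
  shows "cyl_pairing T w \<phi> = (LINT t|lebesgue_on {0..T}. LINT x|circ. w t x * \<phi> (t, x))"
  unfolding cyl_pairing_def
  using Fubini_lebesgue_on(1)[OF _ _ integrable_cyl_mult[OF assms]] by simp

lemma
  assumes "smooth \<phi>"
  shows d_t_eqI: "((\<lambda>t. \<phi> (t, x)) has_real_derivative D) (at t) \<Longrightarrow> d_t \<phi> (t, x) = D"
    and d_x_eqI: "((\<lambda>x. \<phi> (t, x)) has_real_derivative D) (at x) \<Longrightarrow> d_x \<phi> (t, x) = D"
  using smooth_test_slice[OF assms] DERIV_unique by blast+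

text \<open>For \<open>s = 1\<close> and \<open>s = -1\<close> the profile \<psi> is carried along a
  characteristic; \<open>s = 0\<close> gives a plain product, used later for the mean over the
  circle.\<close>

definition moving :: "real \<Rightarrow> (real \<Rightarrow> real) \<Rightarrow> (real \<Rightarrow> real) \<Rightarrow> real \<times> real \<Rightarrow> real" where
  "moving s \<theta> \<psi> p = \<theta> (fst p) * \<psi> (snd p + s * fst p)"

lemma smooth_moving:
  assumes "smooth \<theta>" "smooth \<psi>"
  shows "smooth (moving s \<theta> \<psi>)"
proof -
  have "smooth (\<lambda>p::real \<times> real. snd p + s * fst p)"
    by (intro smooth_bounded_linear bounded_linear_add bounded_linear_snd
        bounded_linear_const_mult bounded_linear_fst)
  moreover have "smooth (\<lambda>p::real \<times> real. fst p)"
    by (intro smooth_bounded_linear bounded_linear_fst)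
  ultimately have "smooth (\<lambda>p. \<theta> (fst p) * \<psi> (snd p + s * fst p))"
    by (intro smooth_mult smooth_compose[OF assms(1)] smooth_compose[OF assms(2)])
  then show ?thesis by (simp add: moving_def[abs_def])
qed

lemma
  assumes "smooth \<theta>" "smooth \<psi>"
  shows d_t_moving: "d_t (moving s \<theta> \<psi>) = (\<lambda>p. moving s (deriv \<theta>) \<psi> p + s * moving s \<theta> (deriv \<psi>) p)"
    and d_x_moving: "d_x (moving s \<theta> \<psi>) = moving s \<theta> (deriv \<psi>)"
proof -
  note D = smooth_DERIV[OF assms(1)] smooth_DERIV[OF assms(2)]
  have "d_t (moving s \<theta> \<psi>) (t, x) = moving s (deriv \<theta>) \<psi> (t, x) + s * moving s \<theta> (deriv \<psi>) (t, x)" for t x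
    by (rule d_t_eqI[OF smooth_moving[OF assms]])
      (auto simp: moving_def algebra_simps intro!: derivative_eq_intros D DERIV_chain'[OF _ D(2)])
  then show "d_t (moving s \<theta> \<psi>) = (\<lambda>p. moving s (deriv \<theta>) \<psi> p + s * moving s \<theta> (deriv \<psi>) p)"
    by auto
  have "d_x (moving s \<theta> \<psi>) (t, x) = moving s \<theta> (deriv \<psi>) (t, x)" for t x
    by (rule d_x_eqI[OF smooth_moving[OF assms]])
      (auto simp: moving_def algebra_simps intro!: derivative_eq_intros D DERIV_chain'[OF _ D(2)])
  then show "d_x (moving s \<theta> \<psi>) = moving s \<theta> (deriv \<psi>)" by auto
qed

lemma d_t_add_cmult:
  assumes "smooth \<phi>" "smooth \<eta>"
  shows "d_t (\<lambda>p. \<phi> p + c * \<eta> p) = (\<lambda>p. d_t \<phi> p + c * d_t \<eta> p)"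
proof -
  have "d_t (\<lambda>p. \<phi> p + c * \<eta> p) (t, x) = d_t \<phi> (t, x) + c * d_t \<eta> (t, x)" for t x
    by (rule d_t_eqI)
      (auto intro!: smooth_add smooth_cmult assms DERIV_add DERIV_cmult smooth_test_slice(1))
  then show ?thesis by auto
qed

lemma test_fun_moving:
  assumes "smooth \<theta>" "smooth \<psi>" "periodic \<psi>" "0 < a" "b < T" "\<And>t. t \<notin> {a..b} \<Longrightarrow> \<theta> t = 0"
  shows "test_fun T (moving s \<theta> \<psi>)"
  unfolding test_fun_def
proof (intro conjI allI)
  show "smooth (moving s \<theta> \<psi>)" using assms by (intro smooth_moving)
  show "periodic (\<lambda>x. moving s \<theta> \<psi> (t, x))" for t
    using periodic_compose_affine[OF assms(3), of "s * t"] by (auto simp: periodic_def moving_def)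
  show "\<exists>a b. 0 < a \<and> b < T \<and> (\<forall>t x. t \<notin> {a..b} \<longrightarrow> moving s \<theta> \<psi> (t, x) = 0)"
    using assms(4-6) by (intro exI[of _ a] exI[of _ b]) (auto simp: moving_def)
qed

lemma deriv_support:
  fixes \<theta> :: "real \<Rightarrow> real"
  assumes "\<And>t. t \<notin> {a..b} \<Longrightarrow> \<theta> t = 0" "t \<notin> {a..b}"
  shows "deriv \<theta> t = 0"
proof (rule DERIV_imp_deriv)
  have "open (- {a..b})" by auto
  then show "(\<theta> has_real_derivative 0) (at t)"
    using has_field_derivative_transform_within_open[OF DERIV_const[of 0], of "- {a..b}" t \<theta>] assms by simp
qed

lemma H1_curve_L2:
  assumes "continuous_curve T H1 H1_norm u"
  shows "continuous_curve T L2 L2_norm u"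
proof -
  have le: "L2_norm f \<le> H1_norm f" for f
    unfolding H1_norm_def by (intro real_le_rsqrt) simp
  have "((\<lambda>s. L2_norm (\<lambda>x. u s x - u t x)) \<longlongrightarrow> 0) (at t within {0..T})" if "t \<in> {0..T}" for t
  proof (rule Lim_null_comparison)
    show "\<forall>\<^sub>F s in at t within {0..T}. norm (L2_norm (\<lambda>x. u s x - u t x)) \<le> H1_norm (\<lambda>x. u s x - u t x)"
      using le L2_norm_nonneg by simp
    show "((\<lambda>s. H1_norm (\<lambda>x. u s x - u t x)) \<longlongrightarrow> 0) (at t within {0..T})"
      using assms that by (simp add: continuous_curve_def)
  qed
  then show ?thesis using assms by (auto simp: continuous_curve_def H1_def)
qed

section \<open>Conservation along characteristics for a weak solution\<close>

context
  fixes T u0 u1 u v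
  assumes T: "T > 0" and sol: "wave_solution T u0 u1 u v"
begin

lemma u_curve: "continuous_curve T L2 L2_norm u"
  and v_curve: "continuous_curve T L2 L2_norm v"
  using sol H1_curve_L2 by (auto simp: wave_solution_def)

lemma u_H1: "t \<in> {0..T} \<Longrightarrow> u t \<in> H1"
  and u_L2: "t \<in> {0..T} \<Longrightarrow> u t \<in> L2"
  and v_L2: "t \<in> {0..T} \<Longrightarrow> v t \<in> L2"
  using sol by (auto simp: wave_solution_def continuous_curve_def H1_def)

lemma u_integrable: "integrable (cyl T) (\<lambda>p. u (fst p) (snd p))"
  and v_integrable: "integrable (cyl T) (\<lambda>p. v (fst p) (snd p))"
proof -
  have j: "jointly_measurable T u" "jointly_measurable T v"
    using sol by (auto simp: wave_solution_def)
  show "integrable (cyl T) (\<lambda>p. u (fst p) (snd p))"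
    using curve_L1_bounded[OF u_curve] integrable_cyl[OF j(1) L2_integrable[OF u_L2]] by metis
  show "integrable (cyl T) (\<lambda>p. v (fst p) (snd p))"
    using curve_L1_bounded[OF v_curve] integrable_cyl[OF j(2) L2_integrable[OF v_L2]] by metis
qed

lemma cyl_pairing_moving:
  assumes "smooth \<theta>" "smooth \<psi>"
  shows "cyl_pairing T u (moving s \<theta> \<psi>) =
      (LINT t|lebesgue_on {0..T}. \<theta> t * (LINT x|circ. u t x * \<psi> (x + s * t)))"
    and "cyl_pairing T v (moving s \<theta> \<psi>) =
      (LINT t|lebesgue_on {0..T}. \<theta> t * (LINT x|circ. v t x * \<psi> (x + s * t)))"
proof -
  have *: "(LINT x|circ. w t x * moving s \<theta> \<psi> (t, x)) = \<theta> t * (LINT x|circ. w t x * \<psi> (x + s * t))"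
    for w :: "real \<Rightarrow> real \<Rightarrow> real" and t
    by (simp add: moving_def mult.left_commute flip: integral_mult_right_zero)
  note c = smooth_continuous_on[OF smooth_moving[OF assms]]
  show "cyl_pairing T u (moving s \<theta> \<psi>) =
      (LINT t|lebesgue_on {0..T}. \<theta> t * (LINT x|circ. u t x * \<psi> (x + s * t)))"
    by (simp add: cyl_pairing_iterated[OF u_integrable c] *)
  show "cyl_pairing T v (moving s \<theta> \<psi>) =
      (LINT t|lebesgue_on {0..T}. \<theta> t * (LINT x|circ. v t x * \<psi> (x + s * t)))"
    by (simp add: cyl_pairing_iterated[OF v_integrable c] *)
qed

lemma cyl_pairing_add_cmult:
  assumes "smooth \<phi>" "smooth \<eta>"
  shows "cyl_pairing T u (\<lambda>p. \<phi> p + c * \<eta> p) = cyl_pairing T u \<phi> + c * cyl_pairing T u \<eta>"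
proof -
  note i = integrable_cyl_mult[OF u_integrable smooth_continuous_on[OF assms(1)]]
    integrable_cyl_mult[OF u_integrable smooth_continuous_on[OF assms(2)]]
  have "(\<lambda>p. u (fst p) (snd p) * (\<phi> p + c * \<eta> p)) =
      (\<lambda>p. u (fst p) (snd p) * \<phi> p + c * (u (fst p) (snd p) * \<eta> p))"
    by (auto simp: algebra_simps)
  then show ?thesis unfolding cyl_pairing_def using i by simp
qed

text \<open>The wave operator maps \<theta> t * \<psi> (x + s * t) to \<theta>'' \<psi> + 2 s
  \<theta>' \<psi>'. The relation between u and v, tested with \<theta>' in place of \<theta>,
  involves \<theta>'' \<psi> + s \<theta>' \<psi>'. Eliminating the term with \<theta>'' leaves
  first-order terms only.\<close>

lemma characteristic_pairing:
  assumes \<theta>: "smooth \<theta>" "0 < a" "b < T" "\<And>t. t \<notin> {a..b} \<Longrightarrow> \<theta> t = 0"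
    and \<psi>: "smooth \<psi>" "periodic \<psi>" and s: "s * s = 1"
  shows "cyl_pairing T v (moving s (deriv \<theta>) \<psi>) = s * cyl_pairing T u (moving s (deriv \<theta>) (deriv \<psi>))"
proof -
  note d\<theta> = smooth_deriv[OF \<theta>(1)] and d\<psi> = smooth_deriv[OF \<psi>(1)]
  note dd\<theta> = smooth_deriv[OF d\<theta>] and dd\<psi> = smooth_deriv[OF d\<psi>]
  let ?A = "moving s (deriv (deriv \<theta>)) \<psi>" and ?B = "moving s (deriv \<theta>) (deriv \<psi>)"
  have tf: "test_fun T (moving s \<theta> \<psi>)" "test_fun T (moving s (deriv \<theta>) \<psi>)"
    using \<theta> \<psi> d\<theta> deriv_support[of a b \<theta>] by (auto intro!: test_fun_moving)
  have eq: "(\<lambda>p. d_t (d_t (moving s \<theta> \<psi>)) p - d_x (d_x (moving s \<theta> \<psi>)) p) = (\<lambda>p. ?A p + 2 * s * ?B p)"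
  proof
    fix p
    have "d_t (d_t (moving s \<theta> \<psi>)) p = ?A p + s * ?B p + s * (?B p + s * moving s \<theta> (deriv (deriv \<psi>)) p)"
      by (simp add: d_t_moving d_t_add_cmult smooth_moving \<theta> \<psi> d\<theta> d\<psi>)
    \<comment> \<open>The coefficient \<open>s * s\<close> equals 1, so the last term cancels
      against the second space derivative.\<close>
    also have "\<dots> = ?A p + 2 * s * ?B p + (s * s) * moving s \<theta> (deriv (deriv \<psi>)) p"
      by (simp add: algebra_simps)
    finally show "d_t (d_t (moving s \<theta> \<psi>)) p - d_x (d_x (moving s \<theta> \<psi>)) p = ?A p + 2 * s * ?B p"
      by (simp add: d_x_moving \<theta> \<psi> d\<psi> s)
  qed
  have "cyl_pairing T u (\<lambda>p. d_t (d_t (moving s \<theta> \<psi>)) p - d_x (d_x (moving s \<theta> \<psi>)) p) = 0"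
    using sol tf(1) unfolding wave_solution_def by blast
  then have "cyl_pairing T u (\<lambda>p. ?A p + 2 * s * ?B p) = 0"
    unfolding eq .
  then have 1: "cyl_pairing T u ?A + 2 * s * cyl_pairing T u ?B = 0"
    by (simp add: cyl_pairing_add_cmult smooth_moving d\<theta> dd\<theta> \<psi> d\<psi>)
  have "cyl_pairing T u (d_t (moving s (deriv \<theta>) \<psi>)) = - cyl_pairing T v (moving s (deriv \<theta>) \<psi>)"
    using sol tf(2) by (simp add: wave_solution_def)
  then have "cyl_pairing T u ?A + s * cyl_pairing T u ?B = - cyl_pairing T v (moving s (deriv \<theta>) \<psi>)"
    by (simp add: d_t_moving cyl_pairing_add_cmult smooth_moving d\<theta> dd\<theta> \<psi> d\<psi>)
  with 1 show ?thesis by simp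
qed

text \<open>By \<open>characteristic_pairing\<close> the difference V - s U is orthogonal to every
  \<theta>'. It is continuous up to t = 0, so it equals its initial value.\<close>

lemma characteristic_conserved:
  assumes \<psi>: "smooth \<psi>" "periodic \<psi>" and s: "s * s = 1" and t: "t \<in> {0..T}"
  shows "(LINT x|circ. v t x * \<psi> (x + s * t)) - s * (LINT x|circ. u t x * deriv \<psi> (x + s * t)) =
         (LINT x|circ. v 0 x * \<psi> x) - s * (LINT x|circ. u 0 x * deriv \<psi> x)"
proof -
  define V where "V t = (LINT x|circ. v t x * \<psi> (x + s * t))" for t
  define U where "U t = (LINT x|circ. u t x * deriv \<psi> (x + s * t))" for t
  note d\<psi> = smooth_deriv[OF \<psi>(1)] periodic_deriv[OF \<psi>(2,1)]
  have cV: "continuous_on {0..T} V"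
    unfolding V_def by (rule curve_continuous_pairing[OF v_curve \<psi>(2,1)])
  have cU: "continuous_on {0..T} U"
    unfolding U_def by (rule curve_continuous_pairing[OF u_curve d\<psi>(2,1)])
  have "V t - s * U t = V 0 - s * U 0"
  proof (rule interval_du_Bois_Reymond[OF T _ _ t])
    show "continuous_on {0..T} (\<lambda>t. V t - s * U t)"
      using cV cU by (intro continuous_intros)
    fix \<theta> a b assume \<theta>: "smooth \<theta>" "0 < a" "b < T" "\<And>t. t \<notin> {a..b} \<Longrightarrow> \<theta> t = (0::real)"
    note d\<theta> = smooth_deriv[OF \<theta>(1)]
    have "integrable (lebesgue_on {0..T}) (\<lambda>t. deriv \<theta> t * V t)" "integrable (lebesgue_on {0..T}) (\<lambda>t. deriv \<theta> t * U t)"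
      by (intro integrable_lebesgue_on_continuous continuous_on_mult smooth_continuous_on[OF d\<theta>] cU cV)+
    moreover have "(\<lambda>t. (V t - s * U t) * deriv \<theta> t) = (\<lambda>t. deriv \<theta> t * V t - s * (deriv \<theta> t * U t))"
      by (auto simp: algebra_simps)
    ultimately have "(LINT t|lebesgue_on {0..T}. (V t - s * U t) * deriv \<theta> t) =
        (LINT t|lebesgue_on {0..T}. deriv \<theta> t * V t) - s * (LINT t|lebesgue_on {0..T}. deriv \<theta> t * U t)"
      by simp
    also have "\<dots> = 0"
      using characteristic_pairing[OF \<theta> \<psi> s]
      unfolding cyl_pairing_moving[OF d\<theta> \<psi>(1)] cyl_pairing_moving[OF d\<theta> d\<psi>(1)] V_def U_def by simp
    finally show "(LINT t|lebesgue_on {0..T}. (V t - s * U t) * deriv \<theta> t) = 0" .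
  qed
  then show ?thesis by (simp add: V_def U_def)
qed

text \<open>Moving the derivative from \<psi> to the weak derivatives of u turns the conserved
  quantity into the pairing of v + s w with a travelling test function. Translating that function
  back to rest identifies the profile at time t with the shifted initial one.\<close>

lemma characteristic_transport:
  assumes s: "s * s = 1" and t: "t \<in> {0..T}"
    and w: "w \<in> L2" "has_weak_deriv (u t) w" and w0: "w0 \<in> L2" "has_weak_deriv (u 0) w0"
  shows "AE x in lebesgue. v t x + s * w x = v 0 (x + s * t) + s * w0 (x + s * t)"
proof -
  have t0: "0 \<in> {0..T}" using T by simp
  define p where "p x = v t x + s * w x" for x
  define q where "q x = v 0 x + s * w0 x" for x
  have pL: "p \<in> L2" and qL: "q \<in> L2"
    unfolding p_def q_def using v_L2[OF t] v_L2[OF t0] w w0 by (auto intro!: L2_add L2_cmult)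
  have qs: "integrable circ (\<lambda>x. q (x + s * t))" "periodic (\<lambda>x. q (x + s * t))"
    using integrable_circ_shift[OF L2_integrable[OF qL] L2_periodic[OF qL]]
      periodic_compose_affine[OF L2_periodic[OF qL]] by auto
  have "AE x in circ. p x - q (x + s * t) = 0"
  proof (rule circ_fundamental_lemma)
    show "integrable circ (\<lambda>x. p x - q (x + s * t))"
      using L2_integrable[OF pL] qs by simp
    fix \<psi>0 :: "real \<Rightarrow> real" assume \<psi>0: "smooth \<psi>0" "periodic \<psi>0"
    \<comment> \<open>The shift is chosen so that the travelling test function equals \<psi>0 at
      time t.\<close>
    define \<psi> where "\<psi> x = \<psi>0 (x + (- s * t))" for x
    have \<psi>: "smooth \<psi>" "periodic \<psi>"
      using smooth_shift[OF \<psi>0(1), of "- s * t"] periodic_compose_affine[OF \<psi>0(2), of "- s * t"]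
      by (simp_all add: \<psi>_def[abs_def])
    have \<psi>s: "\<psi> (x + s * t) = \<psi>0 x" for x by (simp add: \<psi>_def)
    have d\<psi>s: "deriv \<psi> (x + s * t) = deriv \<psi>0 x" for x
      unfolding \<psi>_def[abs_def] deriv_shift[OF \<psi>0(1)] by simp
    have ip: "integrable circ (\<lambda>x. f x * \<phi> x)" if "integrable circ f" "smooth \<phi>" for f \<phi>
      using that by (intro integrable_mult_continuous smooth_continuous_on)
    have e: "(LINT x|circ. (y x + s * z x) * \<phi> x) = (LINT x|circ. y x * \<phi> x) - s * (LINT x|circ. c x * deriv \<phi> x)"
      if "y \<in> L2" "z \<in> L2" "has_weak_deriv c z" "smooth \<phi>" "periodic \<phi>" for y z c \<phi>
    proof -
      have "(LINT x|circ. (y x + s * z x) * \<phi> x) = (LINT x|circ. y x * \<phi> x + s * (z x * \<phi> x))"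
        by (simp add: algebra_simps)
      also have "\<dots> = (LINT x|circ. y x * \<phi> x) + s * (LINT x|circ. z x * \<phi> x)"
        using that by (simp add: ip L2_integrable)
      finally show ?thesis using that by (simp add: has_weak_deriv_def)
    qed
    have "(LINT x|circ. p x * \<psi>0 x) = (LINT x|circ. v t x * \<psi> (x + s * t)) - s * (LINT x|circ. u t x * deriv \<psi> (x + s * t))"
      unfolding p_def \<psi>s d\<psi>s using v_L2[OF t] w \<psi>0 by (rule e)
    also have "\<dots> = (LINT x|circ. v 0 x * \<psi> x) - s * (LINT x|circ. u 0 x * deriv \<psi> x)"
      by (rule characteristic_conserved[OF \<psi> s t])
    also have "\<dots> = (LINT x|circ. q x * \<psi> x)"
      unfolding q_def using v_L2[OF t0] w0 \<psi> by (rule e[symmetric])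
    also have "\<dots> = (LINT x|circ. q (x + s * t) * \<psi> (x + s * t))"
      using integral_circ_shift[of "\<lambda>x. q x * \<psi> x" "s * t"] ip[OF L2_integrable[OF qL] \<psi>(1)]
        L2_periodic[OF qL] \<psi>(2) by (simp add: periodic_def)
    finally have "(LINT x|circ. p x * \<psi>0 x) = (LINT x|circ. q (x + s * t) * \<psi>0 x)"
      by (simp add: \<psi>s)
    then show "(LINT x|circ. (p x - q (x + s * t)) * \<psi>0 x) = 0"
      using ip[OF L2_integrable[OF pL] \<psi>0(1)] ip[OF qs(1) \<psi>0(1)] by (simp add: left_diff_distrib)
  qed
  then have "AE x in circ. p x = q (x + s * t)" by simp
  moreover have "periodic (\<lambda>x. p x = q (x + s * t))"
    using L2_periodic[OF pL] qs(2) by (simp add: periodic_def)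
  ultimately show ?thesis using periodic_AE by (simp add: p_def q_def)
qed

end

section \<open>From (OSC) to unique continuation\<close>

text \<open>The number \<open>measure\<close> is 0 for sets of infinite measure as well; inclusion
  in a bounded interval rules this out. The second equivalence is the first one for the complement
  in [0, 2 pi].\<close>

lemma
  assumes A: "A \<in> sets lebesgue" "A \<subseteq> {0..2 * pi}"
  shows measure_eq_0_iff_AE_circ: "measure lebesgue A = 0 \<longleftrightarrow> (AE x in circ. x \<notin> A)"
    and measure_eq_2pi_iff_AE_circ: "measure lebesgue A = 2 * pi \<longleftrightarrow> (AE x in circ. x \<in> A)"
proof -
  have I: "{0..2 * pi} \<in> lmeasurable" by simp
  have null: "measure lebesgue B = 0 \<longleftrightarrow> (AE x in circ. x \<notin> B)"
    if B: "B \<in> sets lebesgue" "B \<subseteq> {0..2 * pi}" for B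
  proof -
    have Bm: "B \<in> lmeasurable" using fmeasurableI2[OF I B(2) B(1)] .
    then have "measure lebesgue B = 0 \<longleftrightarrow> B \<in> null_sets lebesgue"
      by (simp add: negligible_iff_measure0 negligible_iff_null_sets[symmetric])
    also have "\<dots> \<longleftrightarrow> (AE x in lebesgue. x \<notin> B)"
      by (simp add: completion.null_sets_iff_AE)
    also have "\<dots> \<longleftrightarrow> (AE x in circ. x \<notin> B)"
    proof -
      have "(x \<in> {0..2 * pi} \<longrightarrow> x \<notin> B) \<longleftrightarrow> x \<notin> B" for x using B(2) by auto
      then show ?thesis unfolding AE_circ_iff by (simp only:)
    qed
    finally show ?thesis .
  qed
  show "measure lebesgue A = 0 \<longleftrightarrow> (AE x in circ. x \<notin> A)" by (rule null[OF A])
  have Am: "A \<in> lmeasurable" using fmeasurableI2[OF I A(2) A(1)] .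
  have "measure lebesgue ({0..2 * pi} - A) = 2 * pi - measure lebesgue A"
    using measurable_measure_Diff[OF I A(1) A(2)] by simp
  then have "measure lebesgue A = 2 * pi \<longleftrightarrow> measure lebesgue ({0..2 * pi} - A) = 0"
    by auto
  also have "\<dots> \<longleftrightarrow> (AE x in circ. x \<notin> {0..2 * pi} - A)"
    using A(1) by (intro null) auto
  also have "\<dots> \<longleftrightarrow> (AE x in circ. x \<in> A)"
  proof -
    have "(x \<in> {0..2 * pi} \<longrightarrow> x \<notin> {0..2 * pi} - A) \<longleftrightarrow> (x \<in> {0..2 * pi} \<longrightarrow> x \<in> A)" for x by auto
    then show ?thesis unfolding AE_circ_iff by (simp only:)
  qed
  finally show "measure lebesgue A = 2 * pi \<longleftrightarrow> (AE x in circ. x \<in> A)" .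
qed

lemma AE_circ_False: "\<not> (AE x in circ. False)"
proof
  assume "AE x in circ. False"
  then have "measure lebesgue {0..2 * pi} = 0"
    by (subst measure_eq_0_iff_AE_circ) (auto elim: eventually_mono)
  then show False by simp
qed

text \<open>The levels c at which both functions lie below c form an upward closed set Z. It is
  nonempty and bounded below, since otherwise f would be infinite almost everywhere. The common
  constant is the infimum of Z.\<close>

lemma AE_constant_of_dichotomy:
  fixes f g :: "real \<Rightarrow> real"
  assumes dich: "\<And>c. (AE x in circ. f x \<le> c \<and> g x \<le> c) \<or> (AE x in circ. f x > c \<and> g x > c)"
  obtains m where "AE x in circ. f x = m \<and> g x = m"
proof -
  define Z where "Z = {c. AE x in circ. f x \<le> c \<and> g x \<le> c}"
  have notZ: "AE x in circ. f x > c \<and> g x > c" if "c \<notin> Z" for c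
    using dich[of c] that by (auto simp: Z_def)
  have "Z \<noteq> {}"
  proof
    assume "Z = {}"
    then have "AE x in circ. \<forall>n. f x > real n"
      unfolding AE_all_countable using notZ by (fastforce elim: eventually_mono)
    then have "AE x in circ. False"
      by eventually_elim (metis order_less_asym reals_Archimedean2)
    then show False using AE_circ_False by simp
  qed
  have up: "c' \<in> Z" if "c \<in> Z" "c \<le> c'" for c c'
    unfolding Z_def
  proof (rule CollectI)
    show "AE x in circ. f x \<le> c' \<and> g x \<le> c'"
      using that(1)[unfolded Z_def, THEN CollectD] by eventually_elim (use that(2) in auto)
  qed
  have bdd: "bdd_below Z"
  proof (rule ccontr)
    assume nb: "\<not> bdd_below Z"
    have "c \<in> Z" for c
    proof -
      obtain b where "b \<in> Z" "b < c" using nb unfolding bdd_below_def by (meson not_le)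
      then show ?thesis using up by simp
    qed
    then have "AE x in circ. \<forall>n. f x \<le> - real n"
      unfolding AE_all_countable Z_def by (fastforce elim: eventually_mono)
    then have "AE x in circ. False"
    proof eventually_elim
      case (elim x)
      obtain n where "- f x < real n" using reals_Archimedean2 by blast
      then show ?case using elim[rule_format, of n] by linarith
    qed
    then show False using AE_circ_False by simp
  qed
  define m where "m = Inf Z"
  \<comment> \<open>Only countably many levels m + 1 / (n + 1) and m - 1 / (n + 1) are used, so a
    single null set suffices; the former lie in Z, the latter do not.\<close>
  have "AE x in circ. \<forall>n. (f x \<le> m + inverse (real (Suc n)) \<and> g x \<le> m + inverse (real (Suc n))) \<and>
      (f x > m - inverse (real (Suc n)) \<and> g x > m - inverse (real (Suc n)))"
    unfolding AE_all_countable
  proof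
    fix n
    have "m < m + inverse (real (Suc n))" by simp
    then obtain c where "c \<in> Z" "c < m + inverse (real (Suc n))"
      using cInf_less_iff[OF \<open>Z \<noteq> {}\<close> bdd] unfolding m_def by blast
    then have "m + inverse (real (Suc n)) \<in> Z" using up by simp
    moreover have "m - inverse (real (Suc n)) \<notin> Z"
      using cInf_lower[OF _ bdd, of "m - inverse (real (Suc n))"] by (auto simp: m_def)
    ultimately show "AE x in circ. (f x \<le> m + inverse (real (Suc n)) \<and> g x \<le> m + inverse (real (Suc n))) \<and>
      (f x > m - inverse (real (Suc n)) \<and> g x > m - inverse (real (Suc n)))"
      using notZ unfolding Z_def by (auto elim: eventually_elim2)
  qed
  then have "AE x in circ. f x = m \<and> g x = m"
  proof eventually_elim
    case (elim x)
    have "y = m" if "\<forall>n. y \<le> m + inverse (real (Suc n)) \<and> y > m - inverse (real (Suc n))" for y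
    proof (rule ccontr)
      assume "y \<noteq> m"
      then obtain n where "inverse (real (Suc n)) < \<bar>y - m\<bar>"
        using reals_Archimedean[of "\<bar>y - m\<bar>"] by auto
      moreover have "y \<le> m + inverse (real (Suc n))" "y > m - inverse (real (Suc n))" using that by auto
      ultimately show False by linarith
    qed
    then show ?case using elim by blast
  qed
  then show ?thesis by (rule that)
qed

lemma
  fixes f :: "real \<Rightarrow> real"
  assumes "periodic f" "t \<in> {0..T}"
  shows mem_L_xi_level: "(t, x) \<in> L_xi_set T {y \<in> {0..2 * pi}. f y > c} \<longleftrightarrow> f (x + t) > c"
    and mem_L_eta_level: "(t, x) \<in> L_eta_set T {y \<in> {0..2 * pi}. f y > c} \<longleftrightarrow> f (x - t) > c"
proof -
  have *: "(\<exists>a\<in>{y \<in> {0..2 * pi}. f y > c}. \<exists>k::int. z = a + 2 * pi * of_int k) \<longleftrightarrow> f z > c" for z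
  proof
    assume "\<exists>a\<in>{y \<in> {0..2 * pi}. f y > c}. \<exists>k::int. z = a + 2 * pi * of_int k"
    then show "f z > c" using periodic_int[OF assms(1)] by auto
  next
    assume fz: "f z > c"
    obtain k :: int where k: "z + 2 * pi * of_int k \<in> {0..2 * pi}" using circle_representative .
    show "\<exists>a\<in>{y \<in> {0..2 * pi}. f y > c}. \<exists>k::int. z = a + 2 * pi * of_int k"
      using k fz periodic_int[OF assms(1), of z k]
      by (intro bexI[of _ "z + 2 * pi * of_int k"] exI[of _ "- k"]) auto
  qed
  show "(t, x) \<in> L_xi_set T {y \<in> {0..2 * pi}. f y > c} \<longleftrightarrow> f (x + t) > c"
    using *[of "x + t"] assms(2) by (simp add: L_xi_set_def)
  show "(t, x) \<in> L_eta_set T {y \<in> {0..2 * pi}. f y > c} \<longleftrightarrow> f (x - t) > c"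
    using *[of "x - t"] assms(2) by (simp add: L_eta_set_def)
qed

text \<open>f is only Lebesgue measurable, so it is replaced by a Borel function off a null set N.
  The strip over N is null in the plane, which makes f of the projection measurable; the shear then
  gives the travelling version.\<close>

lemma measurable_travelling:
  fixes f :: "real \<Rightarrow> real"
  assumes "f \<in> borel_measurable lebesgue"
  shows "(\<lambda>p. f (snd p + s * fst p)) \<in> borel_measurable (lebesgue :: (real \<times> real) measure)"
proof -
  have "(\<lambda>p. f (snd p)) \<in> borel_measurable (lebesgue :: (real \<times> real) measure)"
  proof -
    obtain g where g: "g \<in> borel_measurable lborel" and ae: "AE x in lborel. f x = g x"
      using completion_ex_borel_measurable_real[OF assms] by auto
    obtain N where N: "N \<in> null_sets lborel" "{x. f x \<noteq> g x} \<subseteq> N"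
      using ae by (auto simp: eventually_ae_filter)
    have m: "(\<lambda>p. g (snd p)) \<in> borel_measurable (lebesgue :: (real \<times> real) measure)"
      using g by (intro measurable_completion) (simp add: borel_prod[symmetric])
    have "UNIV \<times> N \<in> sets (lebesgue :: (real \<times> real) measure)"
      using N(1) by (intro sets_completionI_sets) (auto simp: borel_prod[symmetric])
    then have "AE p in lebesgue. p \<notin> (UNIV :: real set) \<times> N"
      by (rule AE_lebesgue_pairI) (use AE_completion[OF AE_not_in[OF N(1)]] in simp)
    then have "AE p::real \<times> real in lebesgue. g (snd p) = f (snd p)"
      by eventually_elim (use N(2) in fastforce)
    then show ?thesis by (rule borel_measurable_AE[OF m])
  qed
  then show ?thesis
    using measurable_compose[OF measurable_shear[of s], of "\<lambda>p. f (snd p)" borel] by simp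
qed

text \<open>Once both profiles vanish, u is constant in x at each time by du Bois-Reymond's lemma on
  the circle. That the constants agree for different times is a separate matter: the mean of u over
  the circle has derivative the mean of v, which is 0.\<close>

lemma OSC_imp_unique_continuation:
  assumes T: "T > 0" and G: "G \<in> sets lebesgue" "G \<subseteq> {0..T} \<times> {0..2 * pi}" and osc: "OSC T G"
  shows "unique_continuation T G"
  unfolding unique_continuation_def
proof (intro ballI allI impI)
  fix u0 u1 u v
  assume sol: "wave_solution T u0 u1 u v"
    and vG: "AE p in lebesgue. p \<in> G \<longrightarrow> v (fst p) (snd p) = 0"
  have t0: "0 \<in> {0..T}" using T by simp
  have vL: "v t \<in> L2" and uL: "u t \<in> L2" if "t \<in> {0..T}" for t
    using v_L2[OF T sol that] u_L2[OF T sol that] .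
  have ex: "\<exists>w. w \<in> L2 \<and> has_weak_deriv (u t) w" if "t \<in> {0..T}" for t
    using u_H1[OF T sol that] by (auto simp: H1_def)
  obtain w0 where w0: "w0 \<in> L2" "has_weak_deriv (u 0) w0" using ex[OF t0] by blast
  \<comment> \<open>These are the profiles of d'Alembert's formula: v + w is transported with
    \<open>s = 1\<close> and equals 2 f (x + t), while v - w is transported with
    \<open>s = -1\<close> and equals - 2 g (x - t).\<close>
  define f where "f x = (1 / 2) * (w0 x + v 0 x)" for x
  define g where "g x = (1 / 2) * (w0 x - v 0 x)" for x
  have fL: "f \<in> L2" and gL: "g \<in> L2"
    unfolding f_def g_def by (intro L2_cmult L2_add L2_diff w0(1) vL[OF t0])+
  have transport: "AE x in lebesgue. v t x = f (x + t) - g (x - t) \<and> w x = f (x + t) + g (x - t)"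
    if t: "t \<in> {0..T}" and w: "w \<in> L2" "has_weak_deriv (u t) w" for t w
  proof -
    have "AE x in lebesgue. v t x + 1 * w x = v 0 (x + 1 * t) + 1 * w0 (x + 1 * t)"
      "AE x in lebesgue. v t x + (-1) * w x = v 0 (x + (-1) * t) + (-1) * w0 (x + (-1) * t)"
      by (rule characteristic_transport[OF T sol _ t w w0]; simp)+
    then show ?thesis
      by eventually_elim (simp add: f_def g_def field_simps)
  qed
  \<comment> \<open>The identity is known for each t and almost every x. Joint measurability of v
    makes the exceptional set S measurable, so it is null in the plane and comparable with
    G.\<close>
  have vfg: "AE p in lebesgue. p \<in> {0..T} \<times> UNIV \<longrightarrow> v (fst p) (snd p) = f (snd p + fst p) - g (snd p - fst p)"
  proof -
    define S where "S = {p \<in> {0..T} \<times> UNIV. v (fst p) (snd p) \<noteq> f (snd p + 1 * fst p) - g (snd p + (-1) * fst p)}"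
    have D: "{0..T} \<times> UNIV \<in> sets (lebesgue :: (real \<times> real) measure)"
      by (intro sets_completionI_sets lborelD borel_closed closed_Times) auto
    have "(\<lambda>p. v (fst p) (snd p) - (f (snd p + 1 * fst p) - g (snd p + (-1) * fst p)))
        \<in> borel_measurable (lebesgue_on ({0..T} \<times> UNIV))"
    proof (intro borel_measurable_diff)
      show "(\<lambda>p. v (fst p) (snd p)) \<in> borel_measurable (lebesgue_on ({0..T} \<times> UNIV))"
        using sol by (simp add: wave_solution_def jointly_measurable_def)
    qed (intro measurable_restrict_space1 measurable_travelling L2_measurable fL gL)+
    from measurable_sets[OF this, of "- {0}"]
    have "S \<in> sets (lebesgue_on ({0..T} \<times> UNIV))"
      by (rule back_subst[where P = "\<lambda>X. X \<in> _"]) (auto simp: S_def)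
    then have "S \<in> sets lebesgue"
      using D by (auto simp: sets_restrict_space)
    moreover have "AE t in lebesgue. AE x in lebesgue. (t, x) \<notin> S"
    proof (rule AE_I2)
      fix t
      show "AE x in lebesgue. (t, x) \<notin> S"
      proof (cases "t \<in> {0..T}")
        case True
        then obtain w where "w \<in> L2" "has_weak_deriv (u t) w" using ex by blast
        from transport[OF True this] show ?thesis by eventually_elim (simp add: S_def)
      qed (auto simp: S_def)
    qed
    ultimately have "AE p in lebesgue. p \<notin> S" by (rule AE_lebesgue_pairI)
    then show ?thesis by eventually_elim (auto simp: S_def)
  qed
  have fgG: "AE p in lebesgue. p \<in> G \<longrightarrow> f (snd p + fst p) = g (snd p - fst p)"
    using vfg vG by eventually_elim (use G(2) in auto)
  have level: "{y \<in> {0..2 * pi}. h y > c} \<in> sets lebesgue" if "h \<in> L2" for h c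
  proof -
    have "{y \<in> {0..2 * pi}. h y > c} = {0..2 * pi} \<inter> (h -` {c<..} \<inter> space lebesgue)" by auto
    moreover have "{0..2 * pi} \<inter> (h -` {c<..} \<inter> space lebesgue) \<in> sets lebesgue"
      by (intro sets.Int measurable_sets[OF L2_measurable[OF that]]) auto
    ultimately show ?thesis by simp
  qed
  obtain m where m: "AE x in circ. f x = m \<and> g x = m"
  proof (rule AE_constant_of_dichotomy)
    fix c
    let ?A = "{y \<in> {0..2 * pi}. f y > c}" and ?B = "{y \<in> {0..2 * pi}. g y > c}"
    have "AE p in lebesgue. p \<notin> sym_diff (G \<inter> L_xi_set T ?A) (G \<inter> L_eta_set T ?B)"
      using fgG
    proof eventually_elim
      case (elim p)
      obtain t x where p: "p = (t, x)" by (cases p)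
      show ?case
      proof (cases "p \<in> G")
        case True
        then have "t \<in> {0..T}" using G(2) p by auto
        then show ?thesis using elim True p mem_L_xi_level[OF L2_periodic[OF fL], of t T x c]
          mem_L_eta_level[OF L2_periodic[OF gL], of t T x c] by auto
      qed auto
    qed
    then have "observable_symmetric ?A ?B T G"
      unfolding observable_symmetric_def by (simp add: completion.null_sets_iff_AE)
    then have "trivial_pair ?A ?B"
      using osc level[OF fL, of c] level[OF gL, of c] unfolding OSC_def by (metis (no_types, lifting) mem_Collect_eq subsetI)
    then show "(AE x in circ. f x \<le> c \<and> g x \<le> c) \<or> (AE x in circ. f x > c \<and> g x > c)"
      unfolding trivial_pair_def
    proof
      assume "measure lebesgue ?A = 0 \<and> measure lebesgue ?B = 0"
      then have "AE x in circ. x \<notin> ?A" "AE x in circ. x \<notin> ?B"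
        using measure_eq_0_iff_AE_circ[OF level[OF fL, of c] Collect_restrict]
          measure_eq_0_iff_AE_circ[OF level[OF gL, of c] Collect_restrict] by blast+
      then have "AE x in circ. f x \<le> c \<and> g x \<le> c"
        using AE_space[of circ] by eventually_elim auto
      then show ?thesis ..
    next
      assume "measure lebesgue ?A = 2 * pi \<and> measure lebesgue ?B = 2 * pi"
      then have "AE x in circ. x \<in> ?A" "AE x in circ. x \<in> ?B"
        using measure_eq_2pi_iff_AE_circ[OF level[OF fL, of c] Collect_restrict]
          measure_eq_2pi_iff_AE_circ[OF level[OF gL, of c] Collect_restrict] by blast+
      then have "AE x in circ. f x > c \<and> g x > c" by eventually_elim auto
      then show ?thesis ..
    qed
  qed
  \<comment> \<open>The weak derivative is tested against the constant 1; since w0 = f + g, this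
    gives 4 pi m = 0.\<close>
  have "(LINT x|circ. w0 x) = 0"
    using w0(2) unfolding has_weak_deriv_def
    by (elim allE[of _ "\<lambda>_. 1"]) (auto simp: periodic_def)
  moreover have "(LINT x|circ. w0 x) = (LINT x|circ. 2 * m)"
  proof (rule Bochner_Integration.integral_cong_AE)
    show "AE x in circ. w0 x = 2 * m"
      using m by eventually_elim (auto simp: f_def g_def field_simps)
  qed (use L2_measurable_circ[OF w0(1)] in auto)
  ultimately have "m = 0" by simp
  have "AE x in lebesgue. f x = 0 \<and> g x = 0"
    using m L2_periodic[OF fL] L2_periodic[OF gL] unfolding \<open>m = 0\<close>
    by (intro periodic_AE) (auto simp: periodic_def)
  note fg0 = AE_shift[OF this]
  have vw0: "AE x in lebesgue. v t x = 0 \<and> w x = 0"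
    if t: "t \<in> {0..T}" and w: "w \<in> L2" "has_weak_deriv (u t) w" for t w
    using transport[OF t w] fg0[of t] fg0[of "- t"] by eventually_elim simp
  have v0: "(LINT x|circ. v t x * h x) = 0" if t: "t \<in> {0..T}" for t h
  proof -
    obtain w where "w \<in> L2" "has_weak_deriv (u t) w" using ex[OF t] by blast
    from vw0[OF t this] have "AE x in circ. v t x = 0"
      unfolding AE_circ_iff by eventually_elim auto
    then show ?thesis by (intro integral_eq_zero_AE) auto
  qed
  define U where "U t = (LINT x|circ. u t x)" for t
  have uc: "AE x in lebesgue. u t x = U t / (2 * pi)" if t: "t \<in> {0..T}" for t
  proof (rule periodic_AE)
    show "periodic (\<lambda>x. u t x = U t / (2 * pi))"
      using L2_periodic[OF uL[OF t]] by (simp add: periodic_def)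
    obtain w where w: "w \<in> L2" "has_weak_deriv (u t) w" using ex[OF t] by blast
    show "AE x in circ. u t x = U t / (2 * pi)"
      unfolding U_def
    proof (rule circ_du_Bois_Reymond[OF L2_integrable[OF uL[OF t]]])
      fix \<psi> :: "real \<Rightarrow> real" assume "smooth \<psi>" "periodic \<psi>"
      then have "(LINT x|circ. u t x * deriv \<psi> x) = - (LINT x|circ. w x * \<psi> x)"
        using w(2) by (simp add: has_weak_deriv_def)
      also have "(LINT x|circ. w x * \<psi> x) = 0"
      proof (rule integral_eq_zero_AE)
        have "AE x in circ. w x = 0"
          using vw0[OF t w] unfolding AE_circ_iff by eventually_elim auto
        then show "AE x in circ. w x * \<psi> x = 0" by auto
      qed
      finally show "(LINT x|circ. u t x * deriv \<psi> x) = 0" by simp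
    qed
  qed
  have "U t = U 0" if t: "t \<in> {0..T}" for t
  proof (rule interval_du_Bois_Reymond[OF T _ _ t])
    show "continuous_on {0..T} U"
      using curve_continuous_pairing[OF u_curve[OF T sol], of "\<lambda>_. 1" 0] by (simp add: U_def[abs_def] periodic_def)
    fix \<theta> a b assume \<theta>: "smooth \<theta>" "0 < a" "b < T" "\<And>t. t \<notin> {a..b} \<Longrightarrow> \<theta> t = (0::real)"
    note d\<theta> = smooth_deriv[OF \<theta>(1)]
    have one: "smooth (\<lambda>_::real. 1)" "periodic (\<lambda>_. 1::real)" by (auto simp: periodic_def)
    \<comment> \<open>A test function depending on t alone pairs u with the derivative of \<theta>
      through the mean of u.\<close>
    have "(LINT t|lebesgue_on {0..T}. U t * deriv \<theta> t) = cyl_pairing T u (moving 0 (deriv \<theta>) (\<lambda>_. 1))"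
      using cyl_pairing_moving(1)[OF T sol d\<theta> one(1), of 0] by (simp add: U_def mult.commute)
    also have "\<dots> = cyl_pairing T u (d_t (moving 0 \<theta> (\<lambda>_. 1)))"
      by (simp add: d_t_moving[OF \<theta>(1) one(1)])
    also have "\<dots> = - cyl_pairing T v (moving 0 \<theta> (\<lambda>_. 1))"
      using sol test_fun_moving[OF \<theta>(1) one \<theta>(2-4)] by (simp add: wave_solution_def)
    also have "\<dots> = 0"
      unfolding cyl_pairing_moving(2)[OF T sol \<theta>(1) one(1)]
      by (simp, intro integral_eq_zero_AE AE_I2) (use v0[of _ "\<lambda>_. 1"] in simp)
    finally show "(LINT t|lebesgue_on {0..T}. U t * deriv \<theta> t) = 0" .
  qed
  then show "\<exists>c. \<forall>t\<in>{0..T}. AE x in lebesgue. u t x = c"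
    using uc by (intro exI[of _ "U 0 / (2 * pi)"]) metis
qed

section \<open>From (OSC) to the weak geometric control condition\<close>

lemma infsum_ennreal_pos:
  fixes f :: "'a \<Rightarrow> ennreal"
  assumes "f i > 0"
  shows "infsum f UNIV > 0"
proof -
  have "f i \<le> infsum f UNIV"
    using infsum_mono_neutral[of f "{i}" f UNIV] by (auto simp: nonneg_summable_on_complete)
  with assms show ?thesis by (rule less_le_trans)
qed

text \<open>The arclength parameter is sqrt 2 times the time t, so the two measures differ by the
  positive factor sqrt 2.\<close>

lemma line_measure_pos:
  assumes "emeasure lebesgue {t. (t, x - s * t) \<in> S} > 0"
  shows "line_measure (0, x) (1 / sqrt 2, - s / sqrt 2) S > 0"
proof -
  have "{r. (0, x) + r *\<^sub>R (1 / sqrt 2, - s / sqrt 2) \<in> S} = (\<lambda>t. sqrt 2 *\<^sub>R t + 0) ` {t. (t, x - s * t) \<in> S}"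
  proof (intro set_eqI iffI)
    fix r assume "r \<in> {r. (0, x) + r *\<^sub>R (1 / sqrt 2, - s / sqrt 2) \<in> S}"
    then show "r \<in> (\<lambda>t. sqrt 2 *\<^sub>R t + 0) ` {t. (t, x - s * t) \<in> S}"
      by (intro image_eqI[of _ _ "r / sqrt 2"]) (auto simp: mult.commute)
  qed (auto simp: mult.commute)
  then have "line_measure (0, x) (1 / sqrt 2, - s / sqrt 2) S =
      ennreal (sqrt 2) * emeasure lebesgue {t. (t, x - s * t) \<in> S}"
    unfolding line_measure_def using emeasure_lebesgue_affine[of "sqrt 2" "0::real"] by simp
  also have "\<dots> > 0"
    using assms by (simp add: ennreal_zero_less_mult_iff)
  finally show ?thesis .
qed

text \<open>One line of the family meeting G in positive measure makes the sum over the family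
  positive. A common hypothesis with the sign s serves both families.\<close>

lemma
  assumes "emeasure lebesgue {t. (t, x + 2 * pi * of_int k - s * t) \<in> G} > 0"
  shows meas_L_xi_pos: "s = 1 \<Longrightarrow> meas_L_xi x (G \<inter> L_xi x) > 0"
    and meas_L_eta_pos: "s = -1 \<Longrightarrow> meas_L_eta x (G \<inter> L_eta x) > 0"
proof -
  show "meas_L_xi x (G \<inter> L_xi x) > 0" if "s = 1"
  proof -
    have "{t. (t, x + 2 * of_int k * pi - 1 * t) \<in> G \<inter> L_xi x} = {t. (t, x + 2 * pi * of_int k - 1 * t) \<in> G}"
      by (auto simp: L_xi_def mult_ac)
    with assms that have "emeasure lebesgue {t. (t, x + 2 * of_int k * pi - 1 * t) \<in> G \<inter> L_xi x} > 0"
      by (simp only:)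
    from line_measure_pos[OF this] show ?thesis
      unfolding meas_L_xi_def by (rule infsum_ennreal_pos)
  qed
  show "meas_L_eta x (G \<inter> L_eta x) > 0" if "s = -1"
  proof -
    have "{t. (t, x + 2 * of_int k * pi - (-1) * t) \<in> G \<inter> L_eta x} = {t. (t, x + 2 * pi * of_int k - (-1) * t) \<in> G}"
      by (auto simp: L_eta_def mult_ac)
    with assms that have "emeasure lebesgue {t. (t, x + 2 * of_int k * pi - (-1) * t) \<in> G \<inter> L_eta x} > 0"
      by (simp only:)
    from line_measure_pos[OF this] have "line_measure (0, x + 2 * of_int k * pi) (1 / sqrt 2, 1 / sqrt 2) (G \<inter> L_eta x) > 0"
      by simp
    then show ?thesis
      unfolding meas_L_eta_def by (rule infsum_ennreal_pos)
  qed
qed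

text \<open>Let P consist of the labels y for which every line y + 2 pi k misses G up to a null set
  of times. By Fubini's theorem in the coordinates (y, t), the part of G carried by the lines of P
  is null. Hence P within one period satisfies the hypothesis \<open>triv\<close> and is
  null.\<close>

lemma AE_characteristic_meets:
  fixes G :: "(real \<times> real) set"
  assumes G: "G \<in> sets lebesgue" "G \<subseteq> {0..T} \<times> {0..2 * pi}"
    and triv: "\<And>A. A \<in> sets lebesgue \<Longrightarrow> A \<subseteq> {0..2 * pi} \<Longrightarrow>
      (AE p in lebesgue. p \<in> G \<longrightarrow> \<not> (\<exists>a\<in>A. \<exists>k::int. snd p + s * fst p = a + 2 * pi * of_int k)) \<Longrightarrow>
      measure lebesgue A = 0"
  shows "AE x in circ. \<exists>k::int. emeasure lebesgue {t. (t, x + 2 * pi * of_int k - s * t) \<in> G} > 0"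
proof -
  \<comment> \<open>The map takes (y, t) to the point at time t on the characteristic x + s * t = y.
    It is a coordinate exchange followed by a shear, hence preserves measure.\<close>
  define h where "h p = (snd p, fst p - s * snd p)" for p :: "real \<times> real"
  have h_eq: "h p = (fst (snd p, fst p), snd (snd p, fst p) + (- s) * fst (snd p, fst p))" for p
    by (simp add: h_def)
  have h_meas: "h \<in> lebesgue \<rightarrow>\<^sub>M lebesgue"
    unfolding h_eq[abs_def] by (rule measurable_compose[OF measurable_swap measurable_shear])
  define F where "F q = (indicator G (h q) :: real)" for q
  have Gm: "G \<in> lmeasurable"
  proof (rule fmeasurableI2[OF _ G(2,1)])
    show "{0..T} \<times> {0..2 * pi} \<in> lmeasurable"
      by (intro lmeasurable_compact compact_Times) auto
  qed
  have "integrable lebesgue (indicator G :: _ \<Rightarrow> real)"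
    using Gm by (intro integrable_real_indicator) (auto simp: fmeasurable_def)
  from integrable_lebesgue_preserved[OF swap_measurable distr_swap
      integrable_lebesgue_preserved[OF shear_measurable distr_shear this, of "- s"]]
  have F: "integrable lebesgue F"
    by (simp add: F_def[abs_def] h_def)
  define I where "I y = (LINT t|lebesgue. F (y, t))" for y
  have slice: "I y = measure lebesgue {t. (t, y - s * t) \<in> G}" for y
  proof -
    have "(\<lambda>t. F (y, t)) = indicator {t. (t, y - s * t) \<in> G}"
      by (auto simp: F_def h_def indicator_def)
    then show ?thesis by (simp add: I_def)
  qed
  have I [measurable]: "I \<in> borel_measurable lebesgue"
    unfolding I_def using Fubini_lebesgue(2)[OF F] by auto
  \<comment> \<open>Quantifying over all k makes P invariant under translation by 2 pi, so that it
    can be cut down to one period and recovered from it.\<close>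
  define P where "P = {y. \<forall>k::int. I (y + 2 * pi * of_int k) = 0}"
  have P: "P \<in> sets lebesgue"
  proof -
    have "{y \<in> space lebesgue. I (y + 2 * pi * of_int k) = 0} \<in> sets lebesgue" for k :: int
    proof -
      have "(\<lambda>y. I (y + 2 * pi * of_int k)) \<in> borel_measurable lebesgue"
        by (rule measurable_compose[OF measurable_shift I])
      then show ?thesis by measurable
    qed
    then have "{y \<in> space lebesgue. \<forall>k::int. I (y + 2 * pi * of_int k) = 0} \<in> sets lebesgue"
      by (rule sets.sets_Collect_countable_All)
    then show ?thesis by (simp add: P_def)
  qed
  have per: "y + 2 * pi * of_int j \<in> P" if "y \<in> P" for y and j :: int
  proof -
    have "y + 2 * pi * of_int j + 2 * pi * of_int k = y + 2 * pi * of_int (j + k)" for k :: int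
      by (simp add: algebra_simps)
    then show ?thesis using that unfolding P_def mem_Collect_eq by metis
  qed
  define W where "W = {p \<in> G. snd p + s * fst p \<in> P}"
  have "W \<in> sets lebesgue"
  proof -
    have "(\<lambda>p. indicator P (snd p + s * fst p) :: real) \<in> borel_measurable lebesgue"
      using P by (intro measurable_travelling) simp
    from measurable_sets[OF this, of "{1}"]
    have "{p. snd p + s * fst p \<in> P} \<in> sets lebesgue"
      by (rule back_subst[where P = "\<lambda>X. X \<in> _"]) (auto simp: indicator_def split: if_splits)
    then have "G \<inter> {p. snd p + s * fst p \<in> P} \<in> sets lebesgue" using G(1) by blast
    then show ?thesis by (simp add: W_def Int_def)
  qed
  have "AE q in lebesgue. q \<notin> h -` W"
  proof (rule AE_lebesgue_pairI)
    show "h -` W \<in> sets lebesgue"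
      using measurable_sets[OF h_meas \<open>W \<in> sets lebesgue\<close>] by simp
    show "AE y in lebesgue. AE t in lebesgue. (y, t) \<notin> h -` W"
      using Fubini_lebesgue(1)[OF F]
    proof eventually_elim
      case (elim y)
      show ?case
      proof (cases "y \<in> P")
        case True
        then have "I (y + 2 * pi * of_int 0) = 0" unfolding P_def by blast
        then have "(LINT t|lebesgue. F (y, t)) = 0" by (simp add: I_def)
        then have "AE t in lebesgue. F (y, t) = 0"
          using integral_nonneg_eq_0_iff_AE[OF elim] by (simp add: F_def)
        then show ?thesis
          by eventually_elim (auto simp: F_def W_def indicator_def split: if_splits)
      qed (auto simp: W_def h_def)
    qed
  qed
  \<comment> \<open>The shear by s followed by the exchange of coordinates is the inverse of h, so
    nullity of the preimage of W returns to W.\<close>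
  from AE_shear[OF AE_swap[OF this], of s]
  have W0: "AE p in lebesgue. p \<notin> W"
    by (simp add: h_def)
  define A where "A = P \<inter> {0..2 * pi}"
  have A: "A \<in> sets lebesgue" "A \<subseteq> {0..2 * pi}" using P by (auto simp: A_def)
  have "measure lebesgue A = 0"
  proof (rule triv[OF A])
    show "AE p in lebesgue. p \<in> G \<longrightarrow> \<not> (\<exists>a\<in>A. \<exists>k::int. snd p + s * fst p = a + 2 * pi * of_int k)"
      using W0 by eventually_elim (auto simp: W_def A_def intro: per)
  qed
  then have "AE x in circ. x \<notin> A"
    using measure_eq_0_iff_AE_circ[OF A] by blast
  then show ?thesis
    using AE_space[of circ]
  proof eventually_elim
    case (elim x)
    then have "x \<notin> P" by (auto simp: A_def)
    then obtain k :: int where "I (x + 2 * pi * of_int k) \<noteq> 0" by (auto simp: P_def)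
    then have "emeasure lebesgue {t. (t, x + 2 * pi * of_int k - s * t) \<in> G} \<noteq> 0"
      unfolding slice by (auto simp: measure_def)
    then show ?case by (auto simp: zero_less_iff_neq_zero)
  qed
qed

lemma OSC_imp_weak_GCC:
  assumes G: "G \<in> sets lebesgue" "G \<subseteq> {0..T} \<times> {0..2 * pi}" and osc: "OSC T G"
  shows "weak_GCC G"
proof -
  have sym: "observable_symmetric A B T G"
    if "AE p in lebesgue. p \<notin> sym_diff (G \<inter> L_xi_set T A) (G \<inter> L_eta_set T B)" for A B
    unfolding observable_symmetric_def using that by (simp add: completion.null_sets_iff_AE)
  have "AE x in circ. \<exists>k::int. emeasure lebesgue {t. (t, x + 2 * pi * of_int k - 1 * t) \<in> G} > 0"
  proof (rule AE_characteristic_meets[OF G])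
    fix A :: "real set" assume A: "A \<in> sets lebesgue" "A \<subseteq> {0..2 * pi}"
      and ae: "AE p in lebesgue. p \<in> G \<longrightarrow> \<not> (\<exists>a\<in>A. \<exists>k::int. snd p + 1 * fst p = a + 2 * pi * of_int k)"
    have "AE p in lebesgue. p \<notin> sym_diff (G \<inter> L_xi_set T A) (G \<inter> L_eta_set T {})"
      using ae by eventually_elim (auto simp: L_xi_set_def L_eta_set_def)
    from sym[OF this] have "trivial_pair A {}" using osc A unfolding OSC_def by blast
    \<comment> \<open>The empty set has measure 0, not 2 pi, so only the first alternative of
      triviality can hold.\<close>
    then show "measure lebesgue A = 0" by (simp add: trivial_pair_def)
  qed
  moreover have "AE x in circ. \<exists>k::int. emeasure lebesgue {t. (t, x + 2 * pi * of_int k - (-1) * t) \<in> G} > 0"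
  proof (rule AE_characteristic_meets[OF G])
    fix A :: "real set" assume A: "A \<in> sets lebesgue" "A \<subseteq> {0..2 * pi}"
      and ae: "AE p in lebesgue. p \<in> G \<longrightarrow> \<not> (\<exists>a\<in>A. \<exists>k::int. snd p + (-1) * fst p = a + 2 * pi * of_int k)"
    have "AE p in lebesgue. p \<notin> sym_diff (G \<inter> L_xi_set T {}) (G \<inter> L_eta_set T A)"
      using ae by eventually_elim (auto simp: L_xi_set_def L_eta_set_def)
    from sym[OF this] have "trivial_pair {} A" using osc A unfolding OSC_def by blast
    then show "measure lebesgue A = 0" by (simp add: trivial_pair_def)
  qed
  ultimately have "AE x in circ. meas_L_xi x (G \<inter> L_xi x) > 0 \<and> meas_L_eta x (G \<inter> L_eta x) > 0"
    by eventually_elim (blast intro: meas_L_xi_pos[OF _ refl] meas_L_eta_pos[OF _ refl])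
  then show ?thesis unfolding weak_GCC_def AE_circ_iff .
qed

section \<open>Primitives and translations of bounded functions\<close>

lemma bounded_integrable_interval:
  fixes f :: "real \<Rightarrow> real"
  assumes "f \<in> borel_measurable lebesgue" "\<And>x. \<bar>f x\<bar> \<le> C"
  shows "integrable (lebesgue_on {a..b}) f"
proof -
  have "integrable (lebesgue_on {a..b}) (\<lambda>x. 1 * f x)"
    by (rule integrable_mult_bounded[where C = C])
      (use assms in \<open>auto intro: integrable_lebesgue_on_continuous measurable_restrict_space1\<close>)
  then show ?thesis by simp
qed

lemma integral_interval_shift:
  fixes k :: "real \<Rightarrow> real"
  assumes "k \<in> borel_measurable lebesgue"
  shows "(LINT x|lebesgue_on {a..b}. k (x + d)) = (LINT x|lebesgue_on {a + d..b + d}. k x)"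
proof -
  have m: "(\<lambda>x. if x \<in> {a + d..b + d} then k x else 0) \<in> borel_measurable lebesgue"
    using assms by (subst borel_measurable_if) (auto intro: measurable_restrict_space1)
  have "(LINT x|lebesgue_on {a..b}. k (x + d)) = (LINT x|lebesgue. (if x \<in> {a..b} then k (x + d) else 0))"
    by (rule Lebesgue_Measure.integral_restrict_UNIV[symmetric]) simp
  also have "\<dots> = (LINT x|lebesgue. (if x + d \<in> {a + d..b + d} then k (x + d) else 0))"
    by (intro Bochner_Integration.integral_cong) auto
  also have "\<dots> = (LINT x|lebesgue. (if x \<in> {a + d..b + d} then k x else 0))"
    by (rule integral_lebesgue_preserved[OF shift_measurable distr_shift m])
  also have "\<dots> = (LINT x|lebesgue_on {a + d..b + d}. k x)"
    by (rule Lebesgue_Measure.integral_restrict_UNIV) simp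
  finally show ?thesis .
qed

lemma measurable_affine_real:
  fixes k :: "real \<Rightarrow> real"
  assumes "k \<in> borel_measurable lebesgue"
  shows "(\<lambda>x. k (x + d)) \<in> borel_measurable lebesgue"
    and "(\<lambda>x. k (d - x)) \<in> borel_measurable lebesgue"
proof -
  show s: "(\<lambda>x. k (x + d)) \<in> borel_measurable lebesgue" for d
    by (rule measurable_compose[OF measurable_shift assms])
  have "uminus \<in> lebesgue \<rightarrow>\<^sub>M (lebesgue :: real measure)"
    by (rule measure_preserving_lebesgue(1)) (auto simp: lborel_distr_uminus)
  from measurable_compose[OF this s[of d]]
  show "(\<lambda>x. k (d - x)) \<in> borel_measurable lebesgue" by simp
qed

lemma integral_interval_reflect:
  fixes k :: "real \<Rightarrow> real"
  assumes "k \<in> borel_measurable lebesgue"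
  shows "(LINT x|lebesgue_on {a..b}. k (d - x)) = (LINT x|lebesgue_on {d - b..d - a}. k x)"
proof -
  have "(LINT x|lebesgue_on {a..b}. k (d - x)) = (LINT x|lebesgue_on {- b..- a}. k (x + d))"
    using integral_reflect_real[where a = "- b" and b = "- a" and f = "\<lambda>x. k (x + d)"] by simp
  also have "\<dots> = (LINT x|lebesgue_on {d - b..d - a}. k x)"
    using integral_interval_shift[OF assms, of "- b" "- a" d] by simp
  finally show ?thesis .
qed

text \<open>This is the oriented integral from 0 to y: for each sign of y, one of the two intervals
  is empty or a single point and contributes 0.\<close>

definition primitive :: "(real \<Rightarrow> real) \<Rightarrow> real \<Rightarrow> real" where
  "primitive f y = (LINT s|lebesgue_on {0..y}. f s) - (LINT s|lebesgue_on {y..0}. f s)"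

lemma primitive_diff:
  assumes f: "f \<in> borel_measurable lebesgue" "\<And>x. \<bar>f x\<bar> \<le> C" and ab: "a \<le> b"
  shows "primitive f b - primitive f a = (LINT s|lebesgue_on {a..b}. f s)"
proof -
  note i = bounded_integrable_interval[OF f]
  have e: "(LINT s|lebesgue_on {p..q}. f s) = 0" if "q \<le> p" for p q
  proof (cases "q = p")
    case True
    then show ?thesis by (intro integral_eq_zero_null_sets) simp
  next
    case False
    then have "{p..q} = {}" using that by simp
    then show ?thesis by simp
  qed
  consider "0 \<le> a" | "a \<le> 0" "0 \<le> b" | "b \<le> 0" using ab by linarith
  then show ?thesis
  proof cases
    case 1
    then show ?thesis
      using integral_combine[OF i[of 0 b], of a] ab by (simp add: primitive_def e)
  next
    case 2
    then show ?thesis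
      using integral_combine[OF i[of a b], of 0] by (simp add: primitive_def e)
  next
    case 3
    then show ?thesis
      using integral_combine[OF i[of a 0], of b] ab by (simp add: primitive_def e)
  qed
qed

lemma primitive_Lipschitz:
  assumes f: "f \<in> borel_measurable lebesgue" "\<And>x. \<bar>f x\<bar> \<le> C"
  shows "\<bar>primitive f a - primitive f b\<bar> \<le> C * \<bar>a - b\<bar>"
proof -
  have *: "\<bar>primitive f q - primitive f p\<bar> \<le> C * \<bar>q - p\<bar>" if "p \<le> q" for p q
  proof -
    have "\<bar>primitive f q - primitive f p\<bar> = \<bar>LINT s|lebesgue_on {p..q}. f s\<bar>"
      by (simp add: primitive_diff[OF f that])
    also have "\<dots> \<le> (LINT s|lebesgue_on {p..q}. \<bar>f s\<bar>)" by (rule integral_abs_bound)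
    also have "\<dots> \<le> (LINT s|lebesgue_on {p..q}. C)"
      by (intro integral_mono integrable_abs bounded_integrable_interval[OF f] f(2)
          integrable_lebesgue_on_continuous[OF continuous_on_const])
    also have "\<dots> = C * \<bar>q - p\<bar>" using that by (simp add: measure_restrict_space)
    finally show ?thesis .
  qed
  show ?thesis
    using *[of a b] *[of b a] by (cases "a \<le> b") (auto simp: abs_minus_commute)
qed

lemma primitive_continuous:
  assumes f: "f \<in> borel_measurable lebesgue" "\<And>x. \<bar>f x\<bar> \<le> C"
  shows "continuous_on S (primitive f)"
proof (rule lipschitz_on_continuous_on)
  have "C \<ge> 0" using f(2)[of 0] by linarith
  then show "C-lipschitz_on S (primitive f)"
    using primitive_Lipschitz[OF f] by (intro lipschitz_onI) (auto simp: dist_real_def)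
qed

text \<open>W is only a primitive of a bounded function. The formula comes from integrating w s *
  \<phi>' x over the triangle s \<le> x in both orders: s inside gives (W x - W a) \<phi>' x, and x
  inside gives w s (\<phi> b - \<phi> s).\<close>

lemma integral_by_parts_bounded:
  fixes w W \<phi> \<phi>' :: "real \<Rightarrow> real"
  assumes ab: "a \<le> b" and w: "w \<in> borel_measurable lebesgue" "\<And>x. \<bar>w x\<bar> \<le> C"
    and W: "\<And>x. x \<in> {a..b} \<Longrightarrow> W x = W a + (LINT s|lebesgue_on {a..x}. w s)"
    and \<phi>: "\<And>x. (\<phi> has_real_derivative \<phi>' x) (at x)" and \<phi>': "continuous_on UNIV \<phi>'"
  shows "(LINT x|lebesgue_on {a..b}. W x * \<phi>' x) =
      W b * \<phi> b - W a * \<phi> a - (LINT x|lebesgue_on {a..b}. w x * \<phi> x)"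
proof -
  let ?M = "lebesgue_on {a..b}"
  define F where "F p = w (snd p) * (if snd p \<le> fst p then \<phi>' (fst p) else 0)" for p
  have c\<phi>': "continuous_on {a..b} \<phi>'" using \<phi>' by (rule continuous_on_subset) simp
  have c\<phi>: "continuous_on {a..b} \<phi>"
    using \<phi> by (intro DERIV_continuous_on) (auto intro: has_field_derivative_at_within)
  have "compact (\<phi>' ` {a..b})" using c\<phi>' by (intro compact_continuous_image) auto
  then obtain K where K: "K > 0" "\<And>x. x \<in> {a..b} \<Longrightarrow> \<bar>\<phi>' x\<bar> \<le> K"
    using compact_imp_bounded bounded_pos by (metis imageI real_norm_def)
  have mF: "F \<in> borel_measurable lebesgue"
    unfolding F_def
  proof (rule borel_measurable_times)
    show "(\<lambda>p::real \<times> real. w (snd p)) \<in> borel_measurable lebesgue"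
      using measurable_travelling[OF w(1), of 0] by simp
    have [measurable]: "(\<lambda>p::real \<times> real. \<phi>' (fst p)) \<in> borel_measurable borel"
      by (intro borel_measurable_continuous_onI continuous_on_compose2[OF \<phi>'] continuous_intros) auto
    have [measurable]: "{p::real \<times> real. snd p \<le> fst p} \<in> sets borel"
      by (intro borel_closed closed_Collect_le continuous_intros)
    have "(\<lambda>p::real \<times> real. \<phi>' (fst p) * indicator {p. snd p \<le> fst p} p) \<in> borel_measurable borel"
      by (intro borel_measurable_times borel_measurable_indicator) auto
    also have "(\<lambda>p::real \<times> real. \<phi>' (fst p) * indicator {p. snd p \<le> fst p} p) =
        (\<lambda>p. if snd p \<le> fst p then \<phi>' (fst p) else 0)"
      by (auto simp: fun_eq_iff indicator_def)
    finally show "(\<lambda>p::real \<times> real. if snd p \<le> fst p then \<phi>' (fst p) else 0) \<in> borel_measurable lebesgue"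
      by (intro measurable_completion) simp
  qed
  have "integrable (lebesgue_on ({a..b} \<times> {a..b})) (\<lambda>p. 1 * F p)"
  proof (rule integrable_mult_bounded[where C = "C * K"])
    have "{a..b} \<times> {a..b} \<in> lmeasurable"
      by (intro lmeasurable_compact compact_Times) auto
    then interpret finite_measure "lebesgue_on ({a..b} \<times> {a..b})"
      by (rule finite_measure_lebesgue_on)
    show "integrable (lebesgue_on ({a..b} \<times> {a..b})) (\<lambda>p. 1 :: real)" by simp
    show "F \<in> borel_measurable (lebesgue_on ({a..b} \<times> {a..b}))"
      using mF by (rule measurable_restrict_space1)
    fix p assume "p \<in> space (lebesgue_on ({a..b} \<times> {a..b}))"
    then have "\<bar>\<phi>' (fst p)\<bar> \<le> K" using K(2) by auto
    moreover have "C \<ge> 0" using w(2)[of 0] by linarith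
    ultimately show "\<bar>F p\<bar> \<le> C * K"
      using w(2)[of "snd p"] K(1) by (auto simp: F_def abs_mult intro!: mult_mono)
  qed
  then have iF: "integrable (lebesgue_on ({a..b} \<times> {a..b})) F" by simp
  have restr: "(LINT s|?M. (if s \<in> S then h s else 0)) = (LINT s|lebesgue_on (S \<inter> {a..b}). h s)"
    if "S \<in> sets lebesgue" for S and h :: "real \<Rightarrow> real"
    using that by (intro Lebesgue_Measure.integral_restrict_Int) auto
  have "(LINT p|lebesgue_on ({a..b} \<times> {a..b}). F p) = (LINT x|?M. LINT s|?M. F (x, s))"
    by (rule Fubini_lebesgue_on(1)[OF _ _ iF]) auto
  also have "\<dots> = (LINT x|?M. (W x - W a) * \<phi>' x)"
  proof (intro Bochner_Integration.integral_cong refl)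
    fix x assume "x \<in> space ?M"
    then have x: "x \<in> {a..b}" by simp
    have "(LINT s|?M. F (x, s)) = (LINT s|?M. (if s \<in> {..x} then w s else 0) * \<phi>' x)"
      by (intro Bochner_Integration.integral_cong refl) (auto simp: F_def)
    also have "\<dots> = (LINT s|?M. (if s \<in> {..x} then w s else 0)) * \<phi>' x" by simp
    also have "(LINT s|?M. (if s \<in> {..x} then w s else 0)) = (LINT s|lebesgue_on ({..x} \<inter> {a..b}). w s)"
      by (rule restr) simp
    also have "{..x} \<inter> {a..b} = {a..x}" using x by auto
    finally show "(LINT s|?M. F (x, s)) = (W x - W a) * \<phi>' x" using W[OF x] by simp
  qed
  finally have 1: "(LINT p|lebesgue_on ({a..b} \<times> {a..b}). F p) = (LINT x|?M. (W x - W a) * \<phi>' x)" .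
  have "(LINT p|lebesgue_on ({a..b} \<times> {a..b}). F p) = (LINT s|?M. LINT x|?M. F (x, s))"
    by (rule Fubini_lebesgue_on(2)[OF _ _ iF]) auto
  also have "\<dots> = (LINT s|?M. w s * (\<phi> b - \<phi> s))"
  proof (intro Bochner_Integration.integral_cong refl)
    fix s assume "s \<in> space ?M"
    then have s: "s \<in> {a..b}" by simp
    have "(LINT x|?M. F (x, s)) = (LINT x|?M. w s * (if x \<in> {s..} then \<phi>' x else 0))"
      by (intro Bochner_Integration.integral_cong refl) (auto simp: F_def)
    also have "\<dots> = w s * (LINT x|?M. (if x \<in> {s..} then \<phi>' x else 0))" by simp
    also have "(LINT x|?M. (if x \<in> {s..} then \<phi>' x else 0)) = (LINT x|lebesgue_on ({s..} \<inter> {a..b}). \<phi>' x)"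
      by (rule restr) simp
    also have "{s..} \<inter> {a..b} = {s..b}" using s by auto
    also have "(LINT x|lebesgue_on {s..b}. \<phi>' x) = \<phi> b - \<phi> s"
      using s \<phi> by (intro FTC_lebesgue_on continuous_on_subset[OF \<phi>']) auto
    finally show "(LINT x|?M. F (x, s)) = w s * (\<phi> b - \<phi> s)" .
  qed
  finally have 2: "(LINT x|?M. (W x - W a) * \<phi>' x) = (LINT s|?M. w s * (\<phi> b - \<phi> s))"
    using 1 by simp
  have iw: "integrable ?M w" by (rule bounded_integrable_interval[OF w])
  have cW: "continuous_on {a..b} W"
  proof -
    have "continuous_on {a..b} (\<lambda>x. W a + (primitive w x - primitive w a))"
      by (intro continuous_intros primitive_continuous[OF w])
    then show ?thesis
    proof (rule continuous_on_eq)
      fix x assume "x \<in> {a..b}"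
      then show "W a + (primitive w x - primitive w a) = W x"
        using W[of x] primitive_diff[OF w, of a x] by simp
    qed
  qed
  have i: "integrable ?M (\<lambda>x. W x * \<phi>' x)" "integrable ?M \<phi>'" "integrable ?M (\<lambda>s. w s * \<phi> s)"
    by (intro integrable_lebesgue_on_continuous continuous_on_mult cW c\<phi>',
        rule integrable_lebesgue_on_continuous[OF c\<phi>'], rule integrable_mult_continuous[OF iw c\<phi>])
  have "(LINT x|?M. W x * \<phi>' x) - W a * (\<phi> b - \<phi> a) = (LINT x|?M. (W x - W a) * \<phi>' x)"
    using i FTC_lebesgue_on[OF ab \<phi> c\<phi>'] by (simp add: left_diff_distrib)
  also have "\<dots> = (LINT s|?M. w s) * \<phi> b - (LINT s|?M. w s * \<phi> s)"
    unfolding 2 using i iw by (simp add: right_diff_distrib)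
  also have "(LINT s|?M. w s) = W b - W a" using W[of b] ab by simp
  finally show ?thesis by (simp add: algebra_simps)
qed

text \<open>A measurable function is an almost everywhere limit of continuous ones. Truncation to
  [- C, C] leaves the limit unchanged and permits dominated convergence.\<close>

lemma continuous_L1_approximation:
  fixes f :: "real \<Rightarrow> real"
  assumes f: "f \<in> borel_measurable lebesgue" "\<And>x. \<bar>f x\<bar> \<le> C" and e: "e > 0"
  obtains h where "continuous_on UNIV h" "\<And>x. \<bar>h x\<bar> \<le> C" "(LINT x|lebesgue_on {a..b}. \<bar>f x - h x\<bar>) < e"
proof -
  have "f measurable_on UNIV" using f(1) by (simp add: measurable_on_iff_borel_measurable lebesgue_on_UNIV_eq)
  then obtain N g where N: "negligible N" and g: "\<And>n. continuous_on UNIV (g n)"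
    "\<And>x. x \<notin> N \<Longrightarrow> (\<lambda>n. g n x) \<longlonglongrightarrow> f x"
    unfolding measurable_on_def by auto
  have C: "C \<ge> 0" using f(2)[of 0] by linarith
  define h where "h n x = max (- C) (min C (g n x))" for n and x :: real
  have h: "continuous_on UNIV (h n)" for n
    unfolding h_def by (intro continuous_intros g)
  have hC: "\<bar>h n x\<bar> \<le> C" for n x using C by (auto simp: h_def)
  have lim: "(\<lambda>n. h n x) \<longlonglongrightarrow> f x" if "x \<notin> N" for x
  proof -
    have "(\<lambda>n. max (- C) (min C (g n x))) \<longlonglongrightarrow> max (- C) (min C (f x))"
      by (intro tendsto_intros g that)
    moreover have "max (- C) (min C (f x)) = f x" using f(2)[of x] by auto
    ultimately show ?thesis by (simp add: h_def)
  qed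
  have mh: "h n \<in> borel_measurable lebesgue" for n
    using h by (intro measurable_completion) (simp add: borel_measurable_continuous_onI)
  have "(\<lambda>n. LINT x|lebesgue_on {a..b}. \<bar>f x - h n x\<bar>) \<longlonglongrightarrow> (LINT x|lebesgue_on {a..b}. 0)"
  proof (rule integral_dominated_convergence[where w = "\<lambda>_. 2 * C"])
    show "integrable (lebesgue_on {a..b}) (\<lambda>_. 2 * C)"
      by (rule integrable_lebesgue_on_continuous) simp
    show "(\<lambda>x. \<bar>f x - h n x\<bar>) \<in> borel_measurable (lebesgue_on {a..b})" for n
      using f(1) mh[of n] by (intro measurable_restrict_space1) measurable
    have "AE x in lebesgue. x \<notin> N" using N by (simp add: negligible_iff_null_sets AE_not_in)
    then have "AE x in lebesgue_on {a..b}. x \<notin> N"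
      by (subst AE_restrict_space_iff) (auto elim: eventually_mono)
    then show "AE x in lebesgue_on {a..b}. (\<lambda>n. \<bar>f x - h n x\<bar>) \<longlonglongrightarrow> 0"
    proof eventually_elim
      case (elim x)
      then show ?case using tendsto_rabs[OF tendsto_diff[OF tendsto_const[of "f x"] lim[OF elim]]] by simp
    qed
    show "AE x in lebesgue_on {a..b}. norm \<bar>f x - h n x\<bar> \<le> 2 * C" for n
    proof (rule AE_I2)
      fix x show "norm \<bar>f x - h n x\<bar> \<le> 2 * C"
        using f(2)[of x] hC[of n x] by (simp add: abs_le_iff)
    qed
  qed simp
  then have "(\<lambda>n. LINT x|lebesgue_on {a..b}. \<bar>f x - h n x\<bar>) \<longlonglongrightarrow> 0" by simp
  from order_tendstoD(2)[OF this e] obtain n where "(LINT x|lebesgue_on {a..b}. \<bar>f x - h n x\<bar>) < e"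
    using eventually_happens'[OF sequentially_bot] by blast
  with h hC show ?thesis using that by blast
qed

text \<open>The usual argument in three parts: approximate by a continuous h, use its uniform
  continuity on a compact interval, and return to f. The limit is along \<open>nhds c\<close>, so it
  composes with any map converging to c.\<close>

lemma translation_L1_continuous:
  fixes f :: "real \<Rightarrow> real"
  assumes f: "f \<in> borel_measurable lebesgue" "\<And>x. \<bar>f x\<bar> \<le> C" and ab: "a \<le> b"
  shows "((\<lambda>d. LINT x|lebesgue_on {a..b}. \<bar>f (x + d) - f (x + c)\<bar>) \<longlongrightarrow> 0) (nhds c)"
proof (rule tendstoI)
  fix e :: real assume e: "e > 0"
  let ?M = "lebesgue_on {a..b}"
  \<comment> \<open>The interval is widened by 1 on both sides so that it contains the translates of
    [a, b] by all d with \<bar>d - c\<bar> < 1.\<close>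
  obtain h where h: "continuous_on UNIV h" "\<And>x. \<bar>h x\<bar> \<le> C"
    "(LINT x|lebesgue_on {a + c - 1..b + c + 1}. \<bar>f x - h x\<bar>) < e / 3"
    using continuous_L1_approximation[OF f, of "e / 3" "a + c - 1" "b + c + 1"] e by auto
  have mh: "h \<in> borel_measurable lebesgue"
    using h(1) by (intro measurable_completion) (simp add: borel_measurable_continuous_onI)
  have fh: "(\<lambda>x. \<bar>f x - h x\<bar>) \<in> borel_measurable lebesgue" using f(1) mh by measurable
  have fhC: "\<bar>\<bar>f x - h x\<bar>\<bar> \<le> 2 * C" for x
    using f(2)[of x] h(2)[of x] by (simp add: abs_le_iff)
  have close: "(LINT x|?M. \<bar>f (x + d) - h (x + d)\<bar>) < e / 3" if "\<bar>d - c\<bar> < 1" for d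
  proof -
    have "(LINT x|?M. \<bar>f (x + d) - h (x + d)\<bar>) = (LINT x|lebesgue_on {a + d..b + d}. \<bar>f x - h x\<bar>)"
      by (rule integral_interval_shift[OF fh])
    also have "\<dots> \<le> (LINT x|lebesgue_on {a + c - 1..b + c + 1}. \<bar>f x - h x\<bar>)"
      using bounded_integrable_interval[OF fh fhC] that
      by (intro integral_mono_lebesgue_on_AE) auto
    finally show ?thesis using h(3) by simp
  qed
  have "uniformly_continuous_on {a + c - 1..b + c + 1} h"
    using continuous_on_subset[OF h(1)] by (intro compact_uniformly_continuous) auto
  \<comment> \<open>The summand 1 covers a = b and makes the contribution of the middle term
    strictly smaller than e / 3.\<close>
  moreover have "e / (3 * (b - a + 1)) > 0" using e ab by simp
  ultimately obtain r where r: "r > 0" "\<And>x y. x \<in> {a + c - 1..b + c + 1} \<Longrightarrow> y \<in> {a + c - 1..b + c + 1} \<Longrightarrow>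
      \<bar>y - x\<bar> < r \<Longrightarrow> \<bar>h y - h x\<bar> < e / (3 * (b - a + 1))"
    unfolding uniformly_continuous_on_def dist_real_def by metis
  have "(LINT x|?M. \<bar>f (x + d) - f (x + c)\<bar>) < e" if d: "\<bar>d - c\<bar> < min r 1" for d
  proof -
    have i: "integrable ?M (\<lambda>x. \<bar>f (x + q) - h (x + q)\<bar>)" for q
      using measurable_affine_real(1)[OF fh, of q] fhC by (intro bounded_integrable_interval[where C = "2 * C"]) auto
    have k: "integrable ?M (\<lambda>_. e / (3 * (b - a + 1)))" by (rule integrable_lebesgue_on_continuous) simp
    have "(LINT x|?M. \<bar>f (x + d) - f (x + c)\<bar>) \<le>
        (LINT x|?M. \<bar>f (x + d) - h (x + d)\<bar> + e / (3 * (b - a + 1)) + \<bar>f (x + c) - h (x + c)\<bar>)"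
    proof (rule integral_mono)
      have "(\<lambda>x. \<bar>f (x + d) - f (x + c)\<bar>) \<in> borel_measurable lebesgue"
        using measurable_affine_real(1)[OF f(1), of d] measurable_affine_real(1)[OF f(1), of c] by measurable
      moreover have "\<bar>\<bar>f (x + d) - f (x + c)\<bar>\<bar> \<le> 2 * C" for x
        using f(2)[of "x + d"] f(2)[of "x + c"] by (simp add: abs_le_iff)
      ultimately show "integrable ?M (\<lambda>x. \<bar>f (x + d) - f (x + c)\<bar>)"
        by (rule bounded_integrable_interval)
      show "integrable ?M (\<lambda>x. \<bar>f (x + d) - h (x + d)\<bar> + e / (3 * (b - a + 1)) + \<bar>f (x + c) - h (x + c)\<bar>)"
        using i k by (intro Bochner_Integration.integrable_add)
      fix x assume "x \<in> space ?M"
      then have "\<bar>h (x + d) - h (x + c)\<bar> < e / (3 * (b - a + 1))"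
        using d by (intro r(2)) auto
      then show "\<bar>f (x + d) - f (x + c)\<bar> \<le>
          \<bar>f (x + d) - h (x + d)\<bar> + e / (3 * (b - a + 1)) + \<bar>f (x + c) - h (x + c)\<bar>"
        by linarith
    qed
    also have "\<dots> = (LINT x|?M. \<bar>f (x + d) - h (x + d)\<bar>) + (b - a) * (e / (3 * (b - a + 1))) +
        (LINT x|?M. \<bar>f (x + c) - h (x + c)\<bar>)"
      using i k ab by (simp add: measure_restrict_space)
    also have "(b - a) * (e / (3 * (b - a + 1))) < e / 3"
      using e ab by (simp add: field_simps)
    finally show ?thesis using close[of d] close[of c] d by simp
  qed
  then show "\<forall>\<^sub>F d in nhds c. dist (LINT x|?M. \<bar>f (x + d) - f (x + c)\<bar>) 0 < e"
    unfolding eventually_nhds_metric using r(1)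
    by (intro exI[of _ "min r 1"]) (auto simp: dist_real_def)
qed

section \<open>D'Alembert solutions\<close>

lemma weak_deriv_unique:
  assumes g: "g \<in> L2" "has_weak_deriv f g" and h: "h \<in> L2" "has_weak_deriv f h"
  shows "AE x in circ. g x = h x"
proof -
  have "AE x in circ. g x - h x = 0"
  proof (rule circ_fundamental_lemma)
    show "integrable circ (\<lambda>x. g x - h x)" using L2_integrable[OF g(1)] L2_integrable[OF h(1)] by simp
    fix \<psi> :: "real \<Rightarrow> real" assume \<psi>: "smooth \<psi>" "periodic \<psi>"
    have i: "integrable circ (\<lambda>x. g x * \<psi> x)" "integrable circ (\<lambda>x. h x * \<psi> x)"
      using L2_integrable g(1) h(1) smooth_continuous_on[OF \<psi>(1)] by (auto intro: integrable_mult_continuous)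
    have "(LINT x|circ. f x * deriv \<psi> x) = - (LINT x|circ. g x * \<psi> x)"
      "(LINT x|circ. f x * deriv \<psi> x) = - (LINT x|circ. h x * \<psi> x)"
      using g(2)[unfolded has_weak_deriv_def, rule_format, of \<psi>]
        h(2)[unfolded has_weak_deriv_def, rule_format, of \<psi>] \<psi> by blast+
    then have "(LINT x|circ. g x * \<psi> x) = (LINT x|circ. h x * \<psi> x)" by simp
    then show "(LINT x|circ. (g x - h x) * \<psi> x) = 0" using i by (simp add: left_diff_distrib)
  qed
  then show ?thesis by simp
qed

text \<open>\<open>H1_norm\<close> is defined by a choice of weak derivative. Uniqueness almost
  everywhere allows any explicit one in its place, in particular differences of
  \<open>wave_x\<close> slices.\<close>

lemma H1_norm_eq:
  assumes "h \<in> L2" "has_weak_deriv f h"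
  shows "H1_norm f = sqrt ((L2_norm f)\<^sup>2 + (L2_norm h)\<^sup>2)"
proof -
  have w: "weak_deriv f \<in> L2" "has_weak_deriv f (weak_deriv f)"
    using someI[of "\<lambda>g. g \<in> L2 \<and> has_weak_deriv f g" h] assms by (auto simp: weak_deriv_def)
  have "(LINT x|circ. (weak_deriv f x)\<^sup>2) = (LINT x|circ. (h x)\<^sup>2)"
  proof (rule Bochner_Integration.integral_cong_AE)
    show "AE x in circ. (weak_deriv f x)\<^sup>2 = (h x)\<^sup>2"
      using weak_deriv_unique[OF w assms] by eventually_elim simp
  qed (use L2_integrable_square[OF w(1)] L2_integrable_square[OF assms(1)] in auto)
  then have "L2_norm (weak_deriv f) = L2_norm h" by (simp add: L2_norm_def)
  then show ?thesis by (simp add: H1_norm_def)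
qed

lemma bounded_L2:
  assumes "periodic f" "f \<in> borel_measurable lebesgue" "\<And>x. \<bar>f x\<bar> \<le> C"
  shows "f \<in> L2"
proof -
  have "\<bar>(f x)\<^sup>2\<bar> \<le> C\<^sup>2" for x
    using power_mono[OF assms(3)[of x], of 2] by simp
  then have "integrable circ (\<lambda>x. (f x)\<^sup>2)"
    using assms(2) by (intro bounded_integrable_interval) measurable
  then show ?thesis using assms by (simp add: L2_def)
qed

text \<open>For functions bounded by M, the square is at most M \<bar>k\<bar>; uniform boundedness
  thus upgrades convergence in \<open>L1\<close> to convergence in \<open>L2\<close>.\<close>

lemma L2_norm_tendsto_0:
  assumes meas: "\<And>r. k r \<in> borel_measurable lebesgue" and bound: "\<And>r x. \<bar>k r x\<bar> \<le> M"
    and lim: "((\<lambda>r. LINT x|circ. \<bar>k r x\<bar>) \<longlongrightarrow> 0) F"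
  shows "((\<lambda>r. L2_norm (k r)) \<longlongrightarrow> 0) F"
proof (rule Lim_null_comparison)
  show "\<forall>\<^sub>F r in F. norm (L2_norm (k r)) \<le> sqrt (M * (LINT x|circ. \<bar>k r x\<bar>))"
  proof (intro always_eventually allI)
    fix r
    have "(LINT x|circ. (k r x)\<^sup>2) \<le> (LINT x|circ. M * \<bar>k r x\<bar>)"
    proof (rule integral_mono)
      have "\<bar>(k r x)\<^sup>2\<bar> \<le> M\<^sup>2" for x
        using power_mono[OF bound[of r x], of 2] by simp
      then show "integrable circ (\<lambda>x. (k r x)\<^sup>2)"
        using meas[of r] by (intro bounded_integrable_interval) measurable
      show "integrable circ (\<lambda>x. M * \<bar>k r x\<bar>)"
        using bounded_integrable_interval[OF meas bound] by simp
      show "(k r x)\<^sup>2 \<le> M * \<bar>k r x\<bar>" for x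
        using mult_right_mono[OF bound[of r x], of "\<bar>k r x\<bar>"] by (simp add: power2_eq_square)
    qed
    then have "L2_norm (k r) \<le> sqrt (M * (LINT x|circ. \<bar>k r x\<bar>))" by (simp add: L2_norm_def)
    then show "norm (L2_norm (k r)) \<le> sqrt (M * (LINT x|circ. \<bar>k r x\<bar>))"
      using L2_norm_nonneg[of "k r"] by simp
  qed
  have "((\<lambda>r. sqrt (M * (LINT x|circ. \<bar>k r x\<bar>))) \<longlongrightarrow> sqrt (M * 0)) F"
    by (intro tendsto_intros lim)
  then show "((\<lambda>r. sqrt (M * (LINT x|circ. \<bar>k r x\<bar>))) \<longlongrightarrow> 0) F" by simp
qed

lemma
  assumes "test_fun T \<phi>"
  shows test_fun_d_t: "test_fun T (d_t \<phi>)"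
    and d_x_periodic: "d_x \<phi> (t, x + 2 * pi) = d_x \<phi> (t, x)"
    and test_fun_at_ends: "\<phi> (0, x) = 0" "T > 0 \<Longrightarrow> \<phi> (T, x) = 0"
    and test_fun_smooth: "smooth \<phi>"
    and test_fun_periodic: "\<phi> (t, x + 2 * pi) = \<phi> (t, x)"
proof -
  show sm: "smooth \<phi>" using assms by (simp add: test_fun_def)
  show per: "\<phi> (t, x + 2 * pi) = \<phi> (t, x)" for t x
    using assms by (auto simp: test_fun_def periodic_def)
  obtain a b where ab: "0 < a" "b < T" "\<And>t x. t \<notin> {a..b} \<Longrightarrow> \<phi> (t, x) = 0"
    using assms by (auto simp: test_fun_def)
  show "\<phi> (0, x) = 0" "\<phi> (T, x) = 0" using ab by auto
  have "d_t \<phi> (t, x + 2 * pi) = d_t \<phi> (t, x)" for t x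
    by (rule d_t_eqI[OF sm]) (use smooth_test_slice(1)[OF sm, of x t] per in simp)
  moreover have "d_t \<phi> (t, x) = 0" if "t \<notin> {a..b}" for t x
  proof -
    have "deriv (\<lambda>t. \<phi> (t, x)) t = 0" by (rule deriv_support[of a b]) (use ab that in auto)
    then show ?thesis using DERIV_imp_deriv[OF smooth_test_slice(1)[OF sm]] by simp
  qed
  moreover have "smooth (d_t \<phi>)" using sm by (rule smooth_dir_deriv) (simp add: Basis_prod_def)
  ultimately show "test_fun T (d_t \<phi>)" using ab unfolding test_fun_def periodic_def by blast
  show "d_x \<phi> (t, x + 2 * pi) = d_x \<phi> (t, x)"
  proof (rule d_x_eqI[OF sm])
    have "((\<lambda>y. \<phi> (t, y - 2 * pi)) has_real_derivative d_x \<phi> (t, x)) (at (x + 2 * pi))"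
      using DERIV_shift[of "\<lambda>y. \<phi> (t, y - 2 * pi)" "d_x \<phi> (t, x)" x "2 * pi"] smooth_test_slice(2)[OF sm, of t x]
      by simp
    moreover have "\<phi> (t, y - 2 * pi) = \<phi> (t, y)" for y using per[of t "y - 2 * pi"] by simp
    ultimately show "((\<lambda>y. \<phi> (t, y)) has_real_derivative d_x \<phi> (t, x)) (at (x + 2 * pi))" by simp
  qed
qed

lemma integrable_cyl_bounded:
  fixes w :: "real \<Rightarrow> real \<Rightarrow> real"
  assumes "(\<lambda>p. w (fst p) (snd p)) \<in> borel_measurable lebesgue" "\<And>t x. \<bar>w t x\<bar> \<le> M"
  shows "integrable (cyl T) (\<lambda>p. w (fst p) (snd p))"
proof -
  have "{0..T} \<times> {0..2 * pi} \<in> lmeasurable"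
    by (intro lmeasurable_compact compact_Times) auto
  then interpret finite_measure "cyl T"
    by (rule finite_measure_lebesgue_on)
  have "integrable (cyl T) (\<lambda>p. 1 * w (fst p) (snd p))"
    using assms by (intro integrable_mult_bounded[where C = M] measurable_restrict_space1) auto
  then show ?thesis by simp
qed

lemma integrable_cyl_continuous:
  assumes "continuous_on UNIV (k :: real \<times> real \<Rightarrow> real)"
  shows "integrable (cyl T) k"
  using integrable_cyl_mult[OF integrable_cyl_bounded[of "\<lambda>_ _. 1" 1] assms] by simp

text \<open>Translating x by - s t puts f at rest and places the test function on a characteristic,
  where the operator becomes the ordinary time derivative of \<phi> (t, x - s * t). Its time
  integral vanishes, as \<phi> is 0 at both ends.\<close>

lemma travelling_pairing:
  assumes f: "periodic f" "f \<in> borel_measurable lebesgue" "\<And>x. \<bar>f x\<bar> \<le> C"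
    and \<phi>: "test_fun T \<phi>" and T: "T > 0"
  shows "cyl_pairing T (\<lambda>t x. f (x + s * t)) (\<lambda>p. d_t \<phi> p - s * d_x \<phi> p) = 0"
proof -
  note sm = test_fun_smooth[OF \<phi>]
  define k where "k p = d_t \<phi> p - s * d_x \<phi> p" for p
  have ck: "continuous_on UNIV k"
    unfolding k_def using smooth_continuous_on[OF smooth_dir_deriv[OF sm]]
    by (intro continuous_intros) (auto simp: Basis_prod_def)
  have perk: "k (t, x + 2 * pi) = k (t, x)" for t x
    using test_fun_periodic[OF test_fun_d_t[OF \<phi>]] d_x_periodic[OF \<phi>] by (simp add: k_def)
  have int: "integrable (cyl T) (\<lambda>p. f (snd p + c * fst p))" for c
    using integrable_cyl_bounded[of "\<lambda>t x. f (x + c * t)"] measurable_travelling[OF f(2)] f(3) by blast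
  have cs: "continuous_on UNIV (\<lambda>p::real \<times> real. k (fst p, snd p - s * fst p))"
    by (intro continuous_on_compose2[OF ck] continuous_intros) auto
  have "cyl_pairing T (\<lambda>t x. f (x + s * t)) k = (LINT t|lebesgue_on {0..T}. LINT x|circ. f (x + s * t) * k (t, x))"
    by (rule cyl_pairing_iterated[OF int ck])
  also have "\<dots> = (LINT t|lebesgue_on {0..T}. LINT x|circ. f x * k (t, x - s * t))"
  proof (rule Bochner_Integration.integral_cong[OF refl])
    fix t
    have ckt: "continuous_on {0..2 * pi} (\<lambda>x. k (t, x - s * t))"
      by (intro continuous_on_compose2[OF ck] continuous_intros) auto
    have "integrable circ (\<lambda>x. f x * k (t, x - s * t))"
      by (rule integrable_mult_continuous[OF bounded_integrable_interval[OF f(2,3)] ckt])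
    moreover have "periodic (\<lambda>x. f x * k (t, x - s * t))"
      using f(1) perk[of t] by (simp add: periodic_def) (metis add_diff_eq add.commute add.left_commute diff_add_eq)
    ultimately show "(LINT x|circ. f (x + s * t) * k (t, x)) = (LINT x|circ. f x * k (t, x - s * t))"
      using integral_circ_shift[of "\<lambda>x. f x * k (t, x - s * t)" "s * t"] by simp
  qed
  also have "\<dots> = (LINT p|cyl T. f (snd p + 0 * fst p) * k (fst p, snd p - s * fst p))"
    using Fubini_lebesgue_on(1)[OF _ _ integrable_cyl_mult[OF int cs], of 0] by simp
  also have "\<dots> = (LINT x|circ. LINT t|lebesgue_on {0..T}. f x * k (t, x - s * t))"
    using Fubini_lebesgue_on(2)[OF _ _ integrable_cyl_mult[OF int cs], of 0] by simp
  also have "\<dots> = (LINT x|circ. 0)"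
  proof (rule Bochner_Integration.integral_cong[OF refl])
    fix x
    have "(LINT t|lebesgue_on {0..T}. k (t, x - s * t)) = \<phi> (T, x - s * T) - \<phi> (0, x - s * 0)"
    proof (rule FTC_lebesgue_on)
      show "((\<lambda>t. \<phi> (t, x - s * t)) has_real_derivative k (t, x - s * t)) (at t)" for t
        unfolding k_def by (rule smooth_test_slice(3)[OF sm])
      show "continuous_on {0..T} (\<lambda>t. k (t, x - s * t))"
        by (intro continuous_on_compose2[OF ck] continuous_intros) auto
    qed (use T in simp)
    also have "\<dots> = 0" using test_fun_at_ends[OF \<phi>] T by simp
    finally show "(LINT t|lebesgue_on {0..T}. f x * k (t, x - s * t)) = 0" by simp
  qed
  finally show ?thesis by (simp add: k_def[abs_def])
qed

section \<open>The solution with given bounded periodic profiles\<close>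

context
  fixes f g :: "real \<Rightarrow> real" and C T :: real
  assumes T: "T > 0"
    and f: "periodic f" "f \<in> borel_measurable lebesgue" "\<And>x. \<bar>f x\<bar> \<le> C"
    and g: "periodic g" "g \<in> borel_measurable lebesgue" "\<And>x. \<bar>g x\<bar> \<le> C"
    and mean: "(LINT x|circ. f x) + (LINT x|circ. g x) = 0"
begin

definition wave :: "real \<Rightarrow> real \<Rightarrow> real" where
  "wave t x = primitive f (x + t) + primitive g (x - t)"

definition wave_t :: "real \<Rightarrow> real \<Rightarrow> real" where
  "wave_t t x = f (x + t) - g (x - t)"

definition wave_x :: "real \<Rightarrow> real \<Rightarrow> real" where
  "wave_x t x = f (x + t) + g (x - t)"

lemma C_nonneg: "C \<ge> 0"
  using f(3)[of 0] by linarith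

lemma slice_measurable:
  "wave_t t \<in> borel_measurable lebesgue" "wave_x t \<in> borel_measurable lebesgue"
  "(\<lambda>t. wave_t t x) \<in> borel_measurable lebesgue"
proof -
  have mf: "(\<lambda>x. f (x + c)) \<in> borel_measurable lebesgue" and mg: "(\<lambda>x. g (x - c)) \<in> borel_measurable lebesgue"
    and mg': "(\<lambda>x. g (c - x)) \<in> borel_measurable lebesgue" for c
    using measurable_affine_real[OF f(2), of c] measurable_affine_real[OF g(2), of c]
      measurable_affine_real(1)[OF g(2), of "- c"] by simp_all
  show "wave_t t \<in> borel_measurable lebesgue" "wave_x t \<in> borel_measurable lebesgue"
    unfolding wave_t_def[abs_def] wave_x_def[abs_def]
    by (rule borel_measurable_diff[OF mf mg], rule borel_measurable_add[OF mf mg])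
  have "(\<lambda>t. f (t + x) - g (x - t)) \<in> borel_measurable lebesgue"
    by (rule borel_measurable_diff[OF mf mg'])
  then show "(\<lambda>t. wave_t t x) \<in> borel_measurable lebesgue"
    by (simp add: wave_t_def add.commute)
qed

lemma plane_measurable:
  "(\<lambda>p. wave_t (fst p) (snd p)) \<in> borel_measurable lebesgue"
  "(\<lambda>p. wave_x (fst p) (snd p)) \<in> borel_measurable lebesgue"
proof -
  have "(\<lambda>p. f (snd p + fst p)) \<in> borel_measurable lebesgue" "(\<lambda>p. g (snd p - fst p)) \<in> borel_measurable lebesgue"
    using measurable_travelling[OF f(2), of 1] measurable_travelling[OF g(2), of "-1"] by simp_all
  then show "(\<lambda>p. wave_t (fst p) (snd p)) \<in> borel_measurable lebesgue"
    "(\<lambda>p. wave_x (fst p) (snd p)) \<in> borel_measurable lebesgue"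
    by (simp_all add: wave_t_def wave_x_def)
qed

lemma slice_bounded: "\<bar>wave_t t x\<bar> \<le> 2 * C" "\<bar>wave_x t x\<bar> \<le> 2 * C"
  using f(3)[of "x + t"] g(3)[of "x - t"] by (simp_all add: wave_t_def wave_x_def)

lemma slice_periodic: "periodic (wave_t t)" "periodic (wave_x t)"
  using periodic_compose_affine[OF f(1), of t] periodic_compose_affine[OF g(1), of "- t"]
  by (simp_all add: periodic_def wave_t_def wave_x_def)

lemma slice_L2: "wave_t t \<in> L2" "wave_x t \<in> L2"
  using bounded_L2[OF slice_periodic(1) slice_measurable(1) slice_bounded(1)]
    bounded_L2[OF slice_periodic(2) slice_measurable(2) slice_bounded(2)] by auto

lemma integral_pair:
  fixes h1 h2 :: "real \<Rightarrow> real"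
  assumes "h1 \<in> borel_measurable lebesgue" "\<And>x. \<bar>h1 x\<bar> \<le> C" "h2 \<in> borel_measurable lebesgue" "\<And>x. \<bar>h2 x\<bar> \<le> C"
  shows "(LINT x|lebesgue_on {a..b}. h1 x + h2 x) = (LINT x|lebesgue_on {a..b}. h1 x) + (LINT x|lebesgue_on {a..b}. h2 x)"
    and "(LINT x|lebesgue_on {a..b}. h1 x - h2 x) = (LINT x|lebesgue_on {a..b}. h1 x) - (LINT x|lebesgue_on {a..b}. h2 x)"
  using bounded_integrable_interval[OF assms(1,2)] bounded_integrable_interval[OF assms(3,4)] by simp_all

text \<open>The solution is not differentiable everywhere; being the integral of
  \<open>wave_x\<close> is the form of differentiability that integration by parts requires.\<close>

lemma wave_increment_x:
  assumes "a \<le> b"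
  shows "wave t b - wave t a = (LINT x|lebesgue_on {a..b}. wave_x t x)"
proof -
  have "wave t b - wave t a =
      (LINT y|lebesgue_on {a + t..b + t}. f y) + (LINT y|lebesgue_on {a + (- t)..b + (- t)}. g y)"
    using primitive_diff[OF f(2,3), of "a + t" "b + t"] primitive_diff[OF g(2,3), of "a - t" "b - t"] assms
    by (simp add: wave_def)
  also have "\<dots> = (LINT x|lebesgue_on {a..b}. f (x + t)) + (LINT x|lebesgue_on {a..b}. g (x + (- t)))"
    by (simp only: integral_interval_shift[OF f(2)] integral_interval_shift[OF g(2)])
  also have "\<dots> = (LINT x|lebesgue_on {a..b}. wave_x t x)"
    unfolding wave_x_def
    using integral_pair(1)[OF measurable_affine_real(1)[OF f(2)] f(3) measurable_affine_real(1)[OF g(2)] g(3), of a b t "- t"]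
    by simp
  finally show ?thesis .
qed

lemma wave_increment_t:
  assumes "a \<le> b"
  shows "wave b x - wave a x = (LINT t|lebesgue_on {a..b}. wave_t t x)"
proof -
  have "wave b x - wave a x =
      (LINT y|lebesgue_on {a + x..b + x}. f y) - (LINT y|lebesgue_on {x - b..x - a}. g y)"
    using primitive_diff[OF f(2,3), of "a + x" "b + x"] primitive_diff[OF g(2,3), of "x - b" "x - a"] assms
    by (simp add: wave_def add.commute)
  also have "\<dots> = (LINT t|lebesgue_on {a..b}. f (t + x)) - (LINT t|lebesgue_on {a..b}. g (x - t))"
    by (simp only: integral_interval_shift[OF f(2)] integral_interval_reflect[OF g(2)])
  also have "\<dots> = (LINT t|lebesgue_on {a..b}. wave_t t x)"
    unfolding wave_t_def
    using integral_pair(2)[OF measurable_affine_real(1)[OF f(2)] f(3) measurable_affine_real(2)[OF g(2)] g(3), of a b x x]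
    by (simp add: add.commute)
  finally show ?thesis .
qed

text \<open>The increment over one period is the integral of f plus that of g, since both are
  unaffected by the shifts; \<open>mean\<close> makes it 0.\<close>

lemma wave_periodic: "periodic (wave t)"
proof -
  have "wave t (x + 2 * pi) - wave t x = 0" for x
  proof -
    have "wave t (x + 2 * pi) - wave t x = (LINT y|lebesgue_on {0 + x..2 * pi + x}. wave_x t y)"
      using wave_increment_x[of x "x + 2 * pi" t] by (simp add: add.commute)
    also have "\<dots> = (LINT y|circ. wave_x t (y + x))"
      by (rule integral_interval_shift[OF slice_measurable(2), symmetric])
    also have "\<dots> = (LINT y|circ. wave_x t y)"
      by (rule integral_circ_shift[OF L2_integrable[OF slice_L2(2)] slice_periodic(2)])
    also have "\<dots> = (LINT y|circ. f (y + t)) + (LINT y|circ. g (y + (- t)))"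
      unfolding wave_x_def
      using integral_pair(1)[OF measurable_affine_real(1)[OF f(2)] f(3) measurable_affine_real(1)[OF g(2)] g(3), of 0 "2 * pi" t "- t"]
      by simp
    also have "\<dots> = 0"
      using integral_circ_shift[OF bounded_integrable_interval[OF f(2,3)] f(1), of t]
        integral_circ_shift[OF bounded_integrable_interval[OF g(2,3)] g(1), of "- t"] mean by simp
    finally show ?thesis .
  qed
  then show ?thesis by (simp add: periodic_def)
qed

lemma wave_continuous: "continuous_on UNIV (\<lambda>p. wave (fst p) (snd p))"
  unfolding wave_def
  by (intro continuous_intros continuous_on_compose2[OF primitive_continuous[OF f(2,3)]]
      continuous_on_compose2[OF primitive_continuous[OF g(2,3)]]) auto

lemma wave_slice_continuous: "continuous_on S (wave t)"
  using continuous_on_compose2[OF wave_continuous, of S "\<lambda>x. (t, x)"]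
  by (simp add: continuous_on_Pair)

lemma wave_L2: "wave t \<in> L2"
proof -
  obtain M where "\<And>x. \<bar>wave t x\<bar> \<le> M"
    using periodic_continuous_bounded[OF wave_periodic wave_slice_continuous] by blast
  moreover have "wave t \<in> borel_measurable lebesgue"
    by (intro measurable_completion) (simp add: borel_measurable_continuous_onI wave_slice_continuous)
  ultimately show ?thesis using bounded_L2[OF wave_periodic] by blast
qed

lemma wave_by_parts_x:
  assumes "\<And>x. (\<phi> has_real_derivative \<phi>' x) (at x)" "continuous_on UNIV \<phi>'" "\<phi> (2 * pi) = \<phi> 0"
  shows "(LINT x|circ. wave t x * \<phi>' x) = - (LINT x|circ. wave_x t x * \<phi> x)"
proof -
  have "(LINT x|circ. wave t x * \<phi>' x) =
      wave t (2 * pi) * \<phi> (2 * pi) - wave t 0 * \<phi> 0 - (LINT x|circ. wave_x t x * \<phi> x)"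
  proof (rule integral_by_parts_bounded[OF _ slice_measurable(2) slice_bounded(2) _ assms(1,2)])
    show "wave t x = wave t 0 + (LINT s|lebesgue_on {0..x}. wave_x t s)" if "x \<in> {0..2 * pi}" for x
      using wave_increment_x[of 0 x t] that by simp
  qed simp
  moreover have "wave t (2 * pi) = wave t 0"
    using wave_periodic[of t] unfolding periodic_def by (metis add_0)
  ultimately show ?thesis using assms(3) by simp
qed

lemma wave_weak_deriv: "has_weak_deriv (wave t) (wave_x t)"
  unfolding has_weak_deriv_def
proof (intro allI impI)
  fix \<phi> :: "real \<Rightarrow> real" assume "smooth \<phi> \<and> periodic \<phi>"
  then have \<phi>: "smooth \<phi>" "periodic \<phi>" by auto
  have "\<phi> (2 * pi) = \<phi> 0" using \<phi>(2) unfolding periodic_def by (metis add_0)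
  then show "(LINT x|circ. wave t x * deriv \<phi> x) = - (LINT x|circ. wave_x t x * \<phi> x)"
    by (intro wave_by_parts_x smooth_DERIV[OF \<phi>(1)] smooth_continuous_on[OF smooth_deriv[OF \<phi>(1)]])
qed

lemma travelling_L1_continuous:
  assumes "h \<in> borel_measurable lebesgue" "\<And>x. \<bar>h x\<bar> \<le> C"
  shows "((\<lambda>r. LINT x|circ. \<bar>h (x + s * r) - h (x + s * t)\<bar>) \<longlongrightarrow> 0) (at t within S)"
proof -
  have 1: "((\<lambda>d. LINT x|circ. \<bar>h (x + d) - h (x + s * t)\<bar>) \<longlongrightarrow> 0) (nhds (s * t))"
    by (rule translation_L1_continuous[OF assms]) simp
  have "((\<lambda>r. s * r) \<longlongrightarrow> s * t) (at t within S)" by (intro tendsto_intros)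
  from filterlim_compose[OF 1 this] show ?thesis .
qed

text \<open>Both slices change by at most the sum of the changes of the translated profiles, so one
  estimate \<open>E\<close> serves for \<open>wave_t\<close> and \<open>wave_x\<close>.\<close>

lemma slice_L2_continuous:
  "((\<lambda>r. L2_norm (\<lambda>x. wave_t r x - wave_t t x)) \<longlongrightarrow> 0) (at t within S)"
  "((\<lambda>r. L2_norm (\<lambda>x. wave_x r x - wave_x t x)) \<longlongrightarrow> 0) (at t within S)"
proof -
  define E where "E r = (LINT x|circ. \<bar>f (x + r) - f (x + t)\<bar>) + (LINT x|circ. \<bar>g (x - r) - g (x - t)\<bar>)" for r
  have E: "(E \<longlongrightarrow> 0) (at t within S)"
    using tendsto_add[OF travelling_L1_continuous[OF f(2,3), of 1 t S] travelling_L1_continuous[OF g(2,3), of "-1" t S]]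
    by (simp add: E_def[abs_def])
  have le: "(LINT x|circ. \<bar>k r x - k t x\<bar>) \<le> E r"
    if k: "\<And>r. k r \<in> borel_measurable lebesgue" "\<And>r x. \<bar>k r x\<bar> \<le> 2 * C"
      "\<And>r x. \<bar>k r x - k t x\<bar> \<le> \<bar>f (x + r) - f (x + t)\<bar> + \<bar>g (x - r) - g (x - t)\<bar>" for k r
  proof -
    have i: "integrable circ (\<lambda>x. f (x + d))" "integrable circ (\<lambda>x. g (x - d))" "integrable circ (k d)" for d
      using bounded_integrable_interval[OF measurable_affine_real(1)[OF f(2)] f(3)]
        bounded_integrable_interval[OF measurable_affine_real(1)[OF g(2), of "- d"] g(3)]
        bounded_integrable_interval[OF k(1,2)] by auto
    have "(LINT x|circ. \<bar>k r x - k t x\<bar>) \<le>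
        (LINT x|circ. \<bar>f (x + r) - f (x + t)\<bar> + \<bar>g (x - r) - g (x - t)\<bar>)"
      by (rule integral_mono) (auto intro!: i k(3) Bochner_Integration.integrable_add integrable_abs Bochner_Integration.integrable_diff)
    also have "\<dots> = E r" unfolding E_def
      by (rule Bochner_Integration.integral_add) (auto intro!: i integrable_abs Bochner_Integration.integrable_diff)
    finally show ?thesis .
  qed
  have tends: "((\<lambda>r. L2_norm (\<lambda>x. k r x - k t x)) \<longlongrightarrow> 0) (at t within S)"
    if k: "\<And>r. k r \<in> borel_measurable lebesgue" "\<And>r x. \<bar>k r x\<bar> \<le> 2 * C"
      "\<And>r x. \<bar>k r x - k t x\<bar> \<le> \<bar>f (x + r) - f (x + t)\<bar> + \<bar>g (x - r) - g (x - t)\<bar>" for k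
  proof (rule L2_norm_tendsto_0[where M = "4 * C"])
    show "(\<lambda>x. k r x - k t x) \<in> borel_measurable lebesgue" for r
      using k(1)[of r] k(1)[of t] by measurable
    show "\<bar>k r x - k t x\<bar> \<le> 4 * C" for r x
      using k(2)[of r x] k(2)[of t x] by linarith
    show "((\<lambda>r. LINT x|circ. \<bar>k r x - k t x\<bar>) \<longlongrightarrow> 0) (at t within S)"
      by (rule Lim_null_comparison[OF _ E]) (use le[of k] k in simp)
  qed
  show "((\<lambda>r. L2_norm (\<lambda>x. wave_t r x - wave_t t x)) \<longlongrightarrow> 0) (at t within S)"
    by (rule tends[OF slice_measurable(1) slice_bounded(1)]) (simp add: wave_t_def)
  show "((\<lambda>r. L2_norm (\<lambda>x. wave_x r x - wave_x t x)) \<longlongrightarrow> 0) (at t within S)"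
    by (rule tends[OF slice_measurable(2) slice_bounded(2)]) (simp add: wave_x_def)
qed

lemma wave_L2_continuous:
  assumes "t \<in> {0..T}"
  shows "((\<lambda>r. L2_norm (\<lambda>x. wave r x - wave t x)) \<longlongrightarrow> 0) (at t within {0..T})"
proof -
  have lip: "\<bar>wave r x - wave t x\<bar> \<le> 2 * C * \<bar>r - t\<bar>" for r x
    using primitive_Lipschitz[OF f(2,3), of "x + r" "x + t"] primitive_Lipschitz[OF g(2,3), of "x - r" "x - t"]
    by (simp add: wave_def abs_minus_commute)
  have "L2_norm (\<lambda>x. wave r x - wave t x) \<le> sqrt (2 * pi) * (2 * C * \<bar>r - t\<bar>)" for r
  proof -
    have "(LINT x|circ. (wave r x - wave t x)\<^sup>2) \<le> (LINT x|circ. (2 * C * \<bar>r - t\<bar>)\<^sup>2)"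
    proof (rule integral_mono)
      show "integrable circ (\<lambda>x. (wave r x - wave t x)\<^sup>2)"
        by (rule L2_integrable_square[OF L2_diff[OF wave_L2 wave_L2]])
      show "integrable circ (\<lambda>x. (2 * C * \<bar>r - t\<bar>)\<^sup>2)"
        by (rule integrable_lebesgue_on_continuous) simp
      show "(wave r x - wave t x)\<^sup>2 \<le> (2 * C * \<bar>r - t\<bar>)\<^sup>2" for x
        using power_mono[OF lip[of r x], of 2] by simp
    qed
    also have "\<dots> = 2 * pi * (2 * C * \<bar>r - t\<bar>)\<^sup>2" by simp
    finally have "L2_norm (\<lambda>x. wave r x - wave t x) \<le> sqrt (2 * pi * (2 * C * \<bar>r - t\<bar>)\<^sup>2)"
      by (simp add: L2_norm_def)
    also have "\<dots> = sqrt (2 * pi) * (2 * C * \<bar>r - t\<bar>)"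
      using C_nonneg by (simp add: real_sqrt_mult)
    finally show ?thesis .
  qed
  then have le: "\<forall>\<^sub>F r in at t within {0..T}. norm (L2_norm (\<lambda>x. wave r x - wave t x)) \<le> sqrt (2 * pi) * (2 * C * \<bar>r - t\<bar>)"
    using L2_norm_nonneg by simp
  have "((\<lambda>r. sqrt (2 * pi) * (2 * C * \<bar>r - t\<bar>)) \<longlongrightarrow> sqrt (2 * pi) * (2 * C * \<bar>t - t\<bar>)) (at t within {0..T})"
    by (intro tendsto_intros)
  then have "((\<lambda>r. sqrt (2 * pi) * (2 * C * \<bar>r - t\<bar>)) \<longlongrightarrow> 0) (at t within {0..T})" by simp
  with le show ?thesis by (rule Lim_null_comparison)
qed

lemma wave_curve: "continuous_curve T H1 H1_norm wave"
  unfolding continuous_curve_def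
proof (intro conjI ballI)
  show "wave t \<in> H1" for t
    using wave_L2 wave_weak_deriv slice_L2(2) by (auto simp: H1_def)
  fix t assume t: "t \<in> {0..T}"
  have "H1_norm (\<lambda>x. wave r x - wave t x) =
      sqrt ((L2_norm (\<lambda>x. wave r x - wave t x))\<^sup>2 + (L2_norm (\<lambda>x. wave_x r x - wave_x t x))\<^sup>2)" for r
  proof (rule H1_norm_eq[OF L2_diff[OF slice_L2(2) slice_L2(2)]])
    show "has_weak_deriv (\<lambda>x. wave r x - wave t x) (\<lambda>x. wave_x r x - wave_x t x)"
      unfolding has_weak_deriv_def
    proof (intro allI impI)
      fix \<phi> :: "real \<Rightarrow> real" assume \<phi>: "smooth \<phi> \<and> periodic \<phi>"
      then have c: "continuous_on {0..2 * pi} \<phi>" "continuous_on {0..2 * pi} (deriv \<phi>)"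
        using smooth_continuous_on smooth_deriv by auto
      have i: "integrable circ (\<lambda>x. wave d x * deriv \<phi> x)" "integrable circ (\<lambda>x. wave_x d x * \<phi> x)" for d
        by (rule integrable_mult_continuous[OF L2_integrable[OF wave_L2] c(2)],
            rule integrable_mult_continuous[OF L2_integrable[OF slice_L2(2)] c(1)])
      show "(LINT x|circ. (wave r x - wave t x) * deriv \<phi> x) =
          - (LINT x|circ. (wave_x r x - wave_x t x) * \<phi> x)"
        using wave_weak_deriv[of r] wave_weak_deriv[of t] \<phi> i
        by (simp add: has_weak_deriv_def left_diff_distrib)
    qed
  qed
  moreover have "((\<lambda>r. sqrt ((L2_norm (\<lambda>x. wave r x - wave t x))\<^sup>2 + (L2_norm (\<lambda>x. wave_x r x - wave_x t x))\<^sup>2))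
      \<longlongrightarrow> sqrt (0\<^sup>2 + 0\<^sup>2)) (at t within {0..T})"
    by (intro tendsto_intros wave_L2_continuous[OF t] slice_L2_continuous)
  ultimately show "((\<lambda>r. H1_norm (\<lambda>x. wave r x - wave t x)) \<longlongrightarrow> 0) (at t within {0..T})"
    by simp
qed

lemma wave_t_curve: "continuous_curve T L2 L2_norm wave_t"
  unfolding continuous_curve_def using slice_L2(1) slice_L2_continuous(1) by simp

lemma cyl_integrable:
  "integrable (cyl T) (\<lambda>p. wave (fst p) (snd p))"
  "integrable (cyl T) (\<lambda>p. wave_t (fst p) (snd p))"
  "integrable (cyl T) (\<lambda>p. wave_x (fst p) (snd p))"
  by (rule integrable_cyl_continuous[OF wave_continuous],
      rule integrable_cyl_bounded[OF plane_measurable(1) slice_bounded(1)],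
      rule integrable_cyl_bounded[OF plane_measurable(2) slice_bounded(2)])

text \<open>Taking time as the inner variable reduces to integration by parts at fixed x, without
  boundary terms because \<phi> vanishes at times 0 and T.\<close>

lemma wave_pairing_t:
  assumes \<phi>: "test_fun T \<phi>"
  shows "cyl_pairing T wave (d_t \<phi>) = - cyl_pairing T wave_t \<phi>"
proof -
  note sm = test_fun_smooth[OF \<phi>]
  have c: "continuous_on UNIV \<phi>" "continuous_on UNIV (d_t \<phi>)"
    using smooth_continuous_on[OF sm] smooth_continuous_on[OF smooth_dir_deriv[OF sm]] by (auto simp: Basis_prod_def)
  have "cyl_pairing T wave (d_t \<phi>) = (LINT x|circ. LINT t|lebesgue_on {0..T}. wave t x * d_t \<phi> (t, x))"
    unfolding cyl_pairing_def
    using Fubini_lebesgue_on(2)[OF _ _ integrable_cyl_mult[OF cyl_integrable(1) c(2)]] by simp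
  also have "\<dots> = (LINT x|circ. - (LINT t|lebesgue_on {0..T}. wave_t t x * \<phi> (t, x)))"
  proof (rule Bochner_Integration.integral_cong[OF refl])
    fix x
    have "(LINT t|lebesgue_on {0..T}. wave t x * d_t \<phi> (t, x)) =
        wave T x * \<phi> (T, x) - wave 0 x * \<phi> (0, x) - (LINT t|lebesgue_on {0..T}. wave_t t x * \<phi> (t, x))"
    proof (rule integral_by_parts_bounded[OF _ slice_measurable(3) slice_bounded(1)])
      show "wave t x = wave 0 x + (LINT s|lebesgue_on {0..t}. wave_t s x)" if "t \<in> {0..T}" for t
        using wave_increment_t[of 0 t x] that by simp
      show "continuous_on UNIV (\<lambda>t. d_t \<phi> (t, x))"
        by (intro continuous_on_compose2[OF c(2)] continuous_intros) auto
    qed (use T smooth_test_slice(1)[OF sm] in auto)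
    then show "(LINT t|lebesgue_on {0..T}. wave t x * d_t \<phi> (t, x)) = - (LINT t|lebesgue_on {0..T}. wave_t t x * \<phi> (t, x))"
      using test_fun_at_ends[OF \<phi>] T by simp
  qed
  also have "\<dots> = - cyl_pairing T wave_t \<phi>"
    unfolding cyl_pairing_def
    using Fubini_lebesgue_on(2)[OF _ _ integrable_cyl_mult[OF cyl_integrable(2) c(1)]] by simp
  finally show ?thesis .
qed

lemma wave_pairing_x:
  assumes \<phi>: "test_fun T \<phi>"
  shows "cyl_pairing T wave (d_x (d_x \<phi>)) = - cyl_pairing T wave_x (d_x \<phi>)"
proof -
  note sm = test_fun_smooth[OF \<phi>]
  have sx: "smooth (d_x \<phi>)" using sm by (rule smooth_dir_deriv) (simp add: Basis_prod_def)
  have c: "continuous_on UNIV (d_x \<phi>)" "continuous_on UNIV (d_x (d_x \<phi>))"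
    using smooth_continuous_on[OF sx] smooth_continuous_on[OF smooth_dir_deriv[OF sx]] by (auto simp: Basis_prod_def)
  have "(LINT x|circ. wave t x * d_x (d_x \<phi>) (t, x)) = - (LINT x|circ. wave_x t x * d_x \<phi> (t, x))" for t
  proof (rule wave_by_parts_x)
    show "((\<lambda>x. d_x \<phi> (t, x)) has_real_derivative d_x (d_x \<phi>) (t, x)) (at x)" for x
      by (rule smooth_test_slice(2)[OF sx])
    show "continuous_on UNIV (\<lambda>x. d_x (d_x \<phi>) (t, x))"
      by (intro continuous_on_compose2[OF c(2)] continuous_intros) auto
    show "d_x \<phi> (t, 2 * pi) = d_x \<phi> (t, 0)"
      using d_x_periodic[OF \<phi>, of t 0] by simp
  qed
  then show ?thesis
    by (simp add: cyl_pairing_iterated[OF cyl_integrable(1) c(2)] cyl_pairing_iterated[OF cyl_integrable(3) c(1)])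
qed

text \<open>Regrouping by profiles, the difference of the integrands is f (x + t) times (d_t - d_x)
  \<phi> minus g (x - t) times (d_t + d_x) \<phi>. Each product integrates to 0 by
  \<open>travelling_pairing\<close>.\<close>

lemma wave_pairing_tx:
  assumes \<phi>: "test_fun T \<phi>"
  shows "cyl_pairing T wave_t (d_t \<phi>) = cyl_pairing T wave_x (d_x \<phi>)"
proof -
  note sm = test_fun_smooth[OF \<phi>]
  have c: "continuous_on UNIV (d_t \<phi>)" "continuous_on UNIV (d_x \<phi>)"
    using smooth_continuous_on[OF smooth_dir_deriv[OF sm]] by (auto simp: Basis_prod_def)
  let ?M = "cyl T"
  have int: "integrable ?M (\<lambda>p. h (snd p + s * fst p))"
    if "h \<in> borel_measurable lebesgue" "\<And>x. \<bar>h x\<bar> \<le> C" for h s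
    using integrable_cyl_bounded[of "\<lambda>t x. h (x + s * t)"] measurable_travelling[OF that(1)] that(2) by blast
  define P where "P s h p = h (snd p + s * fst p) * (d_t \<phi> p - s * d_x \<phi> p)" for s and h :: "real \<Rightarrow> real" and p
  have i: "integrable ?M (P s f)" "integrable ?M (P s g)" for s
    unfolding P_def by (intro integrable_cyl_mult int f g continuous_intros c)+
  have "cyl_pairing T wave_t (d_t \<phi>) - cyl_pairing T wave_x (d_x \<phi>) =
      (LINT p|?M. wave_t (fst p) (snd p) * d_t \<phi> p - wave_x (fst p) (snd p) * d_x \<phi> p)"
    unfolding cyl_pairing_def
    using integrable_cyl_mult[OF cyl_integrable(2) c(1)] integrable_cyl_mult[OF cyl_integrable(3) c(2)] by simp
  also have "\<dots> = (LINT p|?M. P 1 f p - P (-1) g p)"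
    by (intro Bochner_Integration.integral_cong refl)
      (simp add: P_def wave_t_def wave_x_def algebra_simps)
  also have "\<dots> = (LINT p|?M. P 1 f p) - (LINT p|?M. P (-1) g p)"
    using i by simp
  also have "\<dots> = 0"
    using travelling_pairing[OF f \<phi> T, of 1] travelling_pairing[OF g \<phi> T, of "-1"]
    unfolding cyl_pairing_def P_def by simp
  finally show ?thesis by simp
qed

text \<open>Only one derivative is moved at a time: the second-order pairings become
  \<open>wave_t\<close> against \<open>d_t \<phi>\<close> and \<open>wave_x\<close> against
  \<open>d_x \<phi>\<close>, which are equal. The profiles themselves are never
  differentiated.\<close>

lemma wave_solution: "wave_solution T (wave 0) (wave_t 0) wave wave_t"
  unfolding wave_solution_def
proof (intro conjI allI impI)
  show "jointly_measurable T wave"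
    unfolding jointly_measurable_def
    by (intro measurable_restrict_space1 measurable_completion)
      (simp add: borel_measurable_continuous_onI wave_continuous)
  show "jointly_measurable T wave_t"
    unfolding jointly_measurable_def by (intro measurable_restrict_space1 plane_measurable)
  show "continuous_curve T H1 H1_norm wave" by (rule wave_curve)
  show "continuous_curve T L2 L2_norm wave_t" by (rule wave_t_curve)
  fix \<phi> assume \<phi>: "test_fun T \<phi>"
  show "cyl_pairing T wave (d_t \<phi>) = - cyl_pairing T wave_t \<phi>"
    by (rule wave_pairing_t[OF \<phi>])
  note sm = test_fun_smooth[OF \<phi>]
  have s: "smooth (d_t \<phi>)" "smooth (d_x \<phi>)"
    by (rule smooth_dir_deriv[OF sm]; simp add: Basis_prod_def)+
  have c: "continuous_on UNIV (d_t (d_t \<phi>))" "continuous_on UNIV (d_x (d_x \<phi>))"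
    by (rule smooth_continuous_on[OF smooth_dir_deriv]; simp add: s Basis_prod_def)+
  have "cyl_pairing T wave (\<lambda>p. d_t (d_t \<phi>) p - d_x (d_x \<phi>) p) =
      cyl_pairing T wave (d_t (d_t \<phi>)) - cyl_pairing T wave (d_x (d_x \<phi>))"
    unfolding cyl_pairing_def
    using integrable_cyl_mult[OF cyl_integrable(1) c(1)] integrable_cyl_mult[OF cyl_integrable(1) c(2)]
    by (simp add: right_diff_distrib)
  also have "\<dots> = 0"
    using wave_pairing_t[OF test_fun_d_t[OF \<phi>]] wave_pairing_x[OF \<phi>] wave_pairing_tx[OF \<phi>] by simp
  finally show "cyl_pairing T wave (\<lambda>p. d_t (d_t \<phi>) p - d_x (d_x \<phi>) p) = 0" .
qed auto

text \<open>If F (x + t) + G (x - t) = c for all small t, the two arguments vary independently and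
  both primitives are constant. Integration by parts then shows that their densities are orthogonal
  to all test functions.\<close>

lemma wave_constant_imp:
  assumes c: "\<And>t. t \<in> {0..T} \<Longrightarrow> AE x in lebesgue. wave t x = c"
  shows "AE x in circ. f x = 0" and "AE x in circ. g x = 0"
proof -
  \<comment> \<open>By continuity the set of failure is open, and a negligible open set is
    empty.\<close>
  have eq: "wave t x = c" if "t \<in> {0..T}" for t x
  proof (rule ccontr)
    assume ne: "wave t x \<noteq> c"
    have "open {x. wave t x \<noteq> c}"
      by (intro open_Collect_neq wave_slice_continuous continuous_on_const)
    moreover have "negligible {x. wave t x \<noteq> c}"
      using c[OF that] by (simp add: negligible_iff_null_sets completion.null_sets_iff_AE)
    ultimately show False using open_not_negligible ne by blast
  qed
  let ?F = "primitive f" and ?G = "primitive g"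
  have FG: "?F x + ?G x = c" for x
    using eq[of 0 x] T by (simp add: wave_def)
  \<comment> \<open>At time r / 2 and position x + r / 2 the arguments are x + r and x; comparison
    with time 0 eliminates G. The range of r is what times up to T allow.\<close>
  have local: "?F (x + r) = ?F x" if "0 \<le> r" "r \<le> 2 * T" for x r
  proof -
    have "?F (x + r / 2 + r / 2) + ?G (x + r / 2 - r / 2) = c"
      using eq[of "r / 2" "x + r / 2"] that by (simp add: wave_def)
    then have "?F (x + r) + ?G x = c" by (simp add: add.assoc)
    then show ?thesis using FG[of x] by simp
  qed
  have step: "?F (x + real n * T) = ?F x" for n x
  proof (induction n)
    case (Suc n)
    then show ?case using local[of T "x + real n * T"] T by (simp add: algebra_simps)
  qed simp
  have up: "?F (x + r) = ?F x" if "r \<ge> 0" for x r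
  proof -
    \<comment> \<open>After n steps of length T the remainder is less than T, hence within the range
      of \<open>local\<close>.\<close>
    define n where "n = nat \<lfloor>r / T\<rfloor>"
    have "real n \<le> r / T" "r / T < real n + 1"
      using that T by (auto simp: n_def of_nat_nat)
    then have "0 \<le> r - real n * T" "r - real n * T \<le> 2 * T"
      using T by (auto simp: field_simps)
    from local[OF this, of "x + real n * T"] show ?thesis using step[of x n] by simp
  qed
  have F: "?F x = ?F 0" for x
    using up[of x 0] up[of "- x" x] by (cases "x \<ge> 0") auto
  have zero: "AE x in circ. h x = 0"
    if h: "h \<in> borel_measurable lebesgue" "\<And>x. \<bar>h x\<bar> \<le> C" and const: "\<And>x. primitive h x = primitive h 0" for h
  proof (rule circ_fundamental_lemma)
    show "integrable circ h" by (rule bounded_integrable_interval[OF h])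
    fix \<psi> :: "real \<Rightarrow> real" assume \<psi>: "smooth \<psi>" "periodic \<psi>"
    have "(LINT x|circ. primitive h x * deriv \<psi> x) =
        primitive h (2 * pi) * \<psi> (2 * pi) - primitive h 0 * \<psi> 0 - (LINT x|circ. h x * \<psi> x)"
    proof (rule integral_by_parts_bounded[OF _ h])
      show "primitive h x = primitive h 0 + (LINT s|lebesgue_on {0..x}. h s)" if "x \<in> {0..2 * pi}" for x
        using primitive_diff[OF h, of 0 x] that by simp
    qed (use smooth_DERIV[OF \<psi>(1)] smooth_continuous_on[OF smooth_deriv[OF \<psi>(1)]] in auto)
    moreover have "(LINT x|circ. primitive h x * deriv \<psi> x) = primitive h 0 * (\<psi> (2 * pi) - \<psi> 0)"
      using FTC_lebesgue_on[of 0 "2 * pi" \<psi> "deriv \<psi>"] smooth_DERIV[OF \<psi>(1)]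
        smooth_continuous_on[OF smooth_deriv[OF \<psi>(1)]] by (subst const) simp
    ultimately show "(LINT x|circ. h x * \<psi> x) = 0"
      by (simp add: const[of "2 * pi"] right_diff_distrib)
  qed
  show "AE x in circ. f x = 0" by (rule zero[OF f(2,3) F])
  have G: "?G x = ?G 0" for x
    using FG[of x] FG[of 0] F[of x] by simp
  show "AE x in circ. g x = 0" by (rule zero[OF g(2,3) G])
qed

end

section \<open>From unique continuation to (OSC)\<close>

definition periodization :: "real set \<Rightarrow> real set" where
  "periodization A = {y. \<exists>a\<in>A. \<exists>k::int. y = a + 2 * pi * of_int k}"

lemma periodization_iff: "y \<in> periodization A \<longleftrightarrow> (\<exists>k::int. y + 2 * pi * of_int k \<in> A)"
proof
  assume "y \<in> periodization A"
  then obtain a and k :: int where "a \<in> A" "y = a + 2 * pi * of_int k"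
    by (auto simp: periodization_def)
  then have "y + 2 * pi * of_int (- k) \<in> A" by simp
  then show "\<exists>k::int. y + 2 * pi * of_int k \<in> A" by blast
next
  assume "\<exists>k::int. y + 2 * pi * of_int k \<in> A"
  then obtain k :: int where "y + 2 * pi * of_int k \<in> A" by blast
  then show "y \<in> periodization A"
    unfolding periodization_def
    by (intro CollectI bexI[of _ "y + 2 * pi * of_int k"] exI[of _ "- k"]) auto
qed

lemma periodization_measurable:
  assumes "A \<in> sets lebesgue"
  shows "periodization A \<in> sets lebesgue"
proof -
  have "periodization A = (\<Union>k::int. (\<lambda>y. y + 2 * pi * of_int k) -` A \<inter> space lebesgue)"
    by (auto simp: periodization_iff)
  also have "\<dots> \<in> sets lebesgue"
    by (intro sets.countable_UN''[OF countableI_type] measurable_sets[OF measurable_shift assms])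
  finally show ?thesis .
qed

lemma periodization_shift: "y + 2 * pi \<in> periodization A \<longleftrightarrow> y \<in> periodization A"
proof -
  have 1: "y + 2 * pi + 2 * pi * of_int k = y + 2 * pi * of_int (k + 1)" for k :: int
    by (simp add: algebra_simps)
  have 2: "y + 2 * pi * of_int k = y + 2 * pi + 2 * pi * of_int (k - 1)" for k :: int
    by (simp add: algebra_simps)
  show ?thesis unfolding periodization_iff using 1 2 by metis
qed

text \<open>The endpoints 0 and 2 pi are the same point of the circle, but A may contain just one of
  them. Inside the open period a nonzero multiple of 2 pi leads out of [0, 2 pi].\<close>

lemma AE_periodization:
  assumes "A \<subseteq> {0..2 * pi}"
  shows "AE x in circ. x \<in> periodization A \<longleftrightarrow> x \<in> A"
proof -
  have "AE x in lebesgue. x \<noteq> 0 \<and> x \<noteq> 2 * pi"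
    by (intro AE_completion) (auto intro!: AE_conjI AE_lborel_singleton)
  then show ?thesis
    unfolding AE_circ_iff
  proof eventually_elim
    case (elim x)
    show ?case
    proof
      assume x: "x \<in> {0..2 * pi}"
      show "x \<in> periodization A \<longleftrightarrow> x \<in> A"
      proof
        assume "x \<in> periodization A"
        then obtain k :: int where k: "x + 2 * pi * of_int k \<in> A" by (auto simp: periodization_iff)
        then have "0 \<le> x + 2 * pi * of_int k" "x + 2 * pi * of_int k \<le> 2 * pi" using assms by auto
        moreover have "2 * pi \<le> 2 * pi * of_int k" if "k \<ge> 1"
          using mult_left_mono[of 1 "real_of_int k" "2 * pi"] that by simp
        moreover have "2 * pi * of_int k \<le> - (2 * pi)" if "k \<le> - 1"
          using mult_left_mono[of "real_of_int k" "- 1" "2 * pi"] that by simp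
        ultimately have "\<not> k \<ge> 1" "\<not> k \<le> - 1" using x elim by fastforce+
        then have "k = 0" by linarith
        with k show "x \<in> A" by simp
      next
        assume "x \<in> A"
        then have "x + 2 * pi * of_int 0 \<in> A" by simp
        then show "x \<in> periodization A" unfolding periodization_iff by blast
      qed
    qed
  qed
qed

lemma unique_continuation_imp_OSC:
  assumes T: "T > 0" and G: "G \<in> sets lebesgue" "G \<subseteq> {0..T} \<times> {0..2 * pi}"
    and uc: "unique_continuation T G"
  shows "OSC T G"
  unfolding OSC_def
proof (intro allI impI notI, elim conjE)
  fix A B
  assume A: "A \<in> sets lebesgue" "A \<subseteq> {0..2 * pi}" and B: "B \<in> sets lebesgue" "B \<subseteq> {0..2 * pi}"
    and nontriv: "\<not> trivial_pair A B" and sym: "observable_symmetric A B T G"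
  define \<alpha> where "\<alpha> = (indicator (periodization A) :: real \<Rightarrow> real)"
  define \<beta> where "\<beta> = (indicator (periodization B) :: real \<Rightarrow> real)"
  \<comment> \<open>Subtracting the common mean leaves the difference of the two waves unchanged and makes the primitive periodic.\<close>
  define m where "m = ((LINT x|circ. \<alpha> x) + (LINT x|circ. \<beta> x)) / (4 * pi)"
  define f where "f x = \<alpha> x - m" for x
  define g where "g x = \<beta> x - m" for x
  have m\<alpha>: "\<alpha> \<in> borel_measurable lebesgue" "\<beta> \<in> borel_measurable lebesgue"
    unfolding \<alpha>_def \<beta>_def using periodization_measurable A(1) B(1) by auto
  have f: "periodic f" "f \<in> borel_measurable lebesgue" "\<And>x. \<bar>f x\<bar> \<le> 1 + \<bar>m\<bar>"
  proof -
    show "periodic f" by (simp add: f_def \<alpha>_def periodic_def periodization_shift indicator_def)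
    show "f \<in> borel_measurable lebesgue"
      unfolding f_def by (intro borel_measurable_diff m\<alpha> borel_measurable_const)
    show "\<bar>f x\<bar> \<le> 1 + \<bar>m\<bar>" for x by (auto simp: f_def \<alpha>_def indicator_def abs_if)
  qed
  have g: "periodic g" "g \<in> borel_measurable lebesgue" "\<And>x. \<bar>g x\<bar> \<le> 1 + \<bar>m\<bar>"
  proof -
    show "periodic g" by (simp add: g_def \<beta>_def periodic_def periodization_shift indicator_def)
    show "g \<in> borel_measurable lebesgue"
      unfolding g_def by (intro borel_measurable_diff m\<alpha> borel_measurable_const)
    show "\<bar>g x\<bar> \<le> 1 + \<bar>m\<bar>" for x by (auto simp: g_def \<beta>_def indicator_def abs_if)
  qed
  have i: "integrable circ \<alpha>" "integrable circ \<beta>" "integrable circ (\<lambda>_. m)"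
    by (rule bounded_integrable_interval[OF m\<alpha>(1), of 1], simp add: \<alpha>_def indicator_def,
        rule bounded_integrable_interval[OF m\<alpha>(2), of 1], simp add: \<beta>_def indicator_def,
        rule integrable_lebesgue_on_continuous, simp)
  have mean: "(LINT x|circ. f x) + (LINT x|circ. g x) = 0"
  proof -
    have "(LINT x|circ. f x) + (LINT x|circ. g x) = (LINT x|circ. \<alpha> x) + (LINT x|circ. \<beta> x) - 4 * pi * m"
      unfolding f_def g_def using i by simp
    then show ?thesis by (simp add: m_def)
  qed
  let ?u = "wave f g" and ?v = "wave_t f g"
  have init: "?u 0 \<in> H1" "?v 0 \<in> L2"
    using wave_curve[OF T f g mean] wave_t_curve[OF T f g mean] T
    by (auto simp: continuous_curve_def)
  have sol: "wave_solution T (?u 0) (?v 0) ?u ?v"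
    by (rule wave_solution[OF T f g mean])
  have vG: "AE p in lebesgue. p \<in> G \<longrightarrow> ?v (fst p) (snd p) = 0"
  proof -
    have "AE p in lebesgue. p \<notin> sym_diff (G \<inter> L_xi_set T A) (G \<inter> L_eta_set T B)"
      using sym unfolding observable_symmetric_def by (rule AE_not_in)
    then show ?thesis
    proof eventually_elim
      case (elim p)
      obtain t x where p: "p = (t, x)" by (cases p)
      have "?v t x = 0" if "(t, x) \<in> G"
      proof -
        have "t \<in> {0..T}" using G(2) that by auto
        \<comment> \<open>Outside the exceptional null set, a point of G lies in both strips or in
          neither, so the two indicators agree there and the constant m cancels in the time
          derivative.\<close>
        then have "x + t \<in> periodization A \<longleftrightarrow> x - t \<in> periodization B"
          using elim that unfolding p L_xi_set_def L_eta_set_def periodization_def by auto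
        then show ?thesis
          by (simp add: wave_t_def[OF T f g mean] f_def g_def \<alpha>_def \<beta>_def indicator_def)
      qed
      then show ?case by (simp add: p)
    qed
  qed
  have "\<exists>c. \<forall>t\<in>{0..T}. AE x in lebesgue. ?u t x = c"
    by (rule uc[unfolded unique_continuation_def, THEN bspec, OF init(1), THEN bspec, OF init(2),
          THEN spec, THEN spec, THEN mp, OF sol, THEN mp, OF vG])
  then obtain c where c: "\<And>t. t \<in> {0..T} \<Longrightarrow> AE x in lebesgue. ?u t x = c" by blast
  have fg: "AE x in circ. \<alpha> x = m" "AE x in circ. \<beta> x = m"
    using wave_constant_imp[OF T f g mean c] by (simp_all add: f_def g_def)
  have AB: "AE x in circ. (if x \<in> A then 1 else 0) = m \<and> (if x \<in> B then 1 else 0) = m"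
    using fg AE_periodization[OF A(2)] AE_periodization[OF B(2)]
    by eventually_elim (auto simp: \<alpha>_def \<beta>_def indicator_def)
  have "trivial_pair A B"
  \<comment> \<open>Almost everywhere both indicators equal the same number m: if it is 0 both sets
    are null, and otherwise no point outside A or B is possible, so both sets are full.\<close>
  proof (cases "m = 0")
    case True
    have "AE x in circ. x \<notin> A" "AE x in circ. x \<notin> B"
      using AB unfolding True by (eventually_elim; auto split: if_splits)+
    then show ?thesis
      using measure_eq_0_iff_AE_circ[OF A] measure_eq_0_iff_AE_circ[OF B] by (simp add: trivial_pair_def)
  next
    case False
    have "AE x in circ. x \<in> A" "AE x in circ. x \<in> B"
      using AB by (eventually_elim; use False in \<open>auto split: if_splits\<close>)+
    then show ?thesis
      using measure_eq_2pi_iff_AE_circ[OF A] measure_eq_2pi_iff_AE_circ[OF B] by (simp add: trivial_pair_def)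
  qed
  with nontriv show False ..
qed

theorem theorem1p3:
  fixes T :: real and G :: "(real \<times> real) set"
  assumes "T > 0"
    and "G \<in> sets lebesgue"
    and "G \<subseteq> {0..T} \<times> {0..2 * pi}"
  shows "unique_continuation T G \<longleftrightarrow> OSC T G \<and> weak_GCC G"
  using unique_continuation_imp_OSC[OF assms] OSC_imp_weak_GCC[OF assms(2,3)]
    OSC_imp_unique_continuation[OF assms] by blast

end
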